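(* Let $q$ be a power of a prime $p$ and let $U$ be the Sylow $p$-subgroup of the Steinberg triality group ${}^3D_4(q^3)$, with root subgroups $Y_1,\dots,Y_6$ and with the subsets $\mathfrak{F}_6,\mathfrak{F}_5,\mathfrak{F}_4,\mathfrak{F}_3,\mathfrak{F}_{lin}$ of $\mathrm{Irr}(U)$ described in the context. Then $\mathrm{Irr}(U)$ is the disjoint union of the five families $\mathfrak{F}_6,\mathfrak{F}_5,\mathfrak{F}_4,\mathfrak{F}_3,\mathfrak{F}_{lin}$, and these families are as follows. 1. $\mathfrak{F}_6=\{\chi_{6,q^4}^{a,b} : (a,b)\in \mathbb{F}_q^\times\times\mathbb{F}_{q^3}\}$ consists of exactly $(q-1)q^3$ characters, all of degree $q^4$. 2. $\mathfrak{F}_5=\{\chi_{5,q^3}^{a_1,a_2,b} : (a_1,a_2,b)\in \mathbb{F}_q^\times\times\mathbb{F}_q\times\mathbb{F}_{q^3}\}$ consists of exactly $(q-1)q^4$ characters, all of degree $q^3$. 3. If $q$ is odd, then $\mathfrak{F}_4=\mathfrak{F}_4^{odd}=\{\chi_{4,q^3}^{b,a} : (b,a)\in \mathbb{F}_{q^3}^\times\times\mathbb{F}_q\}$ consists of exactly $(q^3-1)q$ characters, all of degree $q^3$. If $q$ is even, then $\mathfrak{F}_4=\mathfrak{F}_4^{even}$ consists of exactly $q^3-1$ characters $\chi_{4,q^3}^{b}$, $b\in\mathbb{F}_{q^3}^\times$, of degree $q^3$, together with exactly $4(q^3-1)(q-1)$ characters $\chi_{4,q^3/2}^{b,a,c_1,c_2}$,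 $(b,a,c_1,c_2)\in\mathbb{F}_{q^3}^\times\times\mathbb{F}_q^\times\times\mathbb{F}_2\times\mathbb{F}_2$, of degree $q^3/2$, and no others. 4. $\mathfrak{F}_3=\{\chi_{3,q}^{b_1,b_2} : (b_1,b_2)\in\mathbb{F}_{q^3}^\times\times(\mathbb{F}_{q^3}/\mathbb{F}_q)\}$ consists of exactly $(q^3-1)q^2$ characters, all of degree $q$. 5. $\mathfrak{F}_{lin}=\{\chi_{lin}^{b,a} : (b,a)\in\mathbb{F}_{q^3}\times\mathbb{F}_q\}$ consists of exactly $q^4$ characters, all of degree $1$. In each case the characters with distinct parameters in the indicated parameter set are distinct, i.e. the parameter set indexes the listed characters bijectively.
   Context: $\mathrm{Irr}(G)$ is the set of complex irreducible characters of a finite group $G$, and $\ker(\chi)=\{g\in G:\chi(g)=\chi(1)\}$. For a field $\mathbb{F}$, $\mathbb{F}^\times=\mathbb{F}\setminus\{0\}$; $\mathbb{F}_{q^3}/\mathbb{F}_q$ denotes the quotient of additive groups. The group commutator is $[x,y]=x^{-1}y^{-1}xy$. The group $U$. Let $U\!D_4(q^3)$ be the Sylow $p$-subgroup (maximal unipotent subgroup) of the Chevalley group $D_4(q^3)$ generated by the root elements $x_i(t)=x_{\alpha_i}(t)$, $1\le i\le 12$, $t\in\mathbb{F}_{q^3}$, where $\alpha_1,\dots,\alpha_{12}$ are the positive roots of type $D_4$: $\alpha_1$ is the simple root at the central node, $\alpha_2,\alpha_3,\alpha_4$ are the other simple roots, $\alpha_5=\alpha_1+\alpha_2$, $\alpha_6=\alpha_1+\alpha_3$,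 $\alpha_7=\alpha_1+\alpha_4$, $\alpha_8=\alpha_1+\alpha_2+\alpha_3$, $\alpha_9=\alpha_1+\alpha_3+\alpha_4$, $\alpha_{10}=\alpha_1+\alpha_2+\alpha_4$, $\alpha_{11}=\alpha_1+\alpha_2+\alpha_3+\alpha_4$, $\alpha_{12}=2\alpha_1+\alpha_2+\alpha_3+\alpha_4$. Every element is uniquely a product $x_1(t_1)\cdots x_{12}(t_{12})$, one has $x_i(t)x_i(u)=x_i(t+u)$, and the structure constants are chosen so that $[x_1(t),x_2(u)]=x_5(tu)$, $[x_1(t),x_3(u)]=x_6(tu)$, $[x_1(t),x_4(u)]=x_7(tu)$, $[x_1(t),x_{11}(u)]=x_{12}(tu)$, $[x_2(t),x_6(u)]=x_8(tu)$, $[x_2(t),x_7(u)]=x_{10}(tu)$, $[x_2(t),x_9(u)]=x_{11}(tu)$, $[x_3(t),x_5(u)]=x_8(tu)$, $[x_3(t),x_7(u)]=x_9(tu)$, $[x_3(t),x_{10}(u)]=x_{11}(tu)$, $[x_4(t),x_5(u)]=x_{10}(tu)$, $[x_4(t),x_6(u)]=x_9(tu)$, $[x_4(t),x_8(u)]=x_{11}(tu)$, $[x_5(t),x_9(u)]=x_{12}(tu)$, $[x_6(t),x_{10}(u)]=x_{12}(tu)$, $[x_7(t),x_8(u)]=x_{12}(tu)$, where all $[x_i(t),x_j(u)]$ with neither $[x_i,x_j]$ nor $[x_j,x_i]$ listed are $1$. Let $\gamma=(2,3,4)(5,6,7)(8,9,10)$ and let $\sigma$ be the automorphism of $U\!D_4(q^3)$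 with $\sigma(x_i(t))=x_{\gamma(i)}(t^q)$ (triality graph automorphism composed with a field automorphism of order 3). Then $U$, a Sylow $p$-subgroup of ${}^3D_4(q^3)$, is the subgroup of $\sigma$-fixed points of $U\!D_4(q^3)$; it has order $q^{12}$. Root subgroups of $U$. With $\bar t=t^q$ and $\bar{\bar t}=t^{q^2}$: $Y_1=\{x_1(t):t\in\mathbb{F}_q\}$, $Y_2=\{x_2(t)x_3(\bar t)x_4(\bar{\bar t}):t\in\mathbb{F}_{q^3}\}$, $Y_3=\{x_5(t)x_6(\bar t)x_7(\bar{\bar t}):t\in\mathbb{F}_{q^3}\}$, $Y_4=\{x_8(t)x_9(\bar t)x_{10}(\bar{\bar t}):t\in\mathbb{F}_{q^3}\}$, $Y_5=\{x_{11}(t):t\in\mathbb{F}_q\}$, $Y_6=\{x_{12}(t):t\in\mathbb{F}_q\}$. $U$ is generated by $Y_1,\dots,Y_6$. Families of characters: $\mathfrak{F}_6=\{\chi\in\mathrm{Irr}(U):Y_6\not\subset\ker(\chi)\}$; $\mathfrak{F}_5=\{\chi\in\mathrm{Irr}(U):Y_5\not\subset\ker(\chi),\ Y_6\le\ker(\chi)\}$; $\mathfrak{F}_4=\{\chi\in\mathrm{Irr}(U):Y_4\not\subset\ker(\chi),\ Y_5Y_6\le\ker(\chi)\}$, denoted $\mathfrak{F}_4^{odd}$ when $q$ is odd and $\mathfrak{F}_4^{even}$ when $q$ is even; $\mathfrak{F}_3=\{\chi\in\mathrm{Irr}(U):Y_3\not\subset\ker(\chi),\ Y_4Y_5Y_6\le\ker(\chi)\}$;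 $\mathfrak{F}_{lin}=\{\chi\in\mathrm{Irr}(U):Y_3Y_4Y_5Y_6\le\ker(\chi)\}$, which is the set of linear characters of $U$. The symbols $\chi_{i,d}^{\ast}$ are names for the characters: the lower indices give the family and the degree, and the upper indices are the parameters that determine the character uniquely within its list. *)

theory Defs
  imports
    "HOL-Algebra.Coset"
    "HOL-Library.FuncSet"
    "HOL-Library.Z2"
    "HOL-Computational_Algebra.Primes"
    "HOL-Number_Theory.Residues"
    "Jordan_Normal_Form.VS_Connect"
begin

section \<open>Complex irreducible characters of a group\<close>

definition mat_trace :: "'a::comm_monoid_add mat \<Rightarrow> 'a" where
  "mat_trace A = (\<Sum>i<dim_row A. A $$ (i, i))"

abbreviation GL :: "nat \<Rightarrow> complex mat monoid" where
  "GL n \<equiv> units_of (ring_mat TYPE(complex) n ())"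

definition irreducible_rep :: "('g, 'b) monoid_scheme \<Rightarrow> nat \<Rightarrow> ('g \<Rightarrow> complex mat) \<Rightarrow> bool" where
  "irreducible_rep G n \<rho> \<longleftrightarrow>
     \<rho> \<in> hom G (GL n) \<and> n > 0 \<and>
     (\<forall>W. VectorSpace.subspace class_ring W (module_vec TYPE(complex) n) \<and>
          (\<forall>g\<in>carrier G. \<forall>w\<in>W. \<rho> g *\<^sub>v w \<in> W)
        \<longrightarrow> W = {0\<^sub>v n} \<or> W = carrier_vec n)"

text \<open>Characters are normalised to be \<^const>\<open>undefined\<close> outside the carrier, so that equality
  of characters is equality of functions on the group.\<close>

definition Irr :: "('g, 'b) monoid_scheme \<Rightarrow> ('g \<Rightarrow> complex) set" where
  "Irr G = {\<chi>. \<exists>n \<rho>. irreducible_rep G n \<rho> \<and> \<chi> = (\<lambda>g\<in>carrier G. mat_trace (\<rho> g))}"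

definition char_ker :: "('g, 'b) monoid_scheme \<Rightarrow> ('g \<Rightarrow> complex) \<Rightarrow> 'g set" where
  "char_ker G \<chi> = {g \<in> carrier G. \<chi> g = \<chi> \<one>\<^bsub>G\<^esub>}"


section \<open>The unipotent group of type \<open>D\<^sub>4\<close> over a field\<close>

definition group_commutator :: "('g, 'b) monoid_scheme \<Rightarrow> 'g \<Rightarrow> 'g \<Rightarrow> 'g" where
  "group_commutator G a b = inv\<^bsub>G\<^esub> a \<otimes>\<^bsub>G\<^esub> inv\<^bsub>G\<^esub> b \<otimes>\<^bsub>G\<^esub> a \<otimes>\<^bsub>G\<^esub> b"

text \<open>The positive roots of \<open>D\<^sub>4\<close> are numbered
  \<open>\<alpha>\<^sub>1\<close> (central node), \<open>\<alpha>\<^sub>2, \<alpha>\<^sub>3, \<alpha>\<^sub>4\<close> (outer nodes),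
  \<open>\<alpha>\<^sub>5 = \<alpha>\<^sub>1 + \<alpha>\<^sub>2\<close>, \<open>\<alpha>\<^sub>6 = \<alpha>\<^sub>1 + \<alpha>\<^sub>3\<close>, \<open>\<alpha>\<^sub>7 = \<alpha>\<^sub>1 + \<alpha>\<^sub>4\<close>,
  \<open>\<alpha>\<^sub>8 = \<alpha>\<^sub>1 + \<alpha>\<^sub>2 + \<alpha>\<^sub>3\<close>, \<open>\<alpha>\<^sub>9 = \<alpha>\<^sub>1 + \<alpha>\<^sub>3 + \<alpha>\<^sub>4\<close>, \<open>\<alpha>\<^sub>1\<^sub>0 = \<alpha>\<^sub>1 + \<alpha>\<^sub>2 + \<alpha>\<^sub>4\<close>,
  \<open>\<alpha>\<^sub>1\<^sub>1 = \<alpha>\<^sub>1 + \<alpha>\<^sub>2 + \<alpha>\<^sub>3 + \<alpha>\<^sub>4\<close>, \<open>\<alpha>\<^sub>1\<^sub>2 = 2\<alpha>\<^sub>1 + \<alpha>\<^sub>2 + \<alpha>\<^sub>3 + \<alpha>\<^sub>4\<close>.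
  A triple \<open>(i, j, k)\<close> below means \<open>\<alpha>\<^sub>i + \<alpha>\<^sub>j = \<alpha>\<^sub>k\<close> with structure constant
  chosen so that \<open>[x\<^sub>i(t), x\<^sub>j(u)] = x\<^sub>k(tu)\<close>; these are all the pairs of positive roots
  whose sum is a root.\<close>

definition D4_sums :: "(nat \<times> nat \<times> nat) set" where
  "D4_sums =
    {(1, 2, 5), (1, 3, 6), (1, 4, 7), (1, 11, 12),
     (2, 6, 8), (2, 7, 10), (2, 9, 11),
     (3, 5, 8), (3, 7, 9), (3, 10, 11),
     (4, 5, 10), (4, 6, 9), (4, 8, 11),
     (5, 9, 12), (6, 10, 12), (7, 8, 12)}"

text \<open>\<open>G\<close> is the maximal unipotent subgroup of the Chevalley group of type \<open>D\<^sub>4\<close> over the field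
  \<^typ>\<open>'f\<close>, with root elements \<open>x i t\<close>.  The Chevalley relations together with uniqueness of the
  normal form determine \<open>(G, x)\<close> up to a unique isomorphism; existence is
  \<open>UD4_triality_exists\<close> below.\<close>

locale UD4 = group G
  for G :: "('g, 'b) monoid_scheme" (structure)
    and x :: "nat \<Rightarrow> 'f::field \<Rightarrow> 'g" +
  assumes root_closed: "i \<in> {1..12} \<Longrightarrow> x i t \<in> carrier G"
    and root_add: "i \<in> {1..12} \<Longrightarrow> x i t \<otimes> x i u = x i (t + u)"
    and root_comm: "(i, j, k) \<in> D4_sums \<Longrightarrow> group_commutator G (x i t) (x j u) = x k (t * u)"
    and root_comm_trivial:
      "\<lbrakk>i \<in> {1..12}; j \<in> {1..12}; \<nexists>k. (i, j, k) \<in> D4_sums \<or> (j, i, k) \<in> D4_sums\<rbrakk>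
        \<Longrightarrow> group_commutator G (x i t) (x j u) = \<one>"
    and normal_form:
      "g \<in> carrier G \<Longrightarrow>
        \<exists>!t. t \<in> {1..12::nat} \<rightarrow>\<^sub>E UNIV \<and>
          g = x 1 (t 1) \<otimes> x 2 (t 2) \<otimes> x 3 (t 3) \<otimes> x 4 (t 4) \<otimes> x 5 (t 5) \<otimes> x 6 (t 6) \<otimes>
              x 7 (t 7) \<otimes> x 8 (t 8) \<otimes> x 9 (t 9) \<otimes> x 10 (t 10) \<otimes> x 11 (t 11) \<otimes> x 12 (t 12)"

definition triality_perm :: "nat \<Rightarrow> nat" where
  "triality_perm = id(2 := 3, 3 := 4, 4 := 2, 5 := 6, 6 := 7, 7 := 5, 8 := 9, 9 := 10, 10 := 8)"

definition is_triality ::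
    "('g, 'b) monoid_scheme \<Rightarrow> (nat \<Rightarrow> 'f::field \<Rightarrow> 'g) \<Rightarrow> nat \<Rightarrow> ('g \<Rightarrow> 'g) \<Rightarrow> bool" where
  "is_triality G x q \<sigma> \<longleftrightarrow>
     \<sigma> \<in> iso G G \<and> (\<forall>i\<in>{1..12}. \<forall>t. \<sigma> (x i t) = x (triality_perm i) (t ^ q))"


section \<open>The Sylow subgroup \<open>U\<close> of the triality group, and its families of characters\<close>

definition U3D4 :: "('g, 'b) monoid_scheme \<Rightarrow> ('g \<Rightarrow> 'g) \<Rightarrow> ('g, 'b) monoid_scheme" where
  "U3D4 G \<sigma> = G\<lparr>carrier := {g \<in> carrier G. \<sigma> g = g}\<rparr>"

text \<open>The subfield of order \<open>q\<close> of the field \<^typ>\<open>'f\<close> with \<open>q\<^sup>3\<close> elements.\<close>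

definition Fq :: "nat \<Rightarrow> 'f::field set" where
  "Fq q = {t. t ^ q = t}"

text \<open>The quotient of additive groups of \<^typ>\<open>'f\<close> by its subfield of order \<open>q\<close>, as a set of cosets.\<close>

definition F_mod_Fq :: "nat \<Rightarrow> 'f::field set set" where
  "F_mod_Fq q = UNIV // {(s, t). s - t \<in> Fq q}"

definition Y1 :: "(nat \<Rightarrow> 'f::field \<Rightarrow> 'g) \<Rightarrow> nat \<Rightarrow> 'g set" where
  "Y1 x q = {x 1 t | t. t \<in> Fq q}"

definition Y2 :: "('g, 'b) monoid_scheme \<Rightarrow> (nat \<Rightarrow> 'f::field \<Rightarrow> 'g) \<Rightarrow> nat \<Rightarrow> 'g set" where
  "Y2 G x q = {x 2 t \<otimes>\<^bsub>G\<^esub> x 3 (t ^ q) \<otimes>\<^bsub>G\<^esub> x 4 (t ^ (q^2)) | t. t \<in> UNIV}"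

definition Y3 :: "('g, 'b) monoid_scheme \<Rightarrow> (nat \<Rightarrow> 'f::field \<Rightarrow> 'g) \<Rightarrow> nat \<Rightarrow> 'g set" where
  "Y3 G x q = {x 5 t \<otimes>\<^bsub>G\<^esub> x 6 (t ^ q) \<otimes>\<^bsub>G\<^esub> x 7 (t ^ (q^2)) | t. t \<in> UNIV}"

definition Y4 :: "('g, 'b) monoid_scheme \<Rightarrow> (nat \<Rightarrow> 'f::field \<Rightarrow> 'g) \<Rightarrow> nat \<Rightarrow> 'g set" where
  "Y4 G x q = {x 8 t \<otimes>\<^bsub>G\<^esub> x 9 (t ^ q) \<otimes>\<^bsub>G\<^esub> x 10 (t ^ (q^2)) | t. t \<in> UNIV}"

definition Y5 :: "(nat \<Rightarrow> 'f::field \<Rightarrow> 'g) \<Rightarrow> nat \<Rightarrow> 'g set" where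
  "Y5 x q = {x 11 t | t. t \<in> Fq q}"

definition Y6 :: "(nat \<Rightarrow> 'f::field \<Rightarrow> 'g) \<Rightarrow> nat \<Rightarrow> 'g set" where
  "Y6 x q = {x 12 t | t. t \<in> Fq q}"

definition fam6 where
  "fam6 G x q \<sigma> = {\<chi> \<in> Irr (U3D4 G \<sigma>). \<not> Y6 x q \<subseteq> char_ker (U3D4 G \<sigma>) \<chi>}"

definition fam5 where
  "fam5 G x q \<sigma> = {\<chi> \<in> Irr (U3D4 G \<sigma>).
     \<not> Y5 x q \<subseteq> char_ker (U3D4 G \<sigma>) \<chi> \<and> Y6 x q \<subseteq> char_ker (U3D4 G \<sigma>) \<chi>}"

definition fam4 where
  "fam4 G x q \<sigma> = {\<chi> \<in> Irr (U3D4 G \<sigma>).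
     \<not> Y4 G x q \<subseteq> char_ker (U3D4 G \<sigma>) \<chi> \<and>
     Y5 x q <#>\<^bsub>G\<^esub> Y6 x q \<subseteq> char_ker (U3D4 G \<sigma>) \<chi>}"

definition fam3 where
  "fam3 G x q \<sigma> = {\<chi> \<in> Irr (U3D4 G \<sigma>).
     \<not> Y3 G x q \<subseteq> char_ker (U3D4 G \<sigma>) \<chi> \<and>
     Y4 G x q <#>\<^bsub>G\<^esub> Y5 x q <#>\<^bsub>G\<^esub> Y6 x q \<subseteq> char_ker (U3D4 G \<sigma>) \<chi>}"

definition fam_lin where
  "fam_lin G x q \<sigma> = {\<chi> \<in> Irr (U3D4 G \<sigma>).
     Y3 G x q <#>\<^bsub>G\<^esub> Y4 G x q <#>\<^bsub>G\<^esub> Y5 x q <#>\<^bsub>G\<^esub> Y6 x q \<subseteq> char_ker (U3D4 G \<sigma>) \<chi>}"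

definition char_degree :: "('g, 'b) monoid_scheme \<Rightarrow> ('g \<Rightarrow> complex) \<Rightarrow> complex" where
  "char_degree G \<chi> = \<chi> \<one>\<^bsub>G\<^esub>"


section \<open>Existence of the group and of its triality automorphism\<close>

text \<open>A model on \<open>12\<close>-tuples: the multiplication is obtained by collecting the product of two
  normal forms with the commutator relations.\<close>

type_synonym 'f coords = "'f \<times> 'f \<times> 'f \<times> 'f \<times> 'f \<times> 'f \<times> 'f \<times> 'f \<times> 'f \<times> 'f \<times> 'f \<times> 'f"

definition ud4_mult :: "'f::field coords \<Rightarrow> 'f coords \<Rightarrow> 'f coords" where
  "ud4_mult = (\<lambda>(a1, a2, a3, a4, a5, a6, a7, a8, a9, a10, a11, a12)
    (b1, b2, b3, b4, b5, b6, b7, b8, b9, b10, b11, b12).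
    (a1 + b1,
     a2 + b2,
     a3 + b3,
     a4 + b4,
     a5 + b5 - a2*b1,
     a6 + b6 - a3*b1,
     a7 + b7 - a4*b1,
     a8 + b8 - a5*b3 - a6*b2 + a2*a3*b1 + a2*b1*b3 + a3*b1*b2,
     a9 + b9 - a6*b4 - a7*b3 + a3*a4*b1 + a3*b1*b4 + a4*b1*b3,
     a10 + b10 - a5*b4 - a7*b2 + a2*a4*b1 + a2*b1*b4 + a4*b1*b2,
     a11 + b11 - a10*b3 - a8*b4 - a9*b2 + a5*b3*b4 + a6*b2*b4 + a7*b2*b3 - a2*a3*a4*b1
       - a2*a3*b1*b4 - a2*a4*b1*b3 - a2*b1*b3*b4 - a3*a4*b1*b2 - a3*b1*b2*b4 - a4*b1*b2*b3,
     a12 + b12 - a10*b6 - a11*b1 - a8*b7 - a9*b5 + a5*a6*b4 + a5*a7*b3 + a5*b3*b7 + a5*b4*b6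
       + a6*a7*b2 + a6*b2*b7 + a6*b4*b5 + a7*b2*b6 + a7*b3*b5 - a2*a3*a7*b1 - a2*a3*b1*b7
       - a2*a4*a6*b1 - a2*a4*b1*b6 - a2*a6*b1*b4 - a2*a7*b1*b3 - a2*b1*b3*b7 - a2*b1*b4*b6
       - a3*a4*a5*b1 - a3*a4*b1*b5 - a3*a5*b1*b4 - a3*a7*b1*b2 - a3*b1*b2*b7 - a3*b1*b4*b5
       - a4*a5*b1*b3 - a4*a6*b1*b2 - a4*b1*b2*b6 - a4*b1*b3*b5 + 2*a2*a3*a4*b1*b1
       + a2*a3*b1*b1*b4 + a2*a4*b1*b1*b3 + a3*a4*b1*b1*b2))"

definition ud4_inv :: "'f::field coords \<Rightarrow> 'f coords" where
  "ud4_inv = (\<lambda>(a1, a2, a3, a4, a5, a6, a7, a8, a9, a10, a11, a12).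
    (- a1,
     - a2,
     - a3,
     - a4,
     - a5 - a1*a2,
     - a6 - a1*a3,
     - a7 - a1*a4,
     - a8 - a2*a6 - a3*a5 - a1*a2*a3,
     - a9 - a3*a7 - a4*a6 - a1*a3*a4,
     - a10 - a2*a7 - a4*a5 - a1*a2*a4,
     - a11 - a10*a3 - a2*a9 - a4*a8 - a2*a3*a7 - a2*a4*a6 - a3*a4*a5 - a1*a2*a3*a4,
     - a12 - a1*a11 - a10*a6 - a5*a9 - a7*a8 - a1*a10*a3 - a1*a2*a9 - a1*a4*a8 - a2*a6*a7
       - a3*a5*a7 - a4*a5*a6 - 2*a1*a2*a3*a7 - 2*a1*a2*a4*a6 - 2*a1*a3*a4*a5 - 2*a1*a1*a2*a3*a4))"

definition ud4_model :: "'f::field coords monoid" where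
  "ud4_model = \<lparr>carrier = UNIV, monoid.mult = ud4_mult,
    monoid.one = (0, 0, 0, 0, 0, 0, 0, 0, 0, 0, 0, 0)\<rparr>"

definition ud4_root :: "nat \<Rightarrow> 'f::field \<Rightarrow> 'f coords" where
  "ud4_root i t =
    (let e = (\<lambda>j. if i = j then t else 0)
     in (e 1, e 2, e 3, e 4, e 5, e 6, e 7, e 8, e 9, e 10, e 11, e 12))"

definition ud4_triality :: "nat \<Rightarrow> 'f::field coords \<Rightarrow> 'f coords" where
  "ud4_triality q = (\<lambda>(a1, a2, a3, a4, a5, a6, a7, a8, a9, a10, a11, a12).
    (a1 ^ q, a4 ^ q, a2 ^ q, a3 ^ q, a7 ^ q, a5 ^ q, a6 ^ q, a10 ^ q, a8 ^ q, a9 ^ q, a11 ^ q, a12 ^ q))"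

lemma coords_cases:
  obtains a1 a2 a3 a4 a5 a6 a7 a8 a9 a10 a11 a12
  where "u = (a1, a2, a3, a4, a5, a6, a7, a8, a9, a10, a11, a12)"
  by (cases u) auto

lemma index_set: "{1..12::nat} = {1, 2, 3, 4, 5, 6, 7, 8, 9, 10, 11, 12}"
proof -
  have "{1..12::nat} = set [1..<13]" by auto
  also have "\<dots> = {1, 2, 3, 4, 5, 6, 7, 8, 9, 10, 11, 12}"
    by (simp add: upt_rec eval_nat_numeral del: set_upt)
  finally show ?thesis .
qed

lemma ud4_mult_assoc: "ud4_mult (ud4_mult u v) w = ud4_mult u (ud4_mult v w)"
  by (cases u rule: coords_cases; cases v rule: coords_cases; cases w rule: coords_cases;
      simp only: ud4_mult_def prod.case prod.inject; intro conjI; simp add: algebra_simps)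

lemma ud4_inv_left: "ud4_mult (ud4_inv u) u = (0, 0, 0, 0, 0, 0, 0, 0, 0, 0, 0, 0)"
  by (cases u rule: coords_cases; simp only: ud4_mult_def ud4_inv_def prod.case prod.inject;
      intro conjI; simp add: algebra_simps)

lemma group_ud4_model: "group (ud4_model :: 'f::field coords monoid)"
proof (rule groupI)
  fix u :: "'f coords"
  show "\<one>\<^bsub>ud4_model\<^esub> \<otimes>\<^bsub>ud4_model\<^esub> u = u"
    by (cases u rule: coords_cases) (simp add: ud4_model_def ud4_mult_def)
  show "\<exists>v\<in>carrier ud4_model. v \<otimes>\<^bsub>ud4_model\<^esub> u = \<one>\<^bsub>ud4_model\<^esub>"
    by (rule bexI[of _ "ud4_inv u"]) (simp_all add: ud4_model_def ud4_inv_left)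
qed (simp_all add: ud4_model_def ud4_mult_assoc)

lemma (in group) group_commutator_eqI:
  assumes "a \<in> carrier G" "b \<in> carrier G" "c \<in> carrier G" "a \<otimes> b = b \<otimes> a \<otimes> c"
  shows "group_commutator G a b = c"
proof -
  have "group_commutator G a b = inv (b \<otimes> a) \<otimes> (a \<otimes> b)"
    using assms(1,2) by (simp add: group_commutator_def m_assoc inv_mult_group)
  also have "\<dots> = c"
    using assms by (simp add: inv_solve_left' m_assoc)
  finally show ?thesis .
qed

lemma ud4_root_simps:
  fixes t :: "'f::field"
  shows
    "ud4_root (Suc 0) t = (t, 0, 0, 0, 0, 0, 0, 0, 0, 0, 0, 0)"
    "ud4_root 1 t = (t, 0, 0, 0, 0, 0, 0, 0, 0, 0, 0, 0)"
    "ud4_root 2 t = (0, t, 0, 0, 0, 0, 0, 0, 0, 0, 0, 0)"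
    "ud4_root 3 t = (0, 0, t, 0, 0, 0, 0, 0, 0, 0, 0, 0)"
    "ud4_root 4 t = (0, 0, 0, t, 0, 0, 0, 0, 0, 0, 0, 0)"
    "ud4_root 5 t = (0, 0, 0, 0, t, 0, 0, 0, 0, 0, 0, 0)"
    "ud4_root 6 t = (0, 0, 0, 0, 0, t, 0, 0, 0, 0, 0, 0)"
    "ud4_root 7 t = (0, 0, 0, 0, 0, 0, t, 0, 0, 0, 0, 0)"
    "ud4_root 8 t = (0, 0, 0, 0, 0, 0, 0, t, 0, 0, 0, 0)"
    "ud4_root 9 t = (0, 0, 0, 0, 0, 0, 0, 0, t, 0, 0, 0)"
    "ud4_root 10 t = (0, 0, 0, 0, 0, 0, 0, 0, 0, t, 0, 0)"
    "ud4_root 11 t = (0, 0, 0, 0, 0, 0, 0, 0, 0, 0, t, 0)"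
    "ud4_root 12 t = (0, 0, 0, 0, 0, 0, 0, 0, 0, 0, 0, t)"
  by (simp_all add: ud4_root_def Let_def)

lemma UD4_ud4_model: "UD4 (ud4_model :: 'f::field coords monoid) ud4_root"
proof -
  interpret group "ud4_model :: 'f coords monoid" by (rule group_ud4_model)
  have carr: "u \<in> carrier ud4_model" for u :: "'f coords"
    by (simp add: ud4_model_def)
  have mult: "u \<otimes>\<^bsub>ud4_model\<^esub> v = ud4_mult u v" for u v :: "'f coords"
    by (simp add: ud4_model_def)
  note defs = mult ud4_mult_def ud4_root_simps
  have add: "ud4_root i t \<otimes>\<^bsub>ud4_model\<^esub> ud4_root i u = ud4_root i (t + u)"
    if "i \<in> {1..12}" for i and t u :: 'f
    using that[unfolded index_set] by (elim insertE emptyE; simp add: defs)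
  show ?thesis
  proof
    fix i :: nat and t u :: 'f
    show "ud4_root i t \<in> carrier ud4_model" by (rule carr)
    show "i \<in> {1..12} \<Longrightarrow> ud4_root i t \<otimes>\<^bsub>ud4_model\<^esub> ud4_root i u = ud4_root i (t + u)"
      by (rule add)
  next
    fix i j k :: nat and t u :: 'f
    assume "(i, j, k) \<in> D4_sums"
    then have "ud4_root i t \<otimes>\<^bsub>ud4_model\<^esub> ud4_root j u =
        ud4_root j u \<otimes>\<^bsub>ud4_model\<^esub> ud4_root i t \<otimes>\<^bsub>ud4_model\<^esub> ud4_root k (t * u)"
      unfolding D4_sums_def by (elim insertE emptyE; simp add: defs)
    then show "group_commutator ud4_model (ud4_root i t) (ud4_root j u) = ud4_root k (t * u)"
      by (intro group_commutator_eqI carr)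
  next
    fix i j :: nat and t u :: 'f
    assume ij: "i \<in> {1..12}" "j \<in> {1..12}"
      and non: "\<nexists>k. (i, j, k) \<in> D4_sums \<or> (j, i, k) \<in> D4_sums"
    have comm: "ud4_mult (ud4_root i t) (ud4_root j u) = ud4_mult (ud4_root j u) (ud4_root i t)"
      if "i < j" "i \<in> {1..12}" "j \<in> {1..12}" "\<nexists>k. (i, j, k) \<in> D4_sums" for i j and t u :: 'f
    proof -
      have "\<forall>(a, b, c)\<in>D4_sums. (i, j) \<noteq> (a, b)" using that(4) by auto
      note pairs = this[unfolded D4_sums_def, simplified]
      show ?thesis
        using that(2,3)[unfolded index_set] that(1) pairs
        by (elim insertE emptyE; simp only: ud4_root_simps ud4_mult_def prod.case mult_zero_left mult_zero_right
            add_0_left add_0_right diff_0_right; simp)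
    qed
    consider "i < j" | "i = j" | "j < i" by linarith
    then have "ud4_root i t \<otimes>\<^bsub>ud4_model\<^esub> ud4_root j u = ud4_root j u \<otimes>\<^bsub>ud4_model\<^esub> ud4_root i t"
    proof cases
      case 1
      then show ?thesis using comm[OF 1 ij] non by (simp add: mult)
    next
      case 2
      then show ?thesis using ij(1) by (metis add add.commute)
    next
      case 3
      then show ?thesis using comm[OF 3 ij(2,1)] non by (simp add: mult)
    qed
    then show "group_commutator ud4_model (ud4_root i t) (ud4_root j u) = \<one>\<^bsub>ud4_model\<^esub>"
      by (intro group_commutator_eqI carr) (simp add: carr)
  next
    fix g :: "'f coords"
    let ?prod = "\<lambda>t :: nat \<Rightarrow> 'f.
     ud4_root 1 (t 1) \<otimes>\<^bsub>ud4_model\<^esub> ud4_root 2 (t 2) \<otimes>\<^bsub>ud4_model\<^esub> ud4_root 3 (t 3) \<otimes>\<^bsub>ud4_model\<^esub>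
      ud4_root 4 (t 4) \<otimes>\<^bsub>ud4_model\<^esub> ud4_root 5 (t 5) \<otimes>\<^bsub>ud4_model\<^esub> ud4_root 6 (t 6) \<otimes>\<^bsub>ud4_model\<^esub>
      ud4_root 7 (t 7) \<otimes>\<^bsub>ud4_model\<^esub> ud4_root 8 (t 8) \<otimes>\<^bsub>ud4_model\<^esub> ud4_root 9 (t 9) \<otimes>\<^bsub>ud4_model\<^esub>
      ud4_root 10 (t 10) \<otimes>\<^bsub>ud4_model\<^esub> ud4_root 11 (t 11) \<otimes>\<^bsub>ud4_model\<^esub> ud4_root 12 (t 12)"
    obtain a1 a2 a3 a4 a5 a6 a7 a8 a9 a10 a11 a12
      where g: "g = (a1, a2, a3, a4, a5, a6, a7, a8, a9, a10, a11, a12)"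
      by (rule coords_cases)
    have prod: "?prod t = (t 1, t 2, t 3, t 4, t 5, t 6, t 7, t 8, t 9, t 10, t 11, t 12)" for t
      by (simp add: defs)
    let ?t = "\<lambda>i\<in>{1..12::nat}. [a1, a2, a3, a4, a5, a6, a7, a8, a9, a10, a11, a12] ! (i - 1)"
    show "\<exists>!t. t \<in> {1..12::nat} \<rightarrow>\<^sub>E UNIV \<and> g = ?prod t"
    proof (rule ex1I[of _ ?t])
      show "?t \<in> {1..12} \<rightarrow>\<^sub>E UNIV \<and> g = ?prod ?t"
        unfolding prod g by simp
    next
      fix t :: "nat \<Rightarrow> 'f"
      assume t: "t \<in> {1..12} \<rightarrow>\<^sub>E UNIV \<and> g = ?prod t"
      then have vals:
        "t 1 = a1" "t 2 = a2" "t 3 = a3" "t 4 = a4" "t 5 = a5" "t 6 = a6"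
        "t 7 = a7" "t 8 = a8" "t 9 = a9" "t 10 = a10" "t 11 = a11" "t 12 = a12"
        unfolding prod g by simp_all
      show "t = ?t"
      proof (rule PiE_ext)
        show "t \<in> {1..12} \<rightarrow>\<^sub>E UNIV" using t by blast
        show "?t \<in> {1..12} \<rightarrow>\<^sub>E UNIV" by simp
        fix i :: nat assume "i \<in> {1..12}"
        then have "i \<in> {1, 2, 3, 4, 5, 6, 7, 8, 9, 10, 11, 12}" by (simp only: index_set)
        then show "t i = ?t i" by (elim insertE emptyE; simp add: vals vals(1)[simplified])
      qed
    qed
  qed
qed

lemma frobenius_triality_field:
  assumes "prime p" and "k \<ge> 1" and "q = p ^ k" and "card (UNIV :: 'f::{field,finite} set) = q ^ 3"
  shows "(s + t :: 'f) ^ q = s ^ q + t ^ q" and "bij (\<lambda>t :: 'f. t ^ q)"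
proof -
  have char: "CHAR('f) = p"
  proof -
    have "prime CHAR('f)"
      by (rule prime_CHAR_semidom) (simp add: finite_imp_CHAR_pos)
    moreover have "CHAR('f) dvd p ^ (k * 3)"
      using CHAR_dvd_CARD[where 'a = 'f] assms(3,4) by (simp add: power_mult)
    ultimately show ?thesis
      using assms(1) by (meson prime_dvd_power primes_dvd_imp_eq)
  qed
  have add: "(s + t :: 'f) ^ q = s ^ q + t ^ q" for s t
    by (rule freshmans_dream') (use assms char in auto)
  then show "(s + t :: 'f) ^ q = s ^ q + t ^ q" .
  have "inj (\<lambda>t :: 'f. t ^ q)"
  proof (rule injI)
    fix s t :: 'f
    assume "s ^ q = t ^ q"
    with add[of "s - t" t] have "(s - t) ^ q = 0" by simp
    then show "s = t" by simp
  qed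
  then show "bij (\<lambda>t :: 'f. t ^ q)"
    by (simp add: bij_def finite_UNIV_inj_surj)
qed

theorem UD4_triality_exists:
  assumes "prime p" and "k \<ge> 1" and "q = p ^ k" and "card (UNIV :: 'f::{field,finite} set) = q ^ 3"
  shows "\<exists>(G :: 'f coords monoid) (x :: nat \<Rightarrow> 'f \<Rightarrow> 'f coords) \<sigma>.
    UD4 G x \<and> is_triality G x q \<sigma>"
proof (intro exI conjI)
  show "UD4 (ud4_model :: 'f coords monoid) ud4_root"
    by (rule UD4_ud4_model)
  have q: "q > 0" using assms prime_gt_0_nat by simp
  have add: "(s + t :: 'f) ^ q = s ^ q + t ^ q" for s t
    by (rule frobenius_triality_field[OF assms])
  have bij: "bij (\<lambda>t :: 'f. t ^ q)"
    by (rule frobenius_triality_field[OF assms])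
  have diff: "(s - t :: 'f) ^ q = s ^ q - t ^ q" for s t
    using add[of "s - t" t] by simp
  have two: "(2 :: 'f) ^ q = 2"
    using add[of 1 1] by simp
  define \<phi> where "\<phi> = (\<lambda>t :: 'f. t ^ q)"
  have \<phi>: "\<phi> (s + t) = \<phi> s + \<phi> t" "\<phi> (s - t) = \<phi> s - \<phi> t" "\<phi> (s * t) = \<phi> s * \<phi> t"
    "\<phi> 2 = 2" for s t
    using add diff two by (simp_all add: \<phi>_def power_mult_distrib)
  have tri: "ud4_triality q = (\<lambda>(a1, a2, a3, a4, a5, a6, a7, a8, a9, a10, a11, a12).
      (\<phi> a1, \<phi> a4, \<phi> a2, \<phi> a3, \<phi> a7, \<phi> a5, \<phi> a6, \<phi> a10, \<phi> a8, \<phi> a9, \<phi> a11, \<phi> a12))"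
    by (simp add: ud4_triality_def \<phi>_def)
  have "ud4_triality q (ud4_mult u v) = ud4_mult (ud4_triality q u) (ud4_triality q v)"
    for u v :: "'f coords"
    by (cases u rule: coords_cases; cases v rule: coords_cases;
        simp only: tri ud4_mult_def prod.case prod.inject \<phi>; intro conjI; simp add: algebra_simps)
  then have "ud4_triality q \<in> hom (ud4_model :: 'f coords monoid) ud4_model"
    by (simp add: hom_def ud4_model_def)
  moreover have "inj (ud4_triality q :: 'f coords \<Rightarrow> _)"
    using bij by (auto simp: inj_def bij_def ud4_triality_def)
  then have "bij (ud4_triality q :: 'f coords \<Rightarrow> _)"
    by (simp add: bij_def finite_UNIV_inj_surj)
  moreover have "ud4_triality q (ud4_root i t) = ud4_root (triality_perm i) (t ^ q)"
    if "i \<in> {1..12}" for i and t :: 'f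
  proof -
    from that have "i \<in> {1, 2, 3, 4, 5, 6, 7, 8, 9, 10, 11, 12}" by (simp only: index_set)
    then show ?thesis
      using q by (elim insertE emptyE; simp add: ud4_triality_def ud4_root_simps triality_perm_def)
  qed
  ultimately show "is_triality (ud4_model :: 'f coords monoid) ud4_root q (ud4_triality q)"
    by (simp add: is_triality_def iso_def ud4_model_def)
qed

end

theory Submission
  imports Defs
begin


text \<open>
  Every irreducible character of \<open>U\<close> is induced from a linear character of a subgroup, and the proof
  exhibits enough of these monomial characters to exhaust \<^term>\<open>Irr\<close>.

  Write \<open>K\<close> for the field with \<open>q\<^sup>3\<close> elements, \<open>F\<close> for its subfield with \<open>q\<close> elements and \<open>tr\<close> for the
  trace from \<open>K\<close> to \<open>F\<close>.  Collecting products of root elements identifies \<open>U\<close> with a group of tuples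
  \<open>(s, a, b, c, d, e)\<close>, where \<open>s, d, e \<in> F\<close> are the parameters of \<open>Y\<^sub>1, Y\<^sub>5, Y\<^sub>6\<close> and \<open>a, b, c \<in> K\<close> those of
  \<open>Y\<^sub>2, Y\<^sub>3, Y\<^sub>4\<close>.  In each family a subgroup \<open>H\<close> is given by the vanishing of some coordinates, and a
  linear character of \<open>H\<close> by a weight for each remaining coordinate, composed with a fixed additive
  character of \<open>F\<close>.

  Such a character \<open>\<lambda>\<close> induces irreducibly as soon as no element \<open>t\<close> outside \<open>H\<close> fixes it on
  \<open>H \<inter> tHt\<^sup>-\<^sup>1\<close>; this is the easy half of Mackey's criterion (\<open>indchar_in_Irr\<close>), and if two of them
  induce the same character then they are conjugate (\<open>induced_character_eqD\<close>).  Both conditions reduce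
  to the commutator \<open>[h, t]\<close>, on which the additive character is nontrivial for a suitable \<open>h\<close> because
  \<open>(x, y) \<mapsto> tr (x y)\<close> is nondegenerate.  The one commutator pairing that can degenerate is
  \<open>(a, b) \<mapsto> tr (v (b a\<^sup>q + b\<^sup>q a))\<close>, which governs the characters that are nontrivial on \<open>Y\<^sub>4\<close> and
  trivial on \<open>Y\<^sub>5 Y\<^sub>6\<close>.  Its radical is zero if \<open>q\<close> is odd and the line \<open>F v\<^sup>q\<close> if \<open>q\<close> is even.  In the
  latter case most of the linear characters involved have a stabiliser that is larger by a factor \<open>2\<close>;
  extending them to it, in two ways, gives the characters of degree \<open>q\<^sup>3 / 2\<close>.

  The characters found in this way are all, since the squares of their degrees add up to
  \<open>q\<^sup>1\<^sup>2 = |U|\<close>.  By orthogonality the difference of \<open>\<Sum> \<chi>(1) \<chi>\<close> and the regular character then has norm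
  zero, which leaves no room for a further irreducible character (\<open>Irr_eqI_sum_of_squares\<close>).
\<close>

section \<open>Schur's lemma and the orthogonality of irreducible characters\<close>

lemma subspace_vec_iff:
  "VectorSpace.subspace class_ring W (module_vec TYPE(complex) n) \<longleftrightarrow>
   W \<subseteq> carrier_vec n \<and> 0\<^sub>v n \<in> W \<and> (\<forall>v\<in>W. \<forall>w\<in>W. v + w \<in> W) \<and> (\<forall>c. \<forall>v\<in>W. c \<cdot>\<^sub>v v \<in> W)"
  using vec_vs[of n, where 'a = complex] vec_module[of n, where 'a = complex]
  by (auto simp: VectorSpace.subspace_def submodule_def module_vec_simps class_ring_simps)

lemma mat_trace_mult_commute:
  fixes A B :: "'a::comm_semiring_0 mat"
  assumes "A \<in> carrier_mat n m" "B \<in> carrier_mat m n"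
  shows "mat_trace (A * B) = mat_trace (B * A)"
proof -
  have "mat_trace (A * B) = (\<Sum>i<n. \<Sum>j<m. A $$ (i, j) * B $$ (j, i))"
    using assms by (simp add: mat_trace_def scalar_prod_def atLeast0LessThan)
  also have "\<dots> = (\<Sum>j<m. \<Sum>i<n. B $$ (j, i) * A $$ (i, j))"
    by (subst sum.swap) (simp add: mult.commute)
  also have "\<dots> = mat_trace (B * A)"
    using assms by (simp add: mat_trace_def scalar_prod_def atLeast0LessThan)
  finally show ?thesis .
qed

context group
begin

lemma irreducible_repD:
  assumes "irreducible_rep G n \<rho>"
  shows "n > 0"
    and "\<And>g. g \<in> carrier G \<Longrightarrow> \<rho> g \<in> carrier_mat n n"
    and "\<And>g h. \<lbrakk>g \<in> carrier G; h \<in> carrier G\<rbrakk> \<Longrightarrow> \<rho> (g \<otimes> h) = \<rho> g * \<rho> h"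
    and "\<rho> \<one> = 1\<^sub>m n"
    and "\<And>W. \<lbrakk>VectorSpace.subspace class_ring W (module_vec TYPE(complex) n);
            \<And>g w. \<lbrakk>g \<in> carrier G; w \<in> W\<rbrakk> \<Longrightarrow> \<rho> g *\<^sub>v w \<in> W\<rbrakk> \<Longrightarrow> W = {0\<^sub>v n} \<or> W = carrier_vec n"
proof -
  interpret R: ring "ring_mat TYPE(complex) n ()" by (rule ring_mat)
  have GL: "group (GL n)" by (rule R.units_group)
  have hom: "\<rho> \<in> hom G (GL n)" using assms by (simp add: irreducible_rep_def)
  show "n > 0" using assms by (simp add: irreducible_rep_def)
  show "\<rho> g \<in> carrier_mat n n" if "g \<in> carrier G" for g
    using hom_in_carrier[OF hom that] by (simp add: units_of_def Units_def ring_mat_def)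
  show "\<rho> (g \<otimes> h) = \<rho> g * \<rho> h" if "g \<in> carrier G" "h \<in> carrier G" for g h
    using hom_mult[OF hom that] by (simp add: units_of_def ring_mat_def)
  show "\<rho> \<one> = 1\<^sub>m n"
    using hom_one[OF hom is_group GL] by (simp add: units_of_def ring_mat_def)
  show "W = {0\<^sub>v n} \<or> W = carrier_vec n"
    if "VectorSpace.subspace class_ring W (module_vec TYPE(complex) n)"
      "\<And>g w. \<lbrakk>g \<in> carrier G; w \<in> W\<rbrakk> \<Longrightarrow> \<rho> g *\<^sub>v w \<in> W" for W
    using assms that by (simp add: irreducible_rep_def)
qed

lemma irreducible_repI:
  assumes "n > 0"
    and carr: "\<And>g. g \<in> carrier G \<Longrightarrow> \<rho> g \<in> carrier_mat n n"
    and mult: "\<And>g h. \<lbrakk>g \<in> carrier G; h \<in> carrier G\<rbrakk> \<Longrightarrow> \<rho> (g \<otimes> h) = \<rho> g * \<rho> h"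
    and one: "\<rho> \<one> = 1\<^sub>m n"
    and sub: "\<And>W. \<lbrakk>VectorSpace.subspace class_ring W (module_vec TYPE(complex) n);
            \<And>g w. \<lbrakk>g \<in> carrier G; w \<in> W\<rbrakk> \<Longrightarrow> \<rho> g *\<^sub>v w \<in> W\<rbrakk> \<Longrightarrow> W = {0\<^sub>v n} \<or> W = carrier_vec n"
  shows "irreducible_rep G n \<rho>"
  unfolding irreducible_rep_def
proof (intro conjI allI impI)
  show "\<rho> \<in> hom G (GL n)"
  proof (rule homI)
    fix g assume g: "g \<in> carrier G"
    then have "\<rho> (inv g) * \<rho> g = 1\<^sub>m n" "\<rho> g * \<rho> (inv g) = 1\<^sub>m n"
      by (metis inv_closed l_inv mult one, metis inv_closed r_inv mult one g)
    then show "\<rho> g \<in> carrier (GL n)"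
      using g carr[OF g] carr[of "inv g"] by (auto simp: units_of_def Units_def ring_mat_def)
  qed (simp add: units_of_def ring_mat_def mult)
qed (use assms in auto)

text \<open>  Kernel and image of an intertwiner are invariant subspaces.  By irreducibility a nonzero intertwiner
  therefore has a two-sided inverse \<open>Q\<close>, and cyclicity of the trace gives the claim.\<close>

lemma intertwiner_imp_trace_eq:
  assumes \<rho>: "irreducible_rep G n \<rho>" and \<sigma>: "irreducible_rep G m \<sigma>"
    and P: "P \<in> carrier_mat n m" "P \<noteq> 0\<^sub>m n m"
    and comm: "\<And>g. g \<in> carrier G \<Longrightarrow> \<rho> g * P = P * \<sigma> g"
    and g: "g \<in> carrier G"
  shows "mat_trace (\<rho> g) = mat_trace (\<sigma> g)"
proof -
  note \<rho> = irreducible_repD[OF \<rho>] and \<sigma> = irreducible_repD[OF \<sigma>]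
  have act: "\<rho> h *\<^sub>v (P *\<^sub>v v) = P *\<^sub>v (\<sigma> h *\<^sub>v v)" if "h \<in> carrier G" "v \<in> carrier_vec m" for h v
    using comm[OF that(1)] \<rho>(2)[OF that(1)] \<sigma>(2)[OF that(1)] P(1) that(2)
    by (metis assoc_mult_mat_vec)
  obtain i j where ij: "i < n" "j < m" "P $$ (i, j) \<noteq> 0"
    using P by (metis carrier_matD(1) carrier_matD(2) eq_matI index_zero_mat)
  have nz: "P *\<^sub>v unit_vec m j \<noteq> 0\<^sub>v n"
  proof
    assume "P *\<^sub>v unit_vec m j = 0\<^sub>v n"
    then have "(P *\<^sub>v unit_vec m j) $ i = 0" using ij by simp
    then show False using ij P by (simp add: scalar_prod_right_unit)
  qed
  define W where "W = {v \<in> carrier_vec m. P *\<^sub>v v = 0\<^sub>v n}"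
  have "W = {0\<^sub>v m} \<or> W = carrier_vec m"
  proof (rule \<sigma>(5))
    show "VectorSpace.subspace class_ring W (module_vec TYPE(complex) m)"
      unfolding subspace_vec_iff using P(1)
      by (auto simp: W_def mult_add_distrib_mat_vec mult_mat_vec)
    show "\<sigma> h *\<^sub>v w \<in> W" if "h \<in> carrier G" "w \<in> W" for h w
    proof -
      have "\<rho> h *\<^sub>v 0\<^sub>v n = 0\<^sub>v n" using \<rho>(2)[OF that(1)] by (intro eq_vecI) auto
      then show ?thesis using act[OF that(1), of w] that \<sigma>(2)[OF that(1)] by (auto simp: W_def)
    qed
  qed
  moreover have "unit_vec m j \<notin> W" using nz by (simp add: W_def)
  ultimately have W: "W = {0\<^sub>v m}" by (metis unit_vec_carrier)
  define V where "V = {P *\<^sub>v v | v. v \<in> carrier_vec m}"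
  have "V = {0\<^sub>v n} \<or> V = carrier_vec n"
  proof (rule \<rho>(5))
    show "VectorSpace.subspace class_ring V (module_vec TYPE(complex) n)"
      unfolding subspace_vec_iff
    proof (intro conjI ballI allI)
      show "V \<subseteq> carrier_vec n" using P(1) mult_mat_vec_carrier unfolding V_def by blast
      have "P *\<^sub>v 0\<^sub>v m = 0\<^sub>v n" using P(1) by (intro eq_vecI) auto
      then show "0\<^sub>v n \<in> V" unfolding V_def by (metis (mono_tags, lifting) mem_Collect_eq zero_carrier_vec)
      fix v w assume "v \<in> V" "w \<in> V"
      then obtain v' w' where vw: "v = P *\<^sub>v v'" "w = P *\<^sub>v w'" "v' \<in> carrier_vec m" "w' \<in> carrier_vec m"
        unfolding V_def by blast
      then have "v + w = P *\<^sub>v (v' + w')"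
        using mult_add_distrib_mat_vec[OF P(1), of v' w'] by simp
      then show "v + w \<in> V"
        unfolding V_def using vw add_carrier_vec by blast
    next
      fix c v assume "v \<in> V"
      then obtain v' where v': "v = P *\<^sub>v v'" "v' \<in> carrier_vec m" unfolding V_def by blast
      then have "c \<cdot>\<^sub>v v = P *\<^sub>v (c \<cdot>\<^sub>v v')"
        using mult_mat_vec[OF P(1), of v' c] by simp
      then show "c \<cdot>\<^sub>v v \<in> V" unfolding V_def using v' smult_carrier_vec by blast
    qed
    show "\<rho> h *\<^sub>v w \<in> V" if h: "h \<in> carrier G" and w: "w \<in> V" for h w
    proof -
      obtain v where v: "w = P *\<^sub>v v" "v \<in> carrier_vec m" using w by (auto simp: V_def)
      then have "\<rho> h *\<^sub>v w = P *\<^sub>v (\<sigma> h *\<^sub>v v)" using act[OF h v(2)] by simp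
      moreover have "\<sigma> h *\<^sub>v v \<in> carrier_vec m" using mult_mat_vec_carrier[OF \<sigma>(2)[OF h] v(2)] .
      ultimately show ?thesis unfolding V_def by blast
    qed
  qed
  moreover have "P *\<^sub>v unit_vec m j \<in> V" unfolding V_def using unit_vec_carrier by blast
  ultimately have V: "V = carrier_vec n" using nz by (metis singletonD)
  have "\<exists>v. v \<in> carrier_vec m \<and> P *\<^sub>v v = unit_vec n i" if "i < n" for i
    proof -
    have "unit_vec n i \<in> V" using V by simp
    then show ?thesis unfolding V_def by (smt (verit) mem_Collect_eq)
  qed
  then obtain u where u: "\<And>i. i < n \<Longrightarrow> u i \<in> carrier_vec m \<and> P *\<^sub>v u i = unit_vec n i"
    by metis
  define Q where "Q = mat m n (\<lambda>(r, i). u i $ r)"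
  have Q: "Q \<in> carrier_mat m n" by (simp add: Q_def)
  have colQ: "col Q i = u i" if "i < n" for i
    using that u[OF that] by (intro eq_vecI) (auto simp: Q_def)
  have PQ: "P * Q = 1\<^sub>m n"
  proof (rule mat_col_eqI)
    fix i assume "i < dim_col (1\<^sub>m n)"
    then have i: "i < n" by simp
    have "col (P * Q) i = P *\<^sub>v col Q i" using P(1) Q i by (intro col_mult2)
    also have "\<dots> = col (1\<^sub>m n) i" using colQ u i by simp
    finally show "col (P * Q) i = col (1\<^sub>m n) i" .
  qed (use P Q in auto)
  have QP: "Q * P = 1\<^sub>m m"
  proof (rule mat_col_eqI)
    fix i assume "i < dim_col (1\<^sub>m m)"
    then have i: "i < m" by simp
    let ?c = "col (Q * P) i"
    have c: "?c \<in> carrier_vec m" using P(1) Q by (intro col_carrier_vec[of _ m]) (use i in auto)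
    have "P *\<^sub>v ?c = col (P * (Q * P)) i"
      using P(1) Q i by (intro col_mult2[symmetric]) auto
    also have "P * (Q * P) = P"
      using P(1) Q PQ by (metis assoc_mult_mat left_mult_one_mat)
    also have "col P i = P *\<^sub>v unit_vec m i"
      using P(1) i by (intro eq_vecI) auto
    finally have "P *\<^sub>v (?c - unit_vec m i) = 0\<^sub>v n"
      using mult_minus_distrib_mat_vec[OF P(1) c, of "unit_vec m i"] P(1) by auto
    then have "?c - unit_vec m i \<in> W" using c by (auto simp: W_def)
    then have z: "?c - unit_vec m i = 0\<^sub>v m" using W by simp
    have "?c = unit_vec m i"
    proof (rule eq_vecI)
      fix j assume "j < dim_vec (unit_vec m i :: complex vec)"
      then have j: "j < m" by simp
      have "(?c - unit_vec m i) $ j = 0" using z j by simp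
      then show "?c $ j = unit_vec m i $ j" using c j by (simp add: carrier_vecD)
    qed (use c Q in auto)
    then show "?c = col (1\<^sub>m m) i" using i by simp
  qed (use P Q in auto)
  have \<rho>g: "\<rho> g \<in> carrier_mat n n" and \<sigma>g: "\<sigma> g \<in> carrier_mat m m" using \<rho>(2) \<sigma>(2) g by auto
  have "mat_trace (\<rho> g) = mat_trace (\<rho> g * P * Q)"
    using \<rho>g P(1) Q PQ by (metis assoc_mult_mat right_mult_one_mat)
  also have "\<dots> = mat_trace (P * (\<sigma> g * Q))"
    using comm[OF g] \<sigma>g P(1) Q by (metis assoc_mult_mat)
  also have "\<dots> = mat_trace (\<sigma> g * Q * P)"
    using \<sigma>g P(1) Q by (intro mat_trace_mult_commute[of _ n m]) auto
  also have "\<dots> = mat_trace (\<sigma> g)"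
    using \<sigma>g P(1) Q QP by (metis assoc_mult_mat right_mult_one_mat)
  finally show ?thesis .
qed

lemma sum_translate_left:
  assumes "h \<in> carrier G"
  shows "(\<Sum>g\<in>carrier G. f (h \<otimes> g)) = (\<Sum>g\<in>carrier G. f g)"
  by (rule sum.reindex_bij_witness[of _ "\<lambda>g. inv h \<otimes> g" "\<lambda>g. h \<otimes> g"])
    (use assms in \<open>auto simp: m_assoc[symmetric]\<close>)

text \<open>  Averaging a matrix unit \<open>E\<^sub>i\<^sub>j\<close> over \<open>g \<mapsto> \<rho>(g) E\<^sub>i\<^sub>j \<sigma>(g\<^sup>-\<^sup>1)\<close> gives an intertwiner, which must vanish when the
  characters differ.  Its entries are the sums of products of matrix coefficients that make up the inner
  product of the two characters.\<close>

lemma irreducible_characters_orthogonal: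
  assumes chars: "\<chi> \<in> Irr G" "\<psi> \<in> Irr G" "\<chi> \<noteq> \<psi>"
  shows "(\<Sum>g\<in>carrier G. \<chi> g * \<psi> (inv g)) = 0"
proof -
  obtain n \<rho> where irr1: "irreducible_rep G n \<rho>" and \<chi>: "\<chi> = (\<lambda>g\<in>carrier G. mat_trace (\<rho> g))"
    using chars(1) by (auto simp: Irr_def)
  obtain m \<sigma> where irr2: "irreducible_rep G m \<sigma>" and \<psi>: "\<psi> = (\<lambda>g\<in>carrier G. mat_trace (\<sigma> g))"
    using chars(2) by (auto simp: Irr_def)
  note \<rho> = irreducible_repD[OF irr1] and \<sigma> = irreducible_repD[OF irr2]
  have zero: "(\<Sum>g\<in>carrier G. \<rho> g $$ (k, i) * \<sigma> (inv g) $$ (j, l)) = 0"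
    if "k < n" "i < n" "j < m" "l < m" for i j k l
  proof -
    define T where "T = mat n m (\<lambda>(k, l). \<Sum>g\<in>carrier G. \<rho> g $$ (k, i) * \<sigma> (inv g) $$ (j, l))"
    have T: "T \<in> carrier_mat n m" by (simp add: T_def)
    have comm: "\<rho> h * T = T * \<sigma> h" if h: "h \<in> carrier G" for h
    proof (rule eq_matI)
      fix k l assume kl: "k < dim_row (T * \<sigma> h)" "l < dim_col (T * \<sigma> h)"
      have k: "k < n" and l: "l < m" using kl T \<sigma>(2)[OF h] by auto
      have "(\<rho> h * T) $$ (k, l) = (\<Sum>r<n. \<rho> h $$ (k, r) * (\<Sum>g\<in>carrier G. \<rho> g $$ (r, i) * \<sigma> (inv g) $$ (j, l)))"
        using \<rho>(2)[OF h] T k l by (auto simp: scalar_prod_def T_def atLeast0LessThan intro!: sum.cong)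
      also have "\<dots> = (\<Sum>g\<in>carrier G. (\<Sum>r<n. \<rho> h $$ (k, r) * \<rho> g $$ (r, i)) * \<sigma> (inv g) $$ (j, l))"
        unfolding sum_distrib_left sum_distrib_right by (subst sum.swap) (simp add: mult.assoc)
      also have "\<dots> = (\<Sum>g\<in>carrier G. \<rho> (h \<otimes> g) $$ (k, i) * \<sigma> (inv g) $$ (j, l))"
      proof (rule sum.cong)
        fix g assume g: "g \<in> carrier G"
        show "(\<Sum>r<n. \<rho> h $$ (k, r) * \<rho> g $$ (r, i)) * \<sigma> (inv g) $$ (j, l) = \<rho> (h \<otimes> g) $$ (k, i) * \<sigma> (inv g) $$ (j, l)"
          using \<rho>(2)[OF h] \<rho>(2)[OF g] \<rho>(3)[OF h g] k \<open>i < n\<close>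
          by (simp add: scalar_prod_def atLeast0LessThan)
      qed simp
      also have "\<dots> = (\<Sum>g\<in>carrier G. \<rho> (h \<otimes> g) $$ (k, i) * \<sigma> (inv (h \<otimes> g) \<otimes> h) $$ (j, l))"
        using h by (intro sum.cong) (auto simp: inv_mult_group m_assoc)
      also have "\<dots> = (\<Sum>g\<in>carrier G. \<rho> g $$ (k, i) * \<sigma> (inv g \<otimes> h) $$ (j, l))"
        using sum_translate_left[OF h, of "\<lambda>g. \<rho> g $$ (k, i) * \<sigma> (inv g \<otimes> h) $$ (j, l)"] .
      also have "\<dots> = (\<Sum>g\<in>carrier G. \<Sum>r<m. \<rho> g $$ (k, i) * (\<sigma> (inv g) $$ (j, r) * \<sigma> h $$ (r, l)))"
      proof (rule sum.cong)
        fix g assume g: "g \<in> carrier G"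
        then have ig: "inv g \<in> carrier G" by simp
        show "\<rho> g $$ (k, i) * \<sigma> (inv g \<otimes> h) $$ (j, l) = (\<Sum>r<m. \<rho> g $$ (k, i) * (\<sigma> (inv g) $$ (j, r) * \<sigma> h $$ (r, l)))"
          using \<sigma>(2)[OF h] \<sigma>(2)[OF ig] \<sigma>(3)[OF ig h] l \<open>j < m\<close>
          by (simp add: scalar_prod_def atLeast0LessThan sum_distrib_left)
      qed simp
      also have "\<dots> = (\<Sum>r<m. (\<Sum>g\<in>carrier G. \<rho> g $$ (k, i) * \<sigma> (inv g) $$ (j, r)) * \<sigma> h $$ (r, l))"
        unfolding sum_distrib_right by (subst sum.swap) (simp add: mult.assoc)
      also have "\<dots> = (T * \<sigma> h) $$ (k, l)"
        using \<sigma>(2)[OF h] T k l by (auto simp: scalar_prod_def T_def atLeast0LessThan intro!: sum.cong)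
      finally show "(\<rho> h * T) $$ (k, l) = (T * \<sigma> h) $$ (k, l)" .
    qed (use \<rho>(2)[OF h] \<sigma>(2)[OF h] T in auto)
    have "T = 0\<^sub>m n m"
    proof (rule ccontr)
      assume "T \<noteq> 0\<^sub>m n m"
      then have "mat_trace (\<rho> g) = mat_trace (\<sigma> g)" if "g \<in> carrier G" for g
        using intertwiner_imp_trace_eq[OF irr1 irr2 T _ comm that] by simp
      then have "\<chi> = \<psi>" unfolding \<chi> \<psi> by (auto intro: restrict_ext)
      then show False using chars(3) by simp
    qed
    then have "T $$ (k, l) = 0" using that by simp
    then show ?thesis using that by (simp add: T_def)
  qed
  have "(\<Sum>g\<in>carrier G. \<chi> g * \<psi> (inv g)) =
        (\<Sum>g\<in>carrier G. \<Sum>i<n. \<Sum>j<m. \<rho> g $$ (i, i) * \<sigma> (inv g) $$ (j, j))"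
  proof (rule sum.cong)
    fix g assume g: "g \<in> carrier G"
    then have ig: "inv g \<in> carrier G" by simp
    show "\<chi> g * \<psi> (inv g) = (\<Sum>i<n. \<Sum>j<m. \<rho> g $$ (i, i) * \<sigma> (inv g) $$ (j, j))"
      using \<rho>(2)[OF g] \<sigma>(2)[OF ig] g ig by (simp add: \<chi> \<psi> mat_trace_def sum_product)
  qed simp
  also have "\<dots> = (\<Sum>i<n. \<Sum>j<m. \<Sum>g\<in>carrier G. \<rho> g $$ (i, i) * \<sigma> (inv g) $$ (j, j))"
    by (subst sum.swap, intro sum.cong refl, subst sum.swap, simp)
  also have "\<dots> = 0" by (intro sum.neutral ballI zero) auto
  finally show ?thesis .
qed

text \<open>  With \<open>R = \<Sum>\<chi>\<in>L. \<chi>(1) \<chi>\<close> and \<open>\<delta>\<close> equal to \<open>|G|\<close> at the identity and zero elsewhere, the hypothesis on the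
  squares says exactly that \<open>f = R - \<delta>\<close> is orthogonal to itself.  The bilinear form is definite on \<open>f\<close>
  because the characters in \<open>L\<close> satisfy \<open>\<chi>(g\<^sup>-\<^sup>1) = cnj (\<chi>(g))\<close>, so \<open>R = \<delta>\<close>.  An irreducible character outside
  \<open>L\<close> would be orthogonal to \<open>R\<close>, but its product with \<open>\<delta>\<close> is \<open>|G|\<close> times its degree.\<close>

lemma Irr_eqI_sum_of_squares:
  assumes fin: "finite (carrier G)" and L: "L \<subseteq> Irr G" "finite L"
    and cnj: "\<And>\<chi> g. \<lbrakk>\<chi> \<in> L; g \<in> carrier G\<rbrakk> \<Longrightarrow> \<chi> (inv g) = cnj (\<chi> g)"
    and norm: "\<And>\<chi>. \<chi> \<in> L \<Longrightarrow> (\<Sum>g\<in>carrier G. \<chi> g * \<chi> (inv g)) = of_nat (card (carrier G))"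
    and squares: "(\<Sum>\<chi>\<in>L. (\<chi> \<one>)\<^sup>2) = of_nat (card (carrier G))"
  shows "Irr G = L"
proof -
  define N :: complex where "N = of_nat (card (carrier G))"
  define R where "R g = (\<Sum>\<chi>\<in>L. \<chi> \<one> * \<chi> g)" for g
  define \<delta> where "\<delta> g = (if g = \<one> then N else 0)" for g
  define f where "f g = R g - \<delta> g" for g
  have R_cnj: "R (inv g) = cnj (R g)" if "g \<in> carrier G" for g
    unfolding R_def using cnj[OF _ that] cnj[OF _ one_closed] by (auto intro!: sum.cong)
  have f_cnj: "f (inv g) = cnj (f g)" if "g \<in> carrier G" for g
    using R_cnj[OF that] that by (auto simp: f_def \<delta>_def N_def inv_eq_1_iff)
  have R1: "R \<one> = N" using squares by (simp add: R_def N_def power2_eq_square)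
  have orth: "(\<Sum>g\<in>carrier G. \<chi> g * \<psi> (inv g)) = (if \<chi> = \<psi> then N else 0)" if "\<chi> \<in> L" "\<psi> \<in> L" for \<chi> \<psi>
    using irreducible_characters_orthogonal[of \<chi> \<psi>] norm that L by (auto simp: N_def)
  have "(\<Sum>g\<in>carrier G. R g * R (inv g)) = (\<Sum>g\<in>carrier G. \<Sum>\<chi>\<in>L. \<Sum>\<psi>\<in>L. \<chi> \<one> * \<psi> \<one> * (\<chi> g * \<psi> (inv g)))"
    unfolding R_def sum_product by (intro sum.cong refl) (simp add: mult_ac)
  also have "\<dots> = (\<Sum>\<chi>\<in>L. \<Sum>\<psi>\<in>L. \<chi> \<one> * \<psi> \<one> * (\<Sum>g\<in>carrier G. \<chi> g * \<psi> (inv g)))"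
    unfolding sum_distrib_left by (subst sum.swap, intro sum.cong refl, subst sum.swap, simp)
  also have "\<dots> = (\<Sum>\<chi>\<in>L. \<Sum>\<psi>\<in>L. if \<chi> = \<psi> then \<chi> \<one> * \<psi> \<one> * N else 0)"
    by (intro sum.cong refl) (simp add: orth)
  also have "\<dots> = N * N"
    using L(2) squares by (simp add: N_def power2_eq_square flip: sum_distrib_right)
  finally have RR: "(\<Sum>g\<in>carrier G. R g * R (inv g)) = N * N" .
  have delta: "(\<Sum>g\<in>carrier G. \<delta> g * F g) = N * F \<one>" "(\<Sum>g\<in>carrier G. F g * \<delta> (inv g)) = F \<one> * N" for F
  proof -
    have "(\<Sum>g\<in>carrier G. \<delta> g * F g) = (\<Sum>g\<in>carrier G. if g = \<one> then N * F \<one> else 0)"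
      by (intro sum.cong) (auto simp: \<delta>_def)
    then show "(\<Sum>g\<in>carrier G. \<delta> g * F g) = N * F \<one>" using fin by simp
    have "(\<Sum>g\<in>carrier G. F g * \<delta> (inv g)) = (\<Sum>g\<in>carrier G. if g = \<one> then F \<one> * N else 0)"
      by (intro sum.cong) (auto simp: \<delta>_def inv_eq_1_iff)
    then show "(\<Sum>g\<in>carrier G. F g * \<delta> (inv g)) = F \<one> * N" using fin by simp
  qed
  have "(\<Sum>g\<in>carrier G. f g * f (inv g)) =
      (\<Sum>g\<in>carrier G. R g * R (inv g)) - (\<Sum>g\<in>carrier G. R g * \<delta> (inv g))
       - ((\<Sum>g\<in>carrier G. \<delta> g * R (inv g)) - (\<Sum>g\<in>carrier G. \<delta> g * \<delta> (inv g)))"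
    unfolding sum_subtractf[symmetric] by (intro sum.cong refl) (simp add: f_def algebra_simps)
  also have "\<dots> = 0" unfolding RR delta using R1 by (simp add: \<delta>_def)
  finally have "(\<Sum>g\<in>carrier G. f g * f (inv g)) = 0" .
  moreover have "(\<Sum>g\<in>carrier G. f g * f (inv g)) = of_real (\<Sum>g\<in>carrier G. (cmod (f g))\<^sup>2)"
    unfolding of_real_sum by (intro sum.cong refl) (simp only: f_cnj complex_norm_square)
  ultimately have "(\<Sum>g\<in>carrier G. (cmod (f g))\<^sup>2) = 0" by (metis of_real_eq_0_iff)
  then have f0: "f g = 0" if "g \<in> carrier G" for g
    using that fin by (simp add: sum_nonneg_eq_0_iff)
  have "\<psi> \<in> L" if \<psi>: "\<psi> \<in> Irr G" for \<psi>
  proof (rule ccontr)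
    assume nin: "\<psi> \<notin> L"
    obtain n \<rho> where irr: "irreducible_rep G n \<rho>" and \<psi>_eq: "\<psi> = (\<lambda>g\<in>carrier G. mat_trace (\<rho> g))"
      using \<psi> by (auto simp: Irr_def)
    have one: "\<psi> \<one> = of_nat n" using irreducible_repD(4)[OF irr] by (simp add: \<psi>_eq mat_trace_def)
    have "\<psi> \<one> * N = (\<Sum>g\<in>carrier G. \<psi> g * \<delta> (inv g))" by (simp add: delta)
    also have "\<dots> = (\<Sum>g\<in>carrier G. \<psi> g * R (inv g))"
      by (intro sum.cong refl) (use f0 in \<open>simp add: f_def\<close>)
    also have "\<dots> = (\<Sum>\<chi>\<in>L. \<chi> \<one> * (\<Sum>g\<in>carrier G. \<psi> g * \<chi> (inv g)))"
      unfolding R_def sum_distrib_left by (subst sum.swap) (simp add: mult_ac)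
    also have "\<dots> = 0"
      by (intro sum.neutral ballI) (use irreducible_characters_orthogonal \<psi> nin L in fastforce)
    finally have "N = 0" using one irreducible_repD(1)[OF irr] by simp
    then show False using fin by (auto simp: N_def)
  qed
  then show ?thesis using L by blast
qed

end


section \<open>Induced linear characters and Mackey's criterion\<close>

lemma finsum_vec_in_subspace:
  assumes W: "VectorSpace.subspace class_ring W (module_vec TYPE(complex) n)"
    and "finite A" and "\<And>a. a \<in> A \<Longrightarrow> f a \<in> W"
  shows "finsum_vec TYPE(complex) n f A \<in> W"
  using assms(2,3)
proof (induction A rule: finite_induct)
  case empty
  then show ?case using W by (simp add: subspace_vec_iff finsum_vec_empty)
next
  case (insert x A)
  then have "f \<in> A \<rightarrow> carrier_vec n" "f x \<in> carrier_vec n" using W by (auto simp: subspace_vec_iff)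
  then show ?case using insert W by (simp add: subspace_vec_iff finsum_vec_insert)
qed

text \<open>  The sum runs over all of \<open>G\<close> and not over a transversal of \<open>H\<close>, so every coset contributes
  \<^term>\<open>card H\<close> equal terms.\<close>

definition induced_character :: "('g, 'b) monoid_scheme \<Rightarrow> 'g set \<Rightarrow> ('g \<Rightarrow> complex) \<Rightarrow> 'g \<Rightarrow> complex" where
  "induced_character G H lam = (\<lambda>g\<in>carrier G.
     (\<Sum>t\<in>carrier G. if inv\<^bsub>G\<^esub> t \<otimes>\<^bsub>G\<^esub> g \<otimes>\<^bsub>G\<^esub> t \<in> H then lam (inv\<^bsub>G\<^esub> t \<otimes>\<^bsub>G\<^esub> g \<otimes>\<^bsub>G\<^esub> t) else 0)
       / of_nat (card H))"

locale subgroup_linear_char = group G for G :: "('g, 'b) monoid_scheme" (structure) +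
  fixes H :: "'g set" and lam :: "'g \<Rightarrow> complex"
  assumes finite_group: "finite (carrier G)"
    and sub: "subgroup H G"
    and lam_mult: "\<lbrakk>a \<in> H; b \<in> H\<rbrakk> \<Longrightarrow> lam (a \<otimes> b) = lam a * lam b"
    and lam_norm: "a \<in> H \<Longrightarrow> cmod (lam a) = 1"
begin

definition lam0 :: "'g \<Rightarrow> complex" where
  "lam0 g = (if g \<in> H then lam g else 0)"

lemma H_carrier: "a \<in> H \<Longrightarrow> a \<in> carrier G"
  using sub subgroup.mem_carrier by metis

lemma H_one: "\<one> \<in> H" using sub by (rule subgroup.one_closed)
lemma H_mult: "\<lbrakk>a \<in> H; b \<in> H\<rbrakk> \<Longrightarrow> a \<otimes> b \<in> H" using sub by (rule subgroup.m_closed)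
lemma H_inv: "a \<in> H \<Longrightarrow> inv a \<in> H" using sub by (rule subgroup.m_inv_closed)

lemma H_finite: "finite H"
  using finite_group H_carrier by (meson finite_subset subsetI)

lemma card_H_pos: "card H > 0"
  using H_finite H_one by (auto simp: card_gt_0_iff)

lemma lam_nz: "a \<in> H \<Longrightarrow> lam a \<noteq> 0"
  using lam_norm by fastforce

lemma lam_one: "lam \<one> = 1"
  using lam_mult[OF H_one H_one] lam_nz[OF H_one] by simp

lemma lam_inv: "a \<in> H \<Longrightarrow> lam (inv a) = inverse (lam a)"
  using lam_mult[of a "inv a"] H_inv[of a] lam_one lam_nz[of a] H_carrier[of a]
  by (simp add: field_simps)

lemma lam_inv_cnj: "a \<in> H \<Longrightarrow> lam (inv a) = cnj (lam a)"
  using lam_inv[of a] lam_norm[of a] lam_nz[of a] complex_div_cnj[of 1 "lam a"]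
  by (simp add: inverse_eq_divide)

lemma mem_mult_right: "\<lbrakk>g \<in> carrier G; b \<in> H\<rbrakk> \<Longrightarrow> g \<otimes> b \<in> H \<longleftrightarrow> g \<in> H"
  by (metis H_carrier H_inv H_mult inv_closed m_assoc r_inv r_one)

lemma mem_mult_left: "\<lbrakk>g \<in> carrier G; b \<in> H\<rbrakk> \<Longrightarrow> b \<otimes> g \<in> H \<longleftrightarrow> g \<in> H"
  by (metis H_carrier H_inv H_mult inv_closed m_assoc l_inv l_one)

lemma lam0_mult_right: "\<lbrakk>g \<in> carrier G; b \<in> H\<rbrakk> \<Longrightarrow> lam0 (g \<otimes> b) = lam0 g * lam b"
  by (simp add: lam0_def mem_mult_right lam_mult)

lemma lam0_mult_left: "\<lbrakk>g \<in> carrier G; b \<in> H\<rbrakk> \<Longrightarrow> lam0 (b \<otimes> g) = lam b * lam0 g"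
  by (simp add: lam0_def mem_mult_left lam_mult)

lemma lam0_conj: "\<lbrakk>g \<in> carrier G; b \<in> H\<rbrakk> \<Longrightarrow> lam0 (inv b \<otimes> g \<otimes> b) = lam0 g"
  using lam0_mult_right[of "inv b \<otimes> g" b] lam0_mult_left[of g "inv b"]
  by (simp add: H_carrier H_inv lam_inv lam_nz)

lemma lam0_inv: "g \<in> carrier G \<Longrightarrow> lam0 (inv g) = cnj (lam0 g)"
  using lam_inv_cnj[of g] H_inv[of g] H_inv[of "inv g"] by (auto simp: lam0_def)

abbreviation indchar :: "'g \<Rightarrow> complex" where
  "indchar \<equiv> induced_character G H lam"

lemma indchar_eq:
  "g \<in> carrier G \<Longrightarrow> indchar g = (\<Sum>t\<in>carrier G. lam0 (inv t \<otimes> g \<otimes> t)) / of_nat (card H)"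
  by (simp add: induced_character_def lam0_def)

lemma indchar_inv: "g \<in> carrier G \<Longrightarrow> indchar (inv g) = cnj (indchar g)"
proof -
  assume g: "g \<in> carrier G"
  have "lam0 (inv t \<otimes> inv g \<otimes> t) = cnj (lam0 (inv t \<otimes> g \<otimes> t))" if "t \<in> carrier G" for t
    using lam0_inv[of "inv t \<otimes> g \<otimes> t"] g that by (simp add: inv_mult_group m_assoc)
  then show ?thesis using g by (simp add: indchar_eq)
qed

text \<open>  Used to read off kernels: the value of an induced character at an element all of whose conjugates lie
  in \<open>H\<close> and have the same image under \<open>lam\<close>.  Conjugacy is expressed as \<open>g t = t h\<close>, which avoids
  inverses in coordinate computations.\<close>

lemma indchar_constant:
  assumes "g \<in> carrier G" "\<And>t. t \<in> carrier G \<Longrightarrow> \<exists>h\<in>H. g \<otimes> t = t \<otimes> h \<and> lam h = z"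
  shows "indchar g = z * of_nat (card (carrier G)) / of_nat (card H)"
proof -
  have "lam0 (inv t \<otimes> g \<otimes> t) = z" if t: "t \<in> carrier G" for t
  proof -
    obtain h where h: "h \<in> H" "g \<otimes> t = t \<otimes> h" "lam h = z" using assms(2)[OF t] by auto
    have "inv t \<otimes> g \<otimes> t = h" using h t assms(1) H_carrier[OF h(1)]
      by (simp add: m_assoc inv_solve_left')
    then show ?thesis using h by (simp add: lam0_def)
  qed
  then show ?thesis using assms(1) by (simp add: indchar_eq)
qed

lemma indchar_one: "indchar \<one> = of_nat (card (carrier G)) / of_nat (card H)"
  using indchar_constant[of \<one> 1] H_one lam_one by force

lemma indchar_conj:
  assumes "g \<in> carrier G" "s \<in> carrier G"
  shows "indchar (inv s \<otimes> g \<otimes> s) = indchar g"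
proof -
  have "(\<Sum>t\<in>carrier G. lam0 (inv t \<otimes> (inv s \<otimes> g \<otimes> s) \<otimes> t))
      = (\<Sum>t\<in>carrier G. lam0 (inv (s \<otimes> t) \<otimes> g \<otimes> (s \<otimes> t)))"
    using assms by (intro sum.cong refl) (simp add: inv_mult_group m_assoc)
  then show ?thesis
    using assms sum_translate_left[of s "\<lambda>t. lam0 (inv t \<otimes> g \<otimes> t)"] by (simp add: indchar_eq)
qed

end

lemma frobenius_reciprocity:
  fixes G (structure)
  assumes "subgroup_linear_char G H lam" "subgroup_linear_char G K mu"
  shows "(\<Sum>g\<in>carrier G. induced_character G H lam g * induced_character G K mu (inv g)) =
    of_nat (card (carrier G)) / of_nat (card K) * (\<Sum>h\<in>K. induced_character G H lam h * mu (inv h))"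
proof -
  interpret A: subgroup_linear_char G H lam by fact
  interpret B: subgroup_linear_char G K mu by fact
  let ?C = "carrier G"
  have "(\<Sum>g\<in>?C. A.indchar g * B.indchar (inv g)) =
     (\<Sum>g\<in>?C. \<Sum>t\<in>?C. A.indchar g * B.lam0 (inv t \<otimes> inv g \<otimes> t)) / of_nat (card K)"
    by (simp add: B.indchar_eq sum_distrib_left sum_divide_distrib)
  also have "(\<Sum>g\<in>?C. \<Sum>t\<in>?C. A.indchar g * B.lam0 (inv t \<otimes> inv g \<otimes> t)) =
     (\<Sum>t\<in>?C. \<Sum>g\<in>?C. A.indchar g * B.lam0 (inv t \<otimes> inv g \<otimes> t))"
    by (rule sum.swap)
  also have "\<dots> = (\<Sum>t\<in>?C. \<Sum>g\<in>?C. A.indchar g * B.lam0 (inv g))"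
  proof (rule sum.cong)
    fix t assume t: "t \<in> ?C"
    show "(\<Sum>g\<in>?C. A.indchar g * B.lam0 (inv t \<otimes> inv g \<otimes> t)) =
          (\<Sum>g\<in>?C. A.indchar g * B.lam0 (inv g))"
    proof (rule sum.reindex_bij_witness[of _ "\<lambda>g. t \<otimes> g \<otimes> inv t" "\<lambda>g. inv t \<otimes> g \<otimes> t"])
      fix g assume g: "g \<in> ?C"
      show "A.indchar (inv t \<otimes> g \<otimes> t) * B.lam0 (inv (inv t \<otimes> g \<otimes> t)) =
         A.indchar g * B.lam0 (inv t \<otimes> inv g \<otimes> t)"
        using t g A.indchar_conj[OF g t] by (simp add: A.inv_mult_group A.m_assoc)
      show "t \<otimes> (inv t \<otimes> g \<otimes> t) \<otimes> inv t = g"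
        using t g by (simp add: A.m_assoc A.r_inv flip: A.m_assoc[of t "inv t"])
      show "inv t \<otimes> (t \<otimes> g \<otimes> inv t) \<otimes> t = g"
        using t g by (simp add: A.m_assoc A.l_inv flip: A.m_assoc[of "inv t" t])
    qed (use t in auto)
  qed simp
  also have "\<dots> = of_nat (card ?C) * (\<Sum>g\<in>?C. A.indchar g * B.lam0 (inv g))" by simp
  also have "(\<Sum>g\<in>?C. A.indchar g * B.lam0 (inv g)) = (\<Sum>g\<in>K. A.indchar g * mu (inv g))"
  proof (rule sum.mono_neutral_cong_right)
    show "finite ?C" by (rule A.finite_group)
    show "K \<subseteq> ?C" using B.H_carrier by auto
    show "\<forall>i\<in>?C - K. A.indchar i * B.lam0 (inv i) = 0"
      using B.H_inv by (auto simp: B.lam0_def) (metis A.inv_inv B.H_inv)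
    show "A.indchar x * B.lam0 (inv x) = A.indchar x * mu (inv x)" if "x \<in> K" for x
      using B.H_inv[OF that] by (simp add: B.lam0_def)
  qed
  finally show ?thesis by simp
qed

text \<open>  On \<open>K \<inter> tHt\<^sup>-\<^sup>1\<close> the summand is a linear character, and \<open>y\<close> witnesses that it is nontrivial; translating the
  sum by \<open>y\<close> multiplies it by a number different from \<open>1\<close>.\<close>

lemma mackey_term_zero:
  fixes G (structure)
  assumes "subgroup_linear_char G H lam" "subgroup_linear_char G K mu"
    and t: "t \<in> carrier G" and y: "y \<in> K" "y' \<in> H" "y \<otimes> t = t \<otimes> y'" "lam y' \<noteq> mu y"
  shows "(\<Sum>h\<in>K. subgroup_linear_char.lam0 H lam (inv t \<otimes> h \<otimes> t) * mu (inv h)) = 0"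
proof -
  interpret A: subgroup_linear_char G H lam by fact
  interpret B: subgroup_linear_char G K mu by fact
  define F where "F h = A.lam0 (inv t \<otimes> h \<otimes> t) * mu (inv h)" for h
  note [simp] = t A.H_carrier[OF y(2)] B.H_carrier[OF y(1)]
  have "sum F K = (\<Sum>h\<in>K. F (h \<otimes> y))"
    by (rule sum.reindex_bij_witness[of _ "\<lambda>h. h \<otimes> y" "\<lambda>h. h \<otimes> inv y"])
      (use y(1) in \<open>auto simp: B.H_mult B.H_inv A.m_assoc B.H_carrier\<close>)
  also have "\<dots> = (\<Sum>h\<in>K. F h * (lam y' * inverse (mu y)))"
  proof (rule sum.cong)
    fix h assume h: "h \<in> K"
    note [simp] = B.H_carrier[OF h]
    have "inv t \<otimes> (h \<otimes> y) \<otimes> t = inv t \<otimes> h \<otimes> t \<otimes> y'"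
      by (simp add: A.m_assoc y(3))
    then have "A.lam0 (inv t \<otimes> (h \<otimes> y) \<otimes> t) = A.lam0 (inv t \<otimes> h \<otimes> t) * lam y'"
      using y(2) by (simp add: A.lam0_mult_right)
    moreover have "mu (inv (h \<otimes> y)) = mu (inv h) * inverse (mu y)"
      using h y(1) by (simp add: B.lam_inv B.H_mult B.lam_mult)
    ultimately show "F (h \<otimes> y) = F h * (lam y' * inverse (mu y))"
      by (simp add: F_def)
  qed simp
  also have "\<dots> = sum F K * (lam y' * inverse (mu y))" by (simp add: sum_distrib_right)
  finally have "sum F K = 0 \<or> lam y' * inverse (mu y) = 1" by simp
  moreover have "lam y' * inverse (mu y) \<noteq> 1" using y(4) B.lam_nz[OF y(1)] by (simp add: field_simps)
  ultimately show ?thesis by (simp add: F_def)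
qed

lemma frobenius_sum:
  fixes G (structure)
  assumes "subgroup_linear_char G H lam" "subgroup_linear_char G K mu"
  shows "(\<Sum>h\<in>K. induced_character G H lam h * mu (inv h)) =
     (\<Sum>t\<in>carrier G. \<Sum>h\<in>K. subgroup_linear_char.lam0 H lam (inv t \<otimes> h \<otimes> t) * mu (inv h))
       / of_nat (card H)"
proof -
  interpret A: subgroup_linear_char G H lam by fact
  interpret B: subgroup_linear_char G K mu by fact
  have "(\<Sum>h\<in>K. A.indchar h * mu (inv h)) =
     (\<Sum>h\<in>K. \<Sum>t\<in>carrier G. A.lam0 (inv t \<otimes> h \<otimes> t) * mu (inv h)) / of_nat (card H)"
    by (simp add: A.indchar_eq B.H_carrier sum_distrib_right sum_divide_distrib)
  then show ?thesis by (subst (asm) sum.swap)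
qed

text \<open>  The hypothesis of Mackey's criterion: no \<open>t\<close> outside \<open>H\<close> stabilises \<open>lam\<close> on \<open>H \<inter> tHt\<^sup>-\<^sup>1\<close>.\<close>

locale mackey_irreducible = subgroup_linear_char +
  assumes mackey: "\<lbrakk>t \<in> carrier G; t \<notin> H\<rbrakk> \<Longrightarrow> \<exists>h\<in>H. \<exists>h'\<in>H. h \<otimes> t = t \<otimes> h' \<and> lam h' \<noteq> lam h"
begin

lemma indchar_norm: "(\<Sum>g\<in>carrier G. indchar g * indchar (inv g)) = of_nat (card (carrier G))"
proof -
  have ax: "subgroup_linear_char G H lam" by unfold_locales
  have "(\<Sum>h\<in>H. lam0 (inv t \<otimes> h \<otimes> t) * lam (inv h)) = (if t \<in> H then of_nat (card H) else 0)"
    if t: "t \<in> carrier G" for t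
  proof (cases "t \<in> H")
    case True
    have "lam0 (inv t \<otimes> h \<otimes> t) * lam (inv h) = 1" if "h \<in> H" for h
      using lam0_conj[OF H_carrier[OF that] True] that lam_nz[OF that] by (simp add: lam0_def lam_inv)
    then show ?thesis using True by simp
  next
    case False
    obtain h h' where "h \<in> H" "h' \<in> H" "h \<otimes> t = t \<otimes> h'" "lam h' \<noteq> lam h" using mackey[OF t False] by auto
    then show ?thesis using mackey_term_zero[OF ax ax t] False by simp
  qed
  then have "(\<Sum>h\<in>H. indchar h * lam (inv h)) =
      (\<Sum>t\<in>carrier G. if t \<in> H then of_nat (card H) else 0) / of_nat (card H)"
    unfolding frobenius_sum[OF ax ax] by simp
  also have "(\<Sum>t\<in>carrier G. if t \<in> H then of_nat (card H) else 0) = (\<Sum>t\<in>H. of_nat (card H) :: complex)"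
    using H_carrier by (intro sum.mono_neutral_cong_right) (auto simp: finite_group)
  finally show ?thesis
    unfolding frobenius_reciprocity[OF ax ax] using card_H_pos by simp
qed

text \<open>  Inverting representatives of the right cosets turns them into representatives of the left cosets.\<close>

lemma left_transversal:
  obtains t where "\<And>i. i < card (rcosets H) \<Longrightarrow> t i \<in> carrier G"
    and "\<And>g. g \<in> carrier G \<Longrightarrow> \<exists>!i. i < card (rcosets H) \<and> inv (t i) \<otimes> g \<in> H"
proof -
  let ?m = "card (rcosets H)"
  have fin: "finite (rcosets H)" using finite_group by (auto simp: RCOSETS_def)
  obtain C where C: "bij_betw C {0..<?m} (rcosets H)" using ex_bij_betw_nat_finite[OF fin] by auto
  have "\<exists>r. r \<in> carrier G \<and> C i = H #> r" if "i < ?m" for i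
    using bij_betw_apply[OF C, of i] that by (auto simp: RCOSETS_def)
  then obtain r where r: "\<And>i. i < ?m \<Longrightarrow> r i \<in> carrier G \<and> C i = H #> r i" by metis
  have mem: "r i \<otimes> g \<in> H \<longleftrightarrow> inv g \<in> C i" if i: "i < ?m" and g: "g \<in> carrier G" for i g
  proof -
    have "inv g \<in> C i \<longleftrightarrow> inv g \<otimes> inv (r i) \<in> H"
    proof
      assume "inv g \<in> C i"
      then obtain h where h: "h \<in> H" "inv g = h \<otimes> r i" using r[OF i] by (auto simp: r_coset_def)
      then show "inv g \<otimes> inv (r i) \<in> H" using r[OF i] H_carrier[OF h(1)] by (simp add: m_assoc)
    next
      assume "inv g \<otimes> inv (r i) \<in> H"
      moreover have "inv g = (inv g \<otimes> inv (r i)) \<otimes> r i" using r[OF i] g by (simp add: m_assoc)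
      ultimately show "inv g \<in> C i" using r[OF i] by (auto simp: r_coset_def)
    qed
    also have "\<dots> \<longleftrightarrow> r i \<otimes> g \<in> H"
      using r[OF i] g H_inv[of "r i \<otimes> g"] H_inv[of "inv g \<otimes> inv (r i)"]
      by (auto simp: inv_mult_group)
    finally show ?thesis by simp
  qed
  show ?thesis
  proof (rule that[of "\<lambda>i. inv (r i)"])
    show "inv (r i) \<in> carrier G" if "i < ?m" for i using r[OF that] by simp
    fix g assume g: "g \<in> carrier G"
    obtain c where c: "c \<in> rcosets H" "inv g \<in> c"
      using rcosets_part_G[OF sub] inv_closed[OF g] by auto
    then obtain i where i: "i < ?m" "c = C i"
      using C unfolding bij_betw_def by (metis atLeastLessThan_iff imageE)
    show "\<exists>!i. i < ?m \<and> inv (inv (r i)) \<otimes> g \<in> H"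
    proof (rule ex1I[of _ i])
      show "i < ?m \<and> inv (inv (r i)) \<otimes> g \<in> H" using i c mem[OF i(1) g] r by auto
      fix j assume j: "j < ?m \<and> inv (inv (r j)) \<otimes> g \<in> H"
      then have "inv g \<in> C j" using mem[of j g] g r[of j] by auto
      moreover have "C j \<in> rcosets H" using C j by (auto simp: bij_betw_def)
      ultimately have "C j = C i" using c i rcos_disjoint[OF sub] unfolding pairwise_def disjnt_def by blast
      then show "j = i" using C i j by (auto simp: bij_betw_def inj_on_def)
    qed
  qed
qed

text \<open>  The induced representation is \<open>R g = (lam0 (t\<^sub>i\<^sup>-\<^sup>1 g t\<^sub>j))\<^sub>i\<^sub>j\<close> for a left transversal \<open>t\<^sub>0, t\<^sub>1, \<dots>\<close> of \<open>H\<close>.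
  The operator \<open>\<Sum>h\<in>H. lam (h\<^sup>-\<^sup>1) R (t\<^sub>j h t\<^sub>i\<^sup>-\<^sup>1)\<close> is \<open>|H|\<close> times the matrix unit at \<open>(j, i)\<close>: the other entries
  are multiples of sums of a linear character that is nontrivial by Mackey's condition.  Applied to a
  vector with nonzero \<open>i\<close>-th entry it yields every unit vector, so a nonzero invariant subspace is
  everything.\<close>

lemma indchar_in_Irr: "indchar \<in> Irr G"
proof -
  define m where "m = card (rcosets H)"
  obtain t where t: "\<And>i. i < m \<Longrightarrow> t i \<in> carrier G"
    and tr: "\<And>g. g \<in> carrier G \<Longrightarrow> \<exists>!i. i < m \<and> inv (t i) \<otimes> g \<in> H"
    unfolding m_def by (rule left_transversal) blast
  have m0: "m > 0" using tr[OF one_closed] by auto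
  have same: "inv (t i) \<otimes> t j \<in> H \<longleftrightarrow> i = j" if "i < m" "j < m" for i j
    using tr[OF t[OF that(2)]] that t H_one by auto
  define R where "R g = mat m m (\<lambda>(i, j). lam0 (inv (t i) \<otimes> g \<otimes> t j))" for g
  have R: "R g \<in> carrier_mat m m" for g by (simp add: R_def)
  have Rmult: "R (g \<otimes> h) = R g * R h" if gh: "g \<in> carrier G" "h \<in> carrier G" for g h
  proof (rule eq_matI)
    fix i k assume ik: "i < dim_row (R g * R h)" "k < dim_col (R g * R h)"
    then have ik: "i < m" "k < m" by (auto simp: R_def)
    note [simp] = gh t[OF ik(1)] t[OF ik(2)]
    obtain j where j: "j < m" "inv (t j) \<otimes> (h \<otimes> t k) \<in> H"
      and uniq: "\<And>j'. \<lbrakk>j' < m; inv (t j') \<otimes> (h \<otimes> t k) \<in> H\<rbrakk> \<Longrightarrow> j' = j"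
      using tr[of "h \<otimes> t k"] by auto
    note [simp] = t[OF j(1)]
    have "(R g * R h) $$ (i, k) = (\<Sum>l<m. lam0 (inv (t i) \<otimes> g \<otimes> t l) * lam0 (inv (t l) \<otimes> h \<otimes> t k))"
      using ik by (simp add: R_def scalar_prod_def atLeast0LessThan)
    also have "\<dots> = (\<Sum>l<m. if l = j then lam0 (inv (t i) \<otimes> g \<otimes> t l) * lam0 (inv (t l) \<otimes> h \<otimes> t k) else 0)"
    proof (rule sum.cong)
      fix l assume "l \<in> {..<m}"
      then have l: "l < m" by simp
      show "lam0 (inv (t i) \<otimes> g \<otimes> t l) * lam0 (inv (t l) \<otimes> h \<otimes> t k) =
          (if l = j then lam0 (inv (t i) \<otimes> g \<otimes> t l) * lam0 (inv (t l) \<otimes> h \<otimes> t k) else 0)"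
      proof (cases "l = j")
        case False
        then have "inv (t l) \<otimes> (h \<otimes> t k) \<notin> H" using uniq[OF l] by blast
        then have "lam0 (inv (t l) \<otimes> h \<otimes> t k) = 0" using t[OF l] by (simp add: lam0_def m_assoc)
        then show ?thesis using False by simp
      qed simp
    qed simp
    also have "\<dots> = lam0 (inv (t i) \<otimes> g \<otimes> t j) * lam0 (inv (t j) \<otimes> h \<otimes> t k)"
      using j by simp
    also have "\<dots> = lam0 (inv (t i) \<otimes> g \<otimes> t j) * lam (inv (t j) \<otimes> h \<otimes> t k)"
      using j by (simp add: lam0_def m_assoc)
    also have "\<dots> = lam0 (inv (t i) \<otimes> g \<otimes> t j \<otimes> (inv (t j) \<otimes> h \<otimes> t k))"
      using j by (intro lam0_mult_right[symmetric]) (simp_all add: m_assoc)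
    also have "inv (t i) \<otimes> g \<otimes> t j \<otimes> (inv (t j) \<otimes> h \<otimes> t k) = inv (t i) \<otimes> (g \<otimes> h) \<otimes> t k"
    proof -
      have "t j \<otimes> (inv (t j) \<otimes> (h \<otimes> t k)) = h \<otimes> t k" by (simp flip: m_assoc)
      then show ?thesis by (simp add: m_assoc)
    qed
    finally show "R (g \<otimes> h) $$ (i, k) = (R g * R h) $$ (i, k)" using ik by (simp add: R_def)
  qed (auto simp: R_def)
  have Rone: "R \<one> = 1\<^sub>m m"
  proof (rule eq_matI)
    fix i j assume "i < dim_row (1\<^sub>m m)" "j < dim_col (1\<^sub>m m)"
    then have ij: "i < m" "j < m" by auto
    show "R \<one> $$ (i, j) = 1\<^sub>m m $$ (i, j)"
      using ij same[OF ij] t[OF ij(1)] t[OF ij(2)] lam_one by (simp add: R_def lam0_def)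
  qed (auto simp: R_def)
  have "irreducible_rep G m R"
  proof (rule irreducible_repI)
    fix W assume Wsub: "VectorSpace.subspace class_ring W (module_vec TYPE(complex) m)"
      and inv: "\<And>g w. \<lbrakk>g \<in> carrier G; w \<in> W\<rbrakk> \<Longrightarrow> R g *\<^sub>v w \<in> W"
    note W = Wsub[unfolded subspace_vec_iff]
    show "W = {0\<^sub>v m} \<or> W = carrier_vec m"
    proof (cases "W = {0\<^sub>v m}")
      case False
      then obtain w where w: "w \<in> W" "w \<noteq> 0\<^sub>v m" using W by auto
      have wc: "w \<in> carrier_vec m" using w W by auto
      obtain i where i: "i < m" "w $ i \<noteq> 0" using w(2) wc by (metis carrier_vecD eq_vecI index_zero_vec)
      note [simp] = t[OF i(1)]
      have unit: "unit_vec m j \<in> W" if j: "j < m" for j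
      proof -
        note [simp] = t[OF j]
        define F where "F h = lam (inv h) \<cdot>\<^sub>v (R (t j \<otimes> h \<otimes> inv (t i)) *\<^sub>v w)" for h
        have F_in: "F h \<in> W" if "h \<in> H" for h
          unfolding F_def using W inv w H_carrier[OF that] by auto
        have key: "(\<Sum>h\<in>H. lam (inv h) * lam0 (inv (t k) \<otimes> (t j \<otimes> h \<otimes> inv (t i)) \<otimes> t l)) =
            (if k = j \<and> l = i then of_nat (card H) else 0)" if kl: "k < m" "l < m" for k l
        proof -
          note [simp] = t[OF kl(1)] t[OF kl(2)]
          define s where "s = inv (t k) \<otimes> t j"
          define r where "r = inv (t i) \<otimes> t l"
          have [simp]: "s \<in> carrier G" "r \<in> carrier G" by (auto simp: s_def r_def)
          have eq: "inv (t k) \<otimes> (t j \<otimes> h \<otimes> inv (t i)) \<otimes> t l = s \<otimes> h \<otimes> r" if "h \<in> H" for h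
            using H_carrier[OF that] by (simp add: s_def r_def m_assoc)
          show ?thesis
          proof (cases "l = i")
            case True
            then have r: "r = \<one>" by (simp add: r_def)
            have "(\<Sum>h\<in>H. lam (inv h) * lam0 (s \<otimes> h \<otimes> r)) = (\<Sum>h\<in>H. lam0 s)"
              using H_carrier lam_nz by (intro sum.cong) (auto simp: r lam0_mult_right lam_inv)
            also have "\<dots> = (if k = j then of_nat (card H) else 0)"
              using same[OF kl(1) j] lam_one by (auto simp: s_def lam0_def)
            finally show ?thesis using True eq by simp
          next
            case False
            then have "r \<notin> H" using same[OF i(1) kl(2)] by (auto simp: r_def)
            then obtain y y' where y: "y \<in> H" "y' \<in> H" "y \<otimes> r = r \<otimes> y'" "lam y' \<noteq> lam y"
              using mackey[of r] by auto
            note [simp] = H_carrier[OF y(1)] H_carrier[OF y(2)]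
            \<comment> \<open>Translating the sum by \<open>y\<close> multiplies it by \<open>lam y' / lam y\<close>, which is not \<open>1\<close>.\<close>
            let ?S = "\<Sum>h\<in>H. lam (inv h) * lam0 (s \<otimes> h \<otimes> r)"
            have "?S = (\<Sum>h\<in>H. lam (inv (h \<otimes> y)) * lam0 (s \<otimes> (h \<otimes> y) \<otimes> r))"
              by (rule sum.reindex_bij_witness[of _ "\<lambda>h. h \<otimes> y" "\<lambda>h. h \<otimes> inv y"])
                (use y(1) in \<open>auto simp: H_mult H_inv m_assoc H_carrier\<close>)
            also have "\<dots> = (\<Sum>h\<in>H. lam (inv h) * lam0 (s \<otimes> h \<otimes> r) * (lam y' * inverse (lam y)))"
            proof (rule sum.cong)
              fix h assume h: "h \<in> H"
              note [simp] = H_carrier[OF h]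
              have "s \<otimes> (h \<otimes> y) \<otimes> r = s \<otimes> h \<otimes> r \<otimes> y'" by (simp add: m_assoc y(3))
              then have "lam0 (s \<otimes> (h \<otimes> y) \<otimes> r) = lam0 (s \<otimes> h \<otimes> r) * lam y'"
                using y(2) by (simp add: lam0_mult_right)
              then show "lam (inv (h \<otimes> y)) * lam0 (s \<otimes> (h \<otimes> y) \<otimes> r) =
                  lam (inv h) * lam0 (s \<otimes> h \<otimes> r) * (lam y' * inverse (lam y))"
                using h y(1) by (simp add: lam_inv H_mult lam_mult)
            qed simp
            also have "\<dots> = ?S * (lam y' * inverse (lam y))" by (simp add: sum_distrib_right)
            finally have "?S = 0 \<or> lam y' * inverse (lam y) = 1" by simp
            moreover have "lam y' * inverse (lam y) \<noteq> 1" using y(4) lam_nz[OF y(1)] by (simp add: field_simps)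
            ultimately have "?S = 0" by simp
            then show ?thesis using eq False by simp
          qed
        qed
        have "finsum_vec TYPE(complex) m F H = (of_nat (card H) * w $ i) \<cdot>\<^sub>v unit_vec m j"
        proof (rule eq_vecI)
          have Fc: "F \<in> H \<rightarrow> carrier_vec m" using F_in W by auto
          fix k assume "k < dim_vec ((of_nat (card H) * w $ i) \<cdot>\<^sub>v unit_vec m j)"
          then have k: "k < m" by simp
          have "finsum_vec TYPE(complex) m F H $ k = (\<Sum>h\<in>H. F h $ k)"
            by (rule index_finsum_vec[OF H_finite k Fc])
          also have "\<dots> = (\<Sum>h\<in>H. \<Sum>l<m. lam (inv h) * lam0 (inv (t k) \<otimes> (t j \<otimes> h \<otimes> inv (t i)) \<otimes> t l) * w $ l)"
            using k wc by (intro sum.cong refl)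
              (simp add: F_def R_def scalar_prod_def atLeast0LessThan carrier_vecD sum_distrib_left mult.assoc)
          also have "\<dots> = (\<Sum>l<m. (\<Sum>h\<in>H. lam (inv h) * lam0 (inv (t k) \<otimes> (t j \<otimes> h \<otimes> inv (t i)) \<otimes> t l)) * w $ l)"
            unfolding sum_distrib_right by (rule sum.swap)
          also have "\<dots> = (\<Sum>l<m. if l = i then (if k = j then of_nat (card H) * w $ i else 0) else 0)"
            by (intro sum.cong refl) (use k in \<open>auto simp: key\<close>)
          also have "\<dots> = (if k = j then of_nat (card H) * w $ i else 0)" using i by simp
          finally show "finsum_vec TYPE(complex) m F H $ k = ((of_nat (card H) * w $ i) \<cdot>\<^sub>v unit_vec m j) $ k"
            using k j by simp
          next
          have Fc: "F \<in> H \<rightarrow> carrier_vec m" using F_in W by auto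
          show "dim_vec (finsum_vec TYPE(complex) m F H) = dim_vec ((of_nat (card H) * w $ i) \<cdot>\<^sub>v unit_vec m j)"
            using finsum_vec_closed[OF Fc] by simp
        qed
        then have in_W: "(of_nat (card H) * w $ i) \<cdot>\<^sub>v unit_vec m j \<in> W" using finsum_vec_in_subspace[OF Wsub H_finite, of F] F_in by simp
        have "of_nat (card H) * w $ i \<noteq> 0" using i(2) card_H_pos by simp
        then have "inverse (of_nat (card H) * w $ i) \<cdot>\<^sub>v ((of_nat (card H) * w $ i) \<cdot>\<^sub>v unit_vec m j) = unit_vec m j"
          unfolding smult_smult_assoc by (metis left_inverse one_smult_vec)
        then show ?thesis using W in_W by metis
      qed
      have "v \<in> W" if v: "v \<in> carrier_vec m" for v
      proof -
        have "finsum_vec TYPE(complex) m (\<lambda>j. v $ j \<cdot>\<^sub>v unit_vec m j) {..<m} = v"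
        proof (rule eq_vecI)
          fix k assume "k < dim_vec v"
          then have k: "k < m" using v by (simp add: carrier_vecD)
          have "finsum_vec TYPE(complex) m (\<lambda>j. v $ j \<cdot>\<^sub>v unit_vec m j) {..<m} $ k =
              (\<Sum>j<m. (v $ j \<cdot>\<^sub>v unit_vec m j) $ k)"
            by (rule index_finsum_vec) (use k in auto)
          also have "\<dots> = (\<Sum>j<m. if j = k then v $ k else 0)"
            using k by (intro sum.cong) auto
          finally show "finsum_vec TYPE(complex) m (\<lambda>j. v $ j \<cdot>\<^sub>v unit_vec m j) {..<m} $ k = v $ k"
            using k by simp
        next
          show "dim_vec (finsum_vec TYPE(complex) m (\<lambda>j. v $ j \<cdot>\<^sub>v unit_vec m j) {..<m}) = dim_vec v"
            using finsum_vec_closed[of "\<lambda>j. v $ j \<cdot>\<^sub>v unit_vec m j" "{..<m}" m] v by (auto simp: carrier_vecD)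
        qed
        moreover have "finsum_vec TYPE(complex) m (\<lambda>j. v $ j \<cdot>\<^sub>v unit_vec m j) {..<m} \<in> W"
          using unit W by (intro finsum_vec_in_subspace[OF Wsub]) auto
        ultimately show ?thesis by simp
      qed
      then show ?thesis using W by auto
    qed simp
  qed (use m0 R Rmult Rone in auto)
  moreover have "indchar = (\<lambda>g\<in>carrier G. mat_trace (R g))"
  proof
    fix g
    show "indchar g = (\<lambda>g\<in>carrier G. mat_trace (R g)) g"
    proof (cases "g \<in> carrier G")
      case g: True
      define c where "c s = (THE i. i < m \<and> inv (t i) \<otimes> s \<in> H)" for s
      have c: "c s < m" "inv (t (c s)) \<otimes> s \<in> H" if "s \<in> carrier G" for s
        using theI'[OF tr[OF that]] by (auto simp: c_def)
      have ceq: "c s = i" if "s \<in> carrier G" "i < m" "inv (t i) \<otimes> s \<in> H" for s i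
        using tr[OF that(1)] c[OF that(1)] that by auto
      \<comment> \<open>Every group element is uniquely \<open>t i \<otimes> h\<close>, and the summand depends on \<open>i\<close> only.\<close>
      have "(\<Sum>s\<in>carrier G. lam0 (inv s \<otimes> g \<otimes> s)) =
            (\<Sum>(i, h)\<in>{..<m} \<times> H. lam0 (inv (t i) \<otimes> g \<otimes> t i))"
      proof (rule sum.reindex_bij_witness[of _ "\<lambda>(i, h). t i \<otimes> h" "\<lambda>s. (c s, inv (t (c s)) \<otimes> s)"])
        fix s assume s: "s \<in> carrier G"
        note [simp] = s t[OF c(1)[OF s]] g
        let ?h = "inv (t (c s)) \<otimes> s"
        show "(case (c s, ?h) of (i, h) \<Rightarrow> t i \<otimes> h) = s" by (simp flip: m_assoc)
        show "(c s, ?h) \<in> {..<m} \<times> H" using c[OF s] by simp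
        have "inv s \<otimes> g \<otimes> s = inv ?h \<otimes> (inv (t (c s)) \<otimes> g \<otimes> t (c s)) \<otimes> ?h"
        proof -
          have "inv ?h = inv s \<otimes> t (c s)" by (simp add: inv_mult_group)
          moreover have "t (c s) \<otimes> (inv (t (c s)) \<otimes> y) = y" if "y \<in> carrier G" for y
            using that by (simp flip: m_assoc)
          ultimately show ?thesis by (simp add: m_assoc)
        qed
        then show "(case (c s, ?h) of (i, h) \<Rightarrow> lam0 (inv (t i) \<otimes> g \<otimes> t i)) = lam0 (inv s \<otimes> g \<otimes> s)"
          using lam0_conj[of "inv (t (c s)) \<otimes> g \<otimes> t (c s)" ?h] c[OF s] by simp
      next
        fix p assume "p \<in> {..<m} \<times> H"
        then obtain i h where p: "p = (i, h)" "i < m" "h \<in> H" by auto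
        note [simp] = t[OF p(2)] H_carrier[OF p(3)]
        have eq: "inv (t i) \<otimes> (t i \<otimes> h) = h" by (simp flip: m_assoc)
        have "c (t i \<otimes> h) = i" by (rule ceq) (use p eq in auto)
        then show "(c (case p of (i, h) \<Rightarrow> t i \<otimes> h), inv (t (c (case p of (i, h) \<Rightarrow> t i \<otimes> h))) \<otimes> (case p of (i, h) \<Rightarrow> t i \<otimes> h)) = p"
          using p eq by simp
        show "(case p of (i, h) \<Rightarrow> t i \<otimes> h) \<in> carrier G" using p by simp
      qed
      also have "\<dots> = of_nat (card H) * (\<Sum>i<m. lam0 (inv (t i) \<otimes> g \<otimes> t i))"
        by (simp flip: sum.cartesian_product add: sum_distrib_left)
      finally show ?thesis using g card_H_pos by (simp add: indchar_eq R_def mat_trace_def)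
    qed (simp add: induced_character_def)
  qed
  ultimately show ?thesis unfolding Irr_def by blast
qed

end

text \<open>  If no \<open>t\<close> conjugated the characters into each other, every term of their inner product would vanish, but
  the inner product of an irreducible induced character with itself is \<open>|G|\<close>.\<close>

lemma induced_character_eqD:
  fixes G (structure)
  assumes "mackey_irreducible G H lam" "subgroup_linear_char G K mu"
    and eq: "induced_character G H lam = induced_character G K mu"
  obtains t where "t \<in> carrier G"
    "\<And>h h'. \<lbrakk>h \<in> K; h' \<in> H; h \<otimes> t = t \<otimes> h'\<rbrakk> \<Longrightarrow> lam h' = mu h"
proof (rule ccontr)
  assume neg: "\<not> thesis"
  note obt = that
  interpret A: mackey_irreducible G H lam by fact
  interpret B: subgroup_linear_char G K mu by fact
  have ax: "subgroup_linear_char G H lam" by unfold_locales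
  have "\<exists>h\<in>K. \<exists>h'\<in>H. h \<otimes> t = t \<otimes> h' \<and> lam h' \<noteq> mu h" if "t \<in> carrier G" for t
    using neg obt[OF that] by blast
  then have "(\<Sum>h\<in>K. A.lam0 (inv t \<otimes> h \<otimes> t) * mu (inv h)) = 0" if "t \<in> carrier G" for t
    using mackey_term_zero[OF ax assms(2) that] that by blast
  then have "(\<Sum>g\<in>carrier G. A.indchar g * B.indchar (inv g)) = 0"
    unfolding frobenius_reciprocity[OF ax assms(2)] frobenius_sum[OF ax assms(2)] by simp
  then have "card (carrier G) = 0" using A.indchar_norm eq by simp
  then show False using A.finite_group by auto
qed


section \<open>The cubic field extension and its additive characters\<close>

lemma finite_field_pow_card:
  fixes x :: "'f::{field,finite}"
  shows "x ^ card (UNIV :: 'f set) = x"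
proof (cases "x = 0")
  case False
  let ?S = "UNIV - {0 :: 'f}"
  have "prod (\<lambda>y. x * y) ?S = prod (\<lambda>y. y) ?S"
    by (rule prod.reindex_bij_witness[of _ "\<lambda>y. y / x" "\<lambda>y. x * y"]) (use False in auto)
  then have "x ^ card ?S * prod (\<lambda>y. y) ?S = prod (\<lambda>y. y) ?S" by (simp add: prod.distrib)
  moreover have "prod (\<lambda>y. y) ?S \<noteq> 0" by simp
  ultimately have "x ^ card ?S = 1" by simp
  moreover have "card (UNIV :: 'f set) = Suc (card ?S)"
    using card_Suc_Diff1[of "UNIV :: 'f set" 0] by simp
  ultimately show ?thesis by (metis mult.right_neutral power_Suc)
qed (simp add: finite_UNIV_card_ge_0)

text \<open>  A polynomial of degree \<open>r\<^sup>n\<^sup>-\<^sup>1\<close> has at most that many roots.  The case \<open>r = q, n = 3\<close> concerns the trace to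
  the subfield with \<open>q\<close> elements, the case \<open>r = p, n = 3k\<close> the trace to the prime field.\<close>

lemma ex_frobenius_sum_nonzero:
  assumes "r \<ge> 2" "n \<ge> 1" "r ^ (n - 1) < card (UNIV :: 'f::{field,finite} set)"
  shows "\<exists>x :: 'f. (\<Sum>i<n. x ^ (r ^ i)) \<noteq> 0"
    and "card {x :: 'f. (\<Sum>i<n. x ^ (r ^ i)) = 0} \<le> r ^ (n - 1)"
proof -
  define P :: "'f poly" where "P = (\<Sum>i<n. monom 1 (r ^ i))"
  have ev: "poly P x = (\<Sum>i<n. x ^ (r ^ i))" for x by (simp add: P_def poly_sum poly_monom)
  have inj: "r ^ i = r ^ j \<longleftrightarrow> i = j" for i j using assms(1) by (simp add: power_inject_exp)
  have "coeff P (r ^ (n - 1)) = (\<Sum>i<n. if i = n - 1 then 1 else 0)"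
    unfolding P_def coeff_sum by (intro sum.cong) (auto simp: coeff_monom inj)
  also have "\<dots> = 1" using assms(2) by simp
  finally have nz: "P \<noteq> 0" by auto
  have "degree P \<le> r ^ (n - 1)"
    unfolding P_def using assms by (intro degree_sum_le) (auto intro!: order.trans[OF degree_monom_le] power_increasing)
  then have le: "card {x. poly P x = 0} \<le> r ^ (n - 1)"
    using card_poly_roots_bound[OF nz] by linarith
  then show "card {x :: 'f. (\<Sum>i<n. x ^ (r ^ i)) = 0} \<le> r ^ (n - 1)" by (simp add: ev)
  show "\<exists>x :: 'f. (\<Sum>i<n. x ^ (r ^ i)) \<noteq> 0"
  proof (rule ccontr)
    assume "\<not> ?thesis"
    then have "{x. poly P x = 0} = UNIV" by (auto simp: ev)
    then show False using le assms(3) by simp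
  qed
qed

locale triality_field =
  fixes p k q :: nat and ty :: "'f::{field,finite} itself"
  assumes p_prime: "prime p" and k_pos: "k \<ge> 1" and q_def: "q = p ^ k"
    and card_K: "card (UNIV :: 'f set) = q ^ 3"
begin

definition fr :: "'f \<Rightarrow> 'f" where "fr x = x ^ q"
definition tr :: "'f \<Rightarrow> 'f" where "tr x = x + fr x + fr (fr x)"
definition nm :: "'f \<Rightarrow> 'f" where "nm x = x * fr x * fr (fr x)"

abbreviation F :: "'f set" where "F \<equiv> Fq q"

lemma q_ge_2: "q \<ge> 2"
  using p_prime k_pos prime_ge_2_nat[OF p_prime] self_le_power[of p k] by (simp add: q_def)

lemma fr_add [simp]: "fr (x + y) = fr x + fr y"
  using frobenius_triality_field(1)[OF p_prime k_pos q_def card_K] by (simp add: fr_def)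

lemma fr_mult [simp]: "fr (x * y) = fr x * fr y" by (simp add: fr_def power_mult_distrib)
lemma fr_0 [simp]: "fr 0 = 0" using q_ge_2 by (simp add: fr_def)
lemma fr_1 [simp]: "fr 1 = 1" by (simp add: fr_def)
lemma fr_minus [simp]: "fr (- x) = - fr x" 
  by (metis add.right_inverse fr_0 fr_add minus_unique)
lemma fr_diff [simp]: "fr (x - y) = fr x - fr y" using fr_add[of x "- y"] by simp
lemma fr_of_nat [simp]: "fr (of_nat n) = of_nat n"
  by (induction n) auto
lemma fr_divide [simp]: "fr (x / y) = fr x / fr y" by (simp add: fr_def power_divide)
lemma fr_fr_fr [simp]: "fr (fr (fr x)) = x"
  using finite_field_pow_card[of x] by (simp add: fr_def card_K power3_eq_cube flip: power_mult)
lemma fr_eq_0 [simp]: "fr x = 0 \<longleftrightarrow> x = 0" using q_ge_2 by (simp add: fr_def)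

lemma F_iff: "x \<in> F \<longleftrightarrow> fr x = x" by (simp add: Fq_def fr_def)

lemma F_0 [simp]: "0 \<in> F" by (simp add: F_iff)
lemma F_1 [simp]: "1 \<in> F" by (simp add: F_iff)
lemma F_add [simp]: "\<lbrakk>x \<in> F; y \<in> F\<rbrakk> \<Longrightarrow> x + y \<in> F" by (simp add: F_iff)
lemma F_diff [simp]: "\<lbrakk>x \<in> F; y \<in> F\<rbrakk> \<Longrightarrow> x - y \<in> F" by (simp add: F_iff)
lemma F_mult [simp]: "\<lbrakk>x \<in> F; y \<in> F\<rbrakk> \<Longrightarrow> x * y \<in> F" by (simp add: F_iff)
lemma F_divide [simp]: "\<lbrakk>x \<in> F; y \<in> F\<rbrakk> \<Longrightarrow> x / y \<in> F" by (simp add: F_iff)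
lemma F_minus [simp]: "x \<in> F \<Longrightarrow> - x \<in> F" by (simp add: F_iff)
lemma F_numeral [simp]: "numeral n \<in> F"
  using fr_of_nat[of "numeral n"] by (simp add: F_iff)

lemma tr_in_F [simp]: "tr x \<in> F" by (simp add: F_iff tr_def)
lemma nm_in_F [simp]: "nm x \<in> F" by (simp add: F_iff nm_def)
lemma nm_eq_0 [simp]: "nm x = 0 \<longleftrightarrow> x = 0" by (simp add: nm_def)
lemma tr_add: "tr (x + y) = tr x + tr y" by (simp add: tr_def)
lemma tr_diff: "tr (x - y) = tr x - tr y" by (simp add: tr_def)
lemma tr_minus: "tr (- x) = - tr x" by (simp add: tr_def)
lemma tr_0 [simp]: "tr 0 = 0" by (simp add: tr_def)
lemma tr_fr [simp]: "tr (fr x) = tr x" by (simp add: tr_def)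
lemma tr_scale: "u \<in> F \<Longrightarrow> tr (u * x) = u * tr x" by (simp add: tr_def F_iff algebra_simps)

lemma tr_as_sum: "tr x = (\<Sum>i<3. x ^ (q ^ i))"
  by (simp add: tr_def fr_def numeral_3_eq_3 lessThan_Suc flip: power_mult)

lemma ex_tr_nonzero: "\<exists>x. tr x \<noteq> 0"
  unfolding tr_as_sum using q_ge_2
  by (intro ex_frobenius_sum_nonzero) (auto simp: card_K intro!: power_strict_increasing)

lemma ex_tr_eq: assumes "c \<in> F" shows "\<exists>x. tr x = c"
proof -
  obtain y where y: "tr y \<noteq> 0" using ex_tr_nonzero by auto
  have "tr ((c / tr y) * y) = c" using y assms by (subst tr_scale) auto
  then show ?thesis by blast
qed

lemma card_additive_fibres:
  fixes f :: "'f \<Rightarrow> 'f"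
  assumes "\<And>x y. f (x - y) = f x - f y"
  shows "card (UNIV :: 'f set) = card (range f) * card {x. f x = 0}"
proof -
  have "card (f -` {y}) = card {x. f x = 0}" if y: "y \<in> range f" for y
  proof -
    obtain z where z: "y = f z" using y by auto
    have add: "f (a + b) = f a + f b" for a b
      using assms[of "a + b" b] by (simp add: algebra_simps)
    have "bij_betw (\<lambda>x. x + z) {x. f x = 0} (f -` {y})"
      by (rule bij_betwI[of _ _ _ "\<lambda>x. x - z"]) (auto simp: assms add z)
    then show ?thesis by (metis bij_betw_same_card)
  qed
  moreover have "card (UNIV :: 'f set) = (\<Sum>y\<in>range f. card (f -` {y}))"
    using sum.group[of "UNIV :: 'f set" "range f" f "\<lambda>_. 1 :: nat"] by (simp add: vimage_def)
  ultimately show ?thesis by simp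
qed

text \<open>  The kernel of \<open>x \<mapsto> x\<^sup>q - x\<close> is \<open>F\<close> and its image lies in the kernel of the trace, which has at most \<open>q\<^sup>2\<close>
  elements; hence \<open>F\<close> has at least \<open>q\<close> elements.  It has at most \<open>q\<close> as the zero set of a polynomial.\<close>

lemma card_F: "card F = q"
proof -
  define f where "f x = fr x - x" for x
  have ker: "{x. f x = 0} = F" by (auto simp: f_def F_iff)
  have "range f \<subseteq> {x. tr x = 0}" by (auto simp: f_def tr_diff)
  then have "card (range f) \<le> card {x. tr x = 0}" by (intro card_mono) auto
  also have "\<dots> \<le> q ^ 2"
    unfolding tr_as_sum using q_ge_2 ex_frobenius_sum_nonzero(2)[of q 3, where 'f = 'f]
    by (auto simp: card_K intro!: power_strict_increasing)
  finally have le: "card (range f) \<le> q ^ 2" .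
  have eq: "q ^ 3 = card (range f) * card F"
    using card_additive_fibres[of f] by (simp only: card_K ker) (simp add: f_def)
  have "q ^ 3 \<le> q ^ 2 * card F" unfolding eq using le by simp
  then have "q \<le> card F" using q_ge_2 by (simp add: power3_eq_cube power2_eq_square)
  moreover have "card F \<le> q"
  proof -
    define P :: "'f poly" where "P = monom 1 q - monom 1 1"
    have "coeff P q = 1" using q_ge_2 by (simp add: P_def)
    then have nz: "P \<noteq> 0" by auto
    have "degree P \<le> q" unfolding P_def using q_ge_2
      by (intro degree_diff_le) (auto intro: order.trans[OF degree_monom_le])
    moreover have "{x. poly P x = 0} = F" by (auto simp: P_def poly_monom F_iff fr_def)
    ultimately show ?thesis using card_poly_roots_bound[OF nz] by simp
  qed
  ultimately show ?thesis by simp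
qed

lemma char_p: "CHAR('f) = p"
proof -
  have "prime CHAR('f)"
    by (rule prime_CHAR_semidom) (simp add: finite_imp_CHAR_pos)
  moreover have "CHAR('f) dvd p ^ (k * 3)"
    using CHAR_dvd_CARD[where 'a = 'f] card_K q_def by (simp add: power_mult)
  ultimately show ?thesis
    using p_prime by (meson prime_dvd_power primes_dvd_imp_eq)
qed

lemma two_eq_0: "even q \<Longrightarrow> (2 :: 'f) = 0"
proof -
  assume "even q"
  then have "p = 2" using p_prime k_pos by (simp add: q_def) (metis primes_dvd_imp_eq two_is_prime_nat)
  then show ?thesis using char_p of_nat_CHAR[where 'a = 'f] by simp
qed

lemma two_neq_0: "odd q \<Longrightarrow> (2 :: 'f) \<noteq> 0"
proof
  assume "odd q" "(2 :: 'f) = 0"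
  then have "CHAR('f) dvd 2" using of_nat_eq_0_iff_char_dvd[of 2, where 'a = 'f] by simp
  then have "p = 2" using p_prime by (simp add: char_p primes_dvd_imp_eq)
  then show False using \<open>odd q\<close> k_pos by (simp add: q_def)
qed

definition abs_tr :: "'f \<Rightarrow> 'f" where "abs_tr x = (\<Sum>i<k * 3. x ^ (p ^ i))"

lemma abs_tr_add: "abs_tr (x + y) = abs_tr x + abs_tr y"
  unfolding abs_tr_def sum.distrib[symmetric]
  by (intro sum.cong refl freshmans_dream') (use p_prime in \<open>auto simp: char_p\<close>)

lemma abs_tr_pow: "abs_tr x ^ p = abs_tr x"
proof -
  have "abs_tr x ^ p = (\<Sum>i<k * 3. (x ^ (p ^ i)) ^ p)"
    unfolding abs_tr_def by (rule freshmans_dream_sum) (use p_prime in \<open>auto simp: char_p\<close>)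
  also have "\<dots> = (\<Sum>i<k * 3. x ^ (p ^ Suc i))"
    by (intro sum.cong) (auto simp: mult.commute simp flip: power_mult)
  also have "\<dots> = (\<Sum>i<Suc (k * 3). x ^ (p ^ i)) - x"
    by (subst sum.lessThan_Suc_shift) simp
  also have "\<dots> = abs_tr x"
    using finite_field_pow_card[of x] by (simp add: abs_tr_def card_K q_def power_mult)
  finally show ?thesis .
qed

text \<open>  The \<open>p\<close> images of natural numbers are already all roots of \<open>X\<^sup>p - X\<close>.\<close>

lemma prime_subfield: "(x :: 'f) ^ p = x \<Longrightarrow> \<exists>j. x = of_nat j"
proof -
  assume x: "x ^ p = x"
  have p2: "p \<ge> 2" using p_prime by (rule prime_ge_2_nat)
  define P :: "'f poly" where "P = monom 1 p - monom 1 1"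
  have "coeff P p = 1" using p2 by (simp add: P_def)
  then have nz: "P \<noteq> 0" by auto
  have deg: "degree P \<le> p" unfolding P_def using p2
    by (intro degree_diff_le) (auto intro: order.trans[OF degree_monom_le])
  have sub: "of_nat ` {..<p} \<subseteq> {x. poly P x = 0}"
  proof clarify
    fix j
    have "of_nat j ^ p = (of_nat j :: 'f)"
    proof (induction j)
      case (Suc j)
      have "(1 + of_nat j :: 'f) ^ p = 1 ^ p + of_nat j ^ p"
        by (rule freshmans_dream) (use p_prime in \<open>auto simp: char_p\<close>)
      then show ?case using Suc by simp
    qed (use p2 in simp)
    then show "poly P (of_nat j) = 0" by (simp add: P_def poly_monom)
  qed
  have "inj_on (of_nat :: nat \<Rightarrow> 'f) {..<p}"
    by (intro inj_onI) (auto simp: of_nat_eq_iff_cong_CHAR char_p cong_def)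
  then have "card (of_nat ` {..<p} :: 'f set) = p" by (simp add: card_image)
  moreover have "card {x. poly P x = 0} \<le> p" using card_poly_roots_bound[OF nz] deg by linarith
  ultimately have "of_nat ` {..<p} = {x. poly P x = 0}"
    using sub by (intro card_seteq) (auto simp: poly_roots_finite[OF nz])
  moreover have "x \<in> {x. poly P x = 0}" using x by (simp add: P_def poly_monom)
  ultimately show ?thesis by blast
qed

text \<open>  Compose the trace to the prime field with \<open>j \<mapsto> exp (2 \<pi> \<i> j / p)\<close>, after scaling by an element \<open>y\<close> of
  nonzero trace.  The scaling is what makes the character nontrivial on the prime field, and hence on \<open>F\<close>,
  also when \<open>p = 3\<close> and the trace of \<open>1\<close> vanishes.\<close>

lemma ex_additive_char:
  "\<exists>\<theta> :: 'f \<Rightarrow> complex. (\<forall>x y. \<theta> (x + y) = \<theta> x * \<theta> y) \<and> (\<forall>x. cmod (\<theta> x) = 1) \<and> \<theta> 1 \<noteq> 1"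
proof -
  have p2: "p \<ge> 2" using p_prime by (rule prime_ge_2_nat)
  have "\<exists>y :: 'f. abs_tr y \<noteq> 0"
    unfolding abs_tr_def using p2 k_pos
    by (intro ex_frobenius_sum_nonzero)
      (auto simp: card_K q_def simp flip: power_mult intro!: power_strict_increasing)
  then obtain y where y: "abs_tr y \<noteq> 0" by auto
  define e where "e j = cis (2 * pi * real j / real p)" for j :: nat
  have e_add: "e (i + j) = e i * e j" for i j
    using p2 by (simp add: e_def cis_mult add_divide_distrib distrib_left)
  have e_eq_1: "e j = 1 \<longleftrightarrow> p dvd j" for j
  proof -
    have "e j = 1 \<longleftrightarrow> (\<exists>n::int. 2 * pi * real j / real p = of_int n * 2 * pi)"
    proof
      assume "e j = 1"
      then have "cos (2 * pi * real j / real p) = 1" by (simp add: e_def complex_eq_iff)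
      then show "\<exists>n::int. 2 * pi * real j / real p = of_int n * 2 * pi" by (simp only: cos_one_2pi_int)
    next
      assume "\<exists>n::int. 2 * pi * real j / real p = of_int n * 2 * pi"
      then obtain n :: int where "2 * pi * real j / real p = 2 * pi * of_int n" by (auto simp: mult_ac)
      then show "e j = 1" unfolding e_def by (simp only: cis_multiple_2pi Ints_of_int)
    qed
    also have "\<dots> \<longleftrightarrow> (\<exists>n::int. real j = of_int n * real p)"
      using p2 by (auto simp: field_simps)
    also have "\<dots> \<longleftrightarrow> int p dvd int j"
      by (auto simp: dvd_def mult.commute) (metis of_int_eq_iff of_int_mult of_int_of_nat_eq)+
    finally show ?thesis by simp
  qed
  have e_cong: "e i = e j" if "[i = j] (mod p)" for i j
  proof -
    have aux: "e i = e j" if "[i = j] (mod p)" "i \<le> j" for i j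
    proof -
      have "p dvd j - i" using that mod_eq_dvd_iff_nat[of i j p] by (simp add: cong_def)
      then have "e (i + (j - i)) = e i" unfolding e_add using e_eq_1 by simp
      then show ?thesis using that by simp
    qed
    show ?thesis using aux[of i j] aux[of j i] that cong_sym[OF that] by (metis nat_le_linear)
  qed
  define lg where "lg x = (SOME j. x = (of_nat j :: 'f))" for x
  have lg: "abs_tr x = of_nat (lg (abs_tr x))" for x
    unfolding lg_def by (rule someI_ex) (rule prime_subfield[OF abs_tr_pow])
  define \<theta> where "\<theta> x = e (lg (abs_tr (y * x)))" for x
  have "\<theta> (x + z) = \<theta> x * \<theta> z" for x z
  proof -
    have "of_nat (lg (abs_tr (y * (x + z)))) = (of_nat (lg (abs_tr (y * x)) + lg (abs_tr (y * z))) :: 'f)"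
      unfolding of_nat_add lg[symmetric] by (simp add: distrib_left abs_tr_add)
    then have "[lg (abs_tr (y * (x + z))) = lg (abs_tr (y * x)) + lg (abs_tr (y * z))] (mod p)"
      by (simp only: of_nat_eq_iff_cong_CHAR char_p)
    then show ?thesis unfolding \<theta>_def e_add[symmetric] by (rule e_cong)
  qed
  moreover have "cmod (\<theta> x) = 1" for x by (simp add: \<theta>_def e_def)
  moreover have "\<theta> 1 \<noteq> 1"
  proof
    assume "\<theta> 1 = 1"
    then have "p dvd lg (abs_tr y)" by (simp add: \<theta>_def e_eq_1)
    then have "of_nat (lg (abs_tr y)) = (0 :: 'f)" by (simp add: of_nat_eq_0_iff_char_dvd char_p)
    then show False using lg[of y] y by simp
  qed
  ultimately show ?thesis by blast
qed

end


section \<open>Multiplication of normal forms\<close>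

text \<open>  The commutation rules below are instantiated at concrete indices, because a rule
  \<open>x j u \<otimes> x i t = x i t \<otimes> x j u\<close> with variable indices is permutative and would not sort a product.\<close>

definition D4_commuting :: "nat \<Rightarrow> nat \<Rightarrow> bool" where
  "D4_commuting i j \<longleftrightarrow> i \<in> {1..12} \<and> j \<in> {1..12} \<and>
     (\<forall>(a, b, c)\<in>D4_sums. (a, b) \<noteq> (i, j) \<and> (a, b) \<noteq> (j, i))"

lemma D4_commuting_members:
  "D4_commuting 1 5" "D4_commuting 1 6" "D4_commuting 1 7" "D4_commuting 1 8" "D4_commuting 1 9"
  "D4_commuting 1 10" "D4_commuting 1 12" "D4_commuting 2 3" "D4_commuting 2 4" "D4_commuting 2 5"
  "D4_commuting 2 8" "D4_commuting 2 10" "D4_commuting 2 11" "D4_commuting 2 12" "D4_commuting 3 4"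
  "D4_commuting 3 6" "D4_commuting 3 8" "D4_commuting 3 9" "D4_commuting 3 11" "D4_commuting 3 12"
  "D4_commuting 4 7" "D4_commuting 4 9" "D4_commuting 4 10" "D4_commuting 4 11" "D4_commuting 4 12"
  "D4_commuting 5 6" "D4_commuting 5 7" "D4_commuting 5 8" "D4_commuting 5 10" "D4_commuting 5 11"
  "D4_commuting 5 12" "D4_commuting 6 7" "D4_commuting 6 8" "D4_commuting 6 9" "D4_commuting 6 11"
  "D4_commuting 6 12" "D4_commuting 7 9" "D4_commuting 7 10" "D4_commuting 7 11" "D4_commuting 7 12"
  "D4_commuting 8 9" "D4_commuting 8 10" "D4_commuting 8 11" "D4_commuting 8 12" "D4_commuting 9 10"
  "D4_commuting 9 11" "D4_commuting 9 12" "D4_commuting 10 11" "D4_commuting 10 12" "D4_commuting 11 12"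
  by (simp_all add: D4_commuting_def D4_sums_def)

context UD4
begin

lemma D4_members:
  "(1, 2, 5) \<in> D4_sums" "(1, 3, 6) \<in> D4_sums" "(1, 4, 7) \<in> D4_sums" "(1, 11, 12) \<in> D4_sums"
  "(2, 6, 8) \<in> D4_sums" "(2, 7, 10) \<in> D4_sums" "(2, 9, 11) \<in> D4_sums" "(3, 5, 8) \<in> D4_sums"
  "(3, 7, 9) \<in> D4_sums" "(3, 10, 11) \<in> D4_sums" "(4, 5, 10) \<in> D4_sums" "(4, 6, 9) \<in> D4_sums"
  "(4, 8, 11) \<in> D4_sums" "(5, 9, 12) \<in> D4_sums" "(6, 10, 12) \<in> D4_sums" "(7, 8, 12) \<in> D4_sums"
  by (simp_all add: D4_sums_def)

lemma D4_sums_range: "(i, j, k) \<in> D4_sums \<Longrightarrow> i \<in> {1..12} \<and> j \<in> {1..12} \<and> k \<in> {1..12}"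
  unfolding D4_sums_def by auto

lemma root_zero: "i \<in> {1..12} \<Longrightarrow> x i 0 = \<one>"
  using root_add[of i 0 0] root_closed[of i 0] by simp

lemma commutator_swap:
  assumes "a \<in> carrier G" "b \<in> carrier G"
  shows "a \<otimes> b = b \<otimes> a \<otimes> group_commutator G a b"
proof -
  have "group_commutator G a b = inv (b \<otimes> a) \<otimes> (a \<otimes> b)"
    using assms by (simp add: group_commutator_def inv_mult_group m_assoc)
  moreover have "b \<otimes> a \<otimes> (inv (b \<otimes> a) \<otimes> (a \<otimes> b)) = b \<otimes> a \<otimes> inv (b \<otimes> a) \<otimes> (a \<otimes> b)"
    using assms by (simp only: m_assoc[of "b \<otimes> a"] m_closed inv_closed)
  ultimately show ?thesis using assms by simp
qed

lemma root_swap: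
  assumes "(i, j, k) \<in> D4_sums"
  shows "x j u \<otimes> x i t = x i t \<otimes> (x j u \<otimes> x k (- (t * u)))"
proof -
  have k: "k \<in> {1..12}" using D4_sums_range[OF assms] by blast
  have [simp]: "x i t' \<in> carrier G" "x j t' \<in> carrier G" "x k t' \<in> carrier G" for t'
    using D4_sums_range[OF assms] root_closed by blast+
  have "x i t \<otimes> x j u = x j u \<otimes> x i t \<otimes> group_commutator G (x i t) (x j u)"
    by (rule commutator_swap) auto
  then have eq: "x i t \<otimes> x j u = x j u \<otimes> x i t \<otimes> x k (t * u)"
    by (simp add: root_comm[OF assms])
  have "x i t \<otimes> (x j u \<otimes> x k (- (t * u))) = x i t \<otimes> x j u \<otimes> x k (- (t * u))"
    by (simp add: m_assoc)
  also have "\<dots> = x j u \<otimes> x i t \<otimes> (x k (t * u) \<otimes> x k (- (t * u)))"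
    unfolding eq by (simp add: m_assoc)
  also have "x k (t * u) \<otimes> x k (- (t * u)) = \<one>" using root_add[OF k] root_zero[OF k] by simp
  finally show ?thesis by simp
qed

lemma root_swap_trivial:
  assumes "D4_commuting i j"
  shows "x j u \<otimes> x i t = x i t \<otimes> x j u"
proof -
  have ij: "i \<in> {1..12}" "j \<in> {1..12}" using assms by (auto simp: D4_commuting_def)
  have "x i t \<otimes> x j u = x j u \<otimes> x i t \<otimes> group_commutator G (x i t) (x j u)"
    by (rule commutator_swap) (use ij root_closed in blast)+
  moreover have "\<nexists>k. (i, j, k) \<in> D4_sums \<or> (j, i, k) \<in> D4_sums"
    using assms unfolding D4_commuting_def by fast
  ultimately show ?thesis using root_comm_trivial[OF ij] root_closed[OF ij(1)] root_closed[OF ij(2)] by simp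
qed

lemma root_swap_mid:
  "\<lbrakk>(i, j, k) \<in> D4_sums; w \<in> carrier G\<rbrakk> \<Longrightarrow>
    x j u \<otimes> (x i t \<otimes> w) = x i t \<otimes> (x j u \<otimes> (x k (- (t * u)) \<otimes> w))"
  using root_swap[of i j k u t] D4_sums_range[of i j k] root_closed[of i] root_closed[of j] root_closed[of k]
  by (simp flip: m_assoc)

lemma root_swap_trivial_mid:
  "\<lbrakk>D4_commuting i j; w \<in> carrier G\<rbrakk> \<Longrightarrow> x j u \<otimes> (x i t \<otimes> w) = x i t \<otimes> (x j u \<otimes> w)"
  using root_swap_trivial[of i j u t] root_closed[of i] root_closed[of j]
  by (simp add: D4_commuting_def flip: m_assoc)

lemma root_add_mid:
  "\<lbrakk>i \<in> {1..12}; w \<in> carrier G\<rbrakk> \<Longrightarrow> x i t \<otimes> (x i u \<otimes> w) = x i (t + u) \<otimes> w"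
  using root_add[of i t u] by (simp add: root_closed flip: m_assoc)


definition of_coords :: "'f coords \<Rightarrow> 'g" where
  "of_coords = (\<lambda>(a1, a2, a3, a4, a5, a6, a7, a8, a9, a10, a11, a12).
     x 1 a1 \<otimes> x 2 a2 \<otimes> x 3 a3 \<otimes> x 4 a4 \<otimes> x 5 a5 \<otimes> x 6 a6 \<otimes>
     x 7 a7 \<otimes> x 8 a8 \<otimes> x 9 a9 \<otimes> x 10 a10 \<otimes> x 11 a11 \<otimes> x 12 a12)"

lemma of_coords_closed: "of_coords u \<in> carrier G"
  by (cases u rule: coords_cases) (simp add: of_coords_def root_closed)

lemmas collect_roots = m_assoc root_closed
  D4_members[THEN root_swap] D4_members[THEN root_swap_mid]
  D4_commuting_members[THEN root_swap_trivial] D4_commuting_members[THEN root_swap_trivial_mid]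
  root_add root_add_mid

text \<open>  Sorting the word \<open>x 1 a1 \<otimes> \<dots> \<otimes> x 12 a12 \<otimes> x i t\<close>.  Multiplying by one root element at a time keeps the words
  short; associativity in the tuple model then gives general products.\<close>

lemma of_coords_mult_root:
  shows
    "of_coords u \<otimes> x 1 t = of_coords (ud4_mult u (ud4_root 1 t))"
    "of_coords u \<otimes> x 2 t = of_coords (ud4_mult u (ud4_root 2 t))"
    "of_coords u \<otimes> x 3 t = of_coords (ud4_mult u (ud4_root 3 t))"
    "of_coords u \<otimes> x 4 t = of_coords (ud4_mult u (ud4_root 4 t))"
    "of_coords u \<otimes> x 5 t = of_coords (ud4_mult u (ud4_root 5 t))"
    "of_coords u \<otimes> x 6 t = of_coords (ud4_mult u (ud4_root 6 t))"
    "of_coords u \<otimes> x 7 t = of_coords (ud4_mult u (ud4_root 7 t))"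
    "of_coords u \<otimes> x 8 t = of_coords (ud4_mult u (ud4_root 8 t))"
    "of_coords u \<otimes> x 9 t = of_coords (ud4_mult u (ud4_root 9 t))"
    "of_coords u \<otimes> x 10 t = of_coords (ud4_mult u (ud4_root 10 t))"
    "of_coords u \<otimes> x 11 t = of_coords (ud4_mult u (ud4_root 11 t))"
    "of_coords u \<otimes> x 12 t = of_coords (ud4_mult u (ud4_root 12 t))"
  by (cases u rule: coords_cases;
      simp add: of_coords_def ud4_mult_def ud4_root_simps collect_roots del: One_nat_def;
      (simp add: algebra_simps)?)+

lemma of_coords_mult: "of_coords u \<otimes> of_coords v = of_coords (ud4_mult u v)"
proof -
  obtain b1 b2 b3 b4 b5 b6 b7 b8 b9 b10 b11 b12
    where v: "v = (b1, b2, b3, b4, b5, b6, b7, b8, b9, b10, b11, b12)" by (rule coords_cases)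
  have "of_coords u \<otimes> of_coords v = of_coords u \<otimes> x 1 b1 \<otimes> x 2 b2 \<otimes> x 3 b3 \<otimes> x 4 b4 \<otimes> x 5 b5 \<otimes>
      x 6 b6 \<otimes> x 7 b7 \<otimes> x 8 b8 \<otimes> x 9 b9 \<otimes> x 10 b10 \<otimes> x 11 b11 \<otimes> x 12 b12"
    unfolding v of_coords_def[THEN fun_cong, of "(b1, b2, b3, b4, b5, b6, b7, b8, b9, b10, b11, b12)"] prod.case
    by (simp add: m_assoc root_closed of_coords_closed)
  also have "\<dots> = of_coords (ud4_mult u v)"
    unfolding of_coords_mult_root ud4_mult_assoc
    by (simp add: v ud4_mult_def[THEN fun_cong, of "ud4_root _ _"] ud4_mult_def ud4_root_simps)
  finally show ?thesis .
qed

lemma of_coords_surj: assumes "g \<in> carrier G" obtains u where "g = of_coords u"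
proof -
  obtain t :: "nat \<Rightarrow> 'f" where t: "g = x 1 (t 1) \<otimes> x 2 (t 2) \<otimes> x 3 (t 3) \<otimes> x 4 (t 4) \<otimes> x 5 (t 5) \<otimes> x 6 (t 6) \<otimes>
              x 7 (t 7) \<otimes> x 8 (t 8) \<otimes> x 9 (t 9) \<otimes> x 10 (t 10) \<otimes> x 11 (t 11) \<otimes> x 12 (t 12)"
    using normal_form[OF assms] by (elim ex1E conjE)
  show ?thesis
    by (rule that[of "(t 1, t 2, t 3, t 4, t 5, t 6, t 7, t 8, t 9, t 10, t 11, t 12)"])
      (simp only: t of_coords_def prod.case)
qed

lemma of_coords_inj: assumes "of_coords u = of_coords v" shows "u = v"
proof -
  obtain a1 a2 a3 a4 a5 a6 a7 a8 a9 a10 a11 a12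
    where u: "u = (a1, a2, a3, a4, a5, a6, a7, a8, a9, a10, a11, a12)" by (rule coords_cases)
  obtain b1 b2 b3 b4 b5 b6 b7 b8 b9 b10 b11 b12
    where v: "v = (b1, b2, b3, b4, b5, b6, b7, b8, b9, b10, b11, b12)" by (rule coords_cases)
  define s where "s = (\<lambda>i\<in>{1..12::nat}. [a1, a2, a3, a4, a5, a6, a7, a8, a9, a10, a11, a12] ! (i - 1))"
  define t where "t = (\<lambda>i\<in>{1..12::nat}. [b1, b2, b3, b4, b5, b6, b7, b8, b9, b10, b11, b12] ! (i - 1))"
  have st: "s \<in> {1..12} \<rightarrow>\<^sub>E UNIV" "t \<in> {1..12} \<rightarrow>\<^sub>E UNIV" by (simp_all add: s_def t_def)
  let ?prod = "\<lambda>t :: nat \<Rightarrow> 'f. x 1 (t 1) \<otimes> x 2 (t 2) \<otimes> x 3 (t 3) \<otimes> x 4 (t 4) \<otimes> x 5 (t 5) \<otimes> x 6 (t 6) \<otimes>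
              x 7 (t 7) \<otimes> x 8 (t 8) \<otimes> x 9 (t 9) \<otimes> x 10 (t 10) \<otimes> x 11 (t 11) \<otimes> x 12 (t 12)"
  have vals:
    "s 1 = a1" "s 2 = a2" "s 3 = a3" "s 4 = a4" "s 5 = a5" "s 6 = a6"
    "s 7 = a7" "s 8 = a8" "s 9 = a9" "s 10 = a10" "s 11 = a11" "s 12 = a12"
    "t 1 = b1" "t 2 = b2" "t 3 = b3" "t 4 = b4" "t 5 = b5" "t 6 = b6"
    "t 7 = b7" "t 8 = b8" "t 9 = b9" "t 10 = b10" "t 11 = b11" "t 12 = b12"
    by (simp_all add: s_def t_def)
  have "of_coords u = ?prod s" "of_coords v = ?prod t"
    by (simp_all only: u v of_coords_def prod.case vals)
  then have "of_coords u = ?prod s" "of_coords u = ?prod t" using assms by simp_all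
  moreover have "\<exists>!t. t \<in> {1..12} \<rightarrow>\<^sub>E UNIV \<and> of_coords u = ?prod t"
    by (rule normal_form[OF of_coords_closed])
  moreover have "\<And>P (a :: nat \<Rightarrow> 'f) b. \<lbrakk>\<exists>!x. P x; P a; P b\<rbrakk> \<Longrightarrow> a = b" by blast
  ultimately have st: "s = t" using st by presburger
  show ?thesis unfolding u v vals(1-12)[symmetric] vals(13-24)[symmetric] st by (rule refl)
qed

lemma triality_of_coords:
  assumes "is_triality G x q \<sigma>"
  shows "\<sigma> (of_coords u) = of_coords (ud4_triality q u)"
proof -
  obtain a1 a2 a3 a4 a5 a6 a7 a8 a9 a10 a11 a12
    where u: "u = (a1, a2, a3, a4, a5, a6, a7, a8, a9, a10, a11, a12)" by (rule coords_cases)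
  have hom: "\<sigma> (g \<otimes> h) = \<sigma> g \<otimes> \<sigma> h" if "g \<in> carrier G" "h \<in> carrier G" for g h
    using assms that by (simp add: is_triality_def iso_def hom_def)
  have root: "\<sigma> (x i t) = x (triality_perm i) (t ^ q)" if "i \<in> {1..12}" for i t
    using assms that by (simp add: is_triality_def)
  show ?thesis
    by (simp add: u of_coords_def ud4_triality_def hom root root_closed m_assoc triality_perm_def
          collect_roots del: One_nat_def)
qed

lemma triality_fixed_iff:
  assumes "is_triality G x q \<sigma>"
  shows "\<sigma> (of_coords u) = of_coords u \<longleftrightarrow> ud4_triality q u = u"
  using triality_of_coords[OF assms, of u] of_coords_inj by metis

end


section \<open>The group \<open>U\<close> in coordinates\<close>

type_synonym 'f ucoords = "'f \<times> 'f \<times> 'f \<times> 'f \<times> 'f \<times> 'f"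

lemma ucoords_cases:
  obtains s a b c d e where "u = (s, a, b, c, d, e)"
  by (cases u) auto

context triality_field
begin

definition ucarrier :: "'f ucoords set" where
  "ucarrier = F \<times> UNIV \<times> UNIV \<times> UNIV \<times> F \<times> F"

text \<open>  The restriction of \<^const>\<open>ud4_mult\<close> to tuples \<open>(s, a, fr a, fr (fr a), b, fr b, fr (fr b), c, \<dots>, d, e)\<close>; sums over
  the three conjugates become traces.\<close>

definition umult :: "'f ucoords \<Rightarrow> 'f ucoords \<Rightarrow> 'f ucoords" where
  "umult = (\<lambda>(s, a, b, c, d, e) (S, A, B, C, D, E).
    (s + S,
     a + A,
     b + B - a * S,
     c + C - (b * fr A + fr b * A) + a * fr a * S + S * (a * fr A + fr a * A),
     d + D - tr (fr c * A) + tr (b * fr A * fr (fr A)) - S * nm a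
       - S * tr (a * fr a * fr (fr A)) - S * tr (a * fr A * fr (fr A)),
     e + E - tr (fr c * B) - d * S + tr (b * fr b * fr (fr A)) + tr (b * (fr A * fr (fr B) + fr (fr A) * fr B))
       - S * tr (a * fr a * fr (fr b)) - S * tr (a * fr a * fr (fr B))
       - S * tr (a * (fr b * fr (fr A) + fr (fr b) * fr A)) - S * tr (a * (fr A * fr (fr B) + fr (fr A) * fr B))
       + 2 * S * S * nm a + S * S * tr (a * fr a * fr (fr A))))"

definition uinv :: "'f ucoords \<Rightarrow> 'f ucoords" where
  "uinv = (\<lambda>(s, a, b, c, d, e).
    (- s,
     - a,
     - b - s * a,
     - c - (a * fr b + fr a * b) - s * a * fr a,
     - d - tr (a * fr c) - tr (a * fr a * fr (fr b)) - s * nm a,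
     - e - s * d - tr (b * fr c) - s * tr (a * fr c) - tr (a * fr b * fr (fr b))
       - 2 * s * tr (a * fr a * fr (fr b)) - 2 * s * s * nm a))"

definition unfold_coords :: "'f ucoords \<Rightarrow> 'f coords" where
  "unfold_coords = (\<lambda>(s, a, b, c, d, e).
     (s, a, fr a, fr (fr a), b, fr b, fr (fr b), c, fr c, fr (fr c), d, e))"

lemma unfold_coords_inj: "unfold_coords u = unfold_coords v \<Longrightarrow> u = v"
  by (cases u rule: ucoords_cases; cases v rule: ucoords_cases) (simp add: unfold_coords_def)

lemma unfold_coords_umult:
  assumes "u \<in> ucarrier" "v \<in> ucarrier"
  shows "unfold_coords (umult u v) = ud4_mult (unfold_coords u) (unfold_coords v)"
  using assms
  by (cases u rule: ucoords_cases; cases v rule: ucoords_cases;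
      simp only: ucarrier_def mem_Sigma_iff F_iff unfold_coords_def umult_def ud4_mult_def prod.case prod.inject;
      intro conjI; simp add: tr_def nm_def algebra_simps)

lemma unfold_coords_uinv:
  assumes "u \<in> ucarrier"
  shows "unfold_coords (uinv u) = ud4_inv (unfold_coords u)"
  using assms
  by (cases u rule: ucoords_cases;
      simp only: ucarrier_def mem_Sigma_iff F_iff unfold_coords_def uinv_def ud4_inv_def prod.case prod.inject;
      intro conjI; simp add: tr_def nm_def algebra_simps)

lemma umult_closed: "\<lbrakk>u \<in> ucarrier; v \<in> ucarrier\<rbrakk> \<Longrightarrow> umult u v \<in> ucarrier"
  by (cases u rule: ucoords_cases; cases v rule: ucoords_cases) (simp add: ucarrier_def umult_def)

lemma uinv_closed: "u \<in> ucarrier \<Longrightarrow> uinv u \<in> ucarrier"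
  by (cases u rule: ucoords_cases) (simp add: ucarrier_def uinv_def)

definition U :: "'f ucoords monoid" where
  "U = \<lparr>carrier = ucarrier, monoid.mult = umult, monoid.one = (0, 0, 0, 0, 0, 0)\<rparr>"

lemma U_simps: "carrier U = ucarrier" "u \<otimes>\<^bsub>U\<^esub> v = umult u v" "\<one>\<^bsub>U\<^esub> = (0, 0, 0, 0, 0, 0)"
  by (simp_all add: U_def)

lemma uinv_umult: "u \<in> ucarrier \<Longrightarrow> umult (uinv u) u = (0, 0, 0, 0, 0, 0)"
  by (rule unfold_coords_inj)
    (simp add: unfold_coords_umult uinv_closed unfold_coords_uinv ud4_inv_left, simp add: unfold_coords_def)

lemma group_U: "group U"
proof (rule groupI)
  fix u v w assume uvw: "u \<in> carrier U" "v \<in> carrier U" "w \<in> carrier U"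
  show "u \<otimes>\<^bsub>U\<^esub> v \<otimes>\<^bsub>U\<^esub> w = u \<otimes>\<^bsub>U\<^esub> (v \<otimes>\<^bsub>U\<^esub> w)"
    using uvw by (intro unfold_coords_inj) (simp add: U_simps unfold_coords_umult umult_closed ud4_mult_assoc)
next
  fix u assume u: "u \<in> carrier U"
  show "\<one>\<^bsub>U\<^esub> \<otimes>\<^bsub>U\<^esub> u = u" by (cases u rule: ucoords_cases) (simp add: U_simps umult_def nm_def)
  show "\<exists>v\<in>carrier U. v \<otimes>\<^bsub>U\<^esub> u = \<one>\<^bsub>U\<^esub>"
    using u by (intro bexI[of _ "uinv u"]) (simp_all add: U_simps uinv_umult uinv_closed)
qed (simp_all add: U_simps umult_closed, simp add: ucarrier_def)

lemma card_U: "card (carrier U) = q ^ 12"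
  by (simp add: U_simps ucarrier_def card_cartesian_product card_F card_K) (simp add: eval_nat_numeral)

lemma inv_U: "u \<in> carrier U \<Longrightarrow> inv\<^bsub>U\<^esub> u = uinv u"
  using group.inv_equality[OF group_U, of "uinv u" u] by (simp add: U_simps uinv_umult uinv_closed)

text \<open>  Being fixed by the triality automorphism means that the coordinates at \<open>3, 4\<close>, at \<open>6, 7\<close> and at \<open>9, 10\<close>
  are the Frobenius conjugates of those at \<open>2\<close>, \<open>5\<close> and \<open>8\<close>.\<close>

lemma triality_fixed_coords:
  "ud4_triality q w = w \<longleftrightarrow> w \<in> unfold_coords ` ucarrier"
proof
  assume fixed: "ud4_triality q w = w"
  obtain a1 a2 a3 a4 a5 a6 a7 a8 a9 a10 a11 a12
    where w: "w = (a1, a2, a3, a4, a5, a6, a7, a8, a9, a10, a11, a12)" by (rule coords_cases)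
  have "w = unfold_coords (a1, a2, a5, a8, a11, a12)" "(a1, a2, a5, a8, a11, a12) \<in> ucarrier"
    using fixed by (auto simp: w ud4_triality_def unfold_coords_def ucarrier_def F_iff fr_def)
  then show "w \<in> unfold_coords ` ucarrier" by blast
next
  assume "w \<in> unfold_coords ` ucarrier"
  then obtain s a b c d e where w: "w = unfold_coords (s, a, b, c, d, e)" "s \<in> F" "d \<in> F" "e \<in> F"
    by (auto simp: ucarrier_def)
  then show "ud4_triality q w = w"
    using fr_fr_fr[of a] fr_fr_fr[of b] fr_fr_fr[of c]
    by (simp add: unfold_coords_def ud4_triality_def F_iff fr_def)
qed

end

locale triality_group = triality_field p k q ty + UD4 G x
  for p k q :: nat and ty :: "'f::{field,finite} itself"
    and G :: "('g, 'b) monoid_scheme" and x :: "nat \<Rightarrow> 'f \<Rightarrow> 'g" +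
  fixes \<sigma> :: "'g \<Rightarrow> 'g"
  assumes triality: "is_triality G x q \<sigma>"
begin

definition emb :: "'f ucoords \<Rightarrow> 'g" where "emb u = of_coords (unfold_coords u)"

lemma emb_bij: "bij_betw emb ucarrier (carrier (U3D4 G \<sigma>))"
proof (rule bij_betw_imageI)
  show "inj_on emb ucarrier"
    by (rule inj_onI) (auto simp: emb_def dest!: of_coords_inj unfold_coords_inj)
  show "emb ` ucarrier = carrier (U3D4 G \<sigma>)"
  proof (intro equalityI subsetI)
    fix g assume "g \<in> emb ` ucarrier"
    then obtain u where u: "u \<in> ucarrier" "g = of_coords (unfold_coords u)" by (auto simp: emb_def)
    then show "g \<in> carrier (U3D4 G \<sigma>)"
      using triality_fixed_iff[OF triality, of "unfold_coords u"] triality_fixed_coords[of "unfold_coords u"]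
      by (auto simp: U3D4_def of_coords_closed)
  next
    fix g assume "g \<in> carrier (U3D4 G \<sigma>)"
    then have g: "g \<in> carrier G" "\<sigma> g = g" by (auto simp: U3D4_def)
    obtain w where w: "g = of_coords w" using of_coords_surj[OF g(1)] .
    then show "g \<in> emb ` ucarrier"
      using g triality_fixed_iff[OF triality, of w] triality_fixed_coords[of w] by (auto simp: emb_def)
  qed
qed

lemma emb_mult: "\<lbrakk>u \<in> ucarrier; v \<in> ucarrier\<rbrakk> \<Longrightarrow> emb (umult u v) = emb u \<otimes>\<^bsub>G\<^esub> emb v"
  by (simp add: emb_def of_coords_mult unfold_coords_umult)

lemma emb_iso: "emb \<in> iso U (U3D4 G \<sigma>)"
  using emb_bij by (auto simp: iso_def hom_def U_simps emb_mult bij_betw_def U3D4_def)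

lemma emb_Y:
  "Y3 G x q = emb ` ({0} \<times> {0} \<times> UNIV \<times> {0} \<times> {0} \<times> {0})"
  "Y4 G x q = emb ` ({0} \<times> {0} \<times> {0} \<times> UNIV \<times> {0} \<times> {0})"
  "Y5 x q = emb ` ({0} \<times> {0} \<times> {0} \<times> {0} \<times> F \<times> {0})"
  "Y6 x q = emb ` ({0} \<times> {0} \<times> {0} \<times> {0} \<times> {0} \<times> F)"
proof -
  have x0: "x i 0 = \<one>\<^bsub>G\<^esub>" if "i \<in> {1, 2, 3, 4, 5, 6, 7, 8, 9, 10, 11, 12}" for i
    by (rule root_zero) (use that in auto)
  note emb = emb_def unfold_coords_def of_coords_def x0 root_closed
  have fr2: "t ^ q\<^sup>2 = fr (fr t)" "t ^ q = fr t" for t :: 'f by (simp_all add: fr_def power2_eq_square power_mult)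
  have roots:
    "emb (0, 0, t, 0, 0, 0) = x 5 t \<otimes>\<^bsub>G\<^esub> x 6 (t ^ q) \<otimes>\<^bsub>G\<^esub> x 7 (t ^ q\<^sup>2)"
    "emb (0, 0, 0, t, 0, 0) = x 8 t \<otimes>\<^bsub>G\<^esub> x 9 (t ^ q) \<otimes>\<^bsub>G\<^esub> x 10 (t ^ q\<^sup>2)"
    "emb (0, 0, 0, 0, t, 0) = x 11 t" "emb (0, 0, 0, 0, 0, t) = x 12 t" for t
    by (simp_all add: emb fr2 del: One_nat_def)
  show "Y3 G x q = emb ` ({0} \<times> {0} \<times> UNIV \<times> {0} \<times> {0} \<times> {0})"
    by (auto simp: Y3_def image_def roots)
  show "Y4 G x q = emb ` ({0} \<times> {0} \<times> {0} \<times> UNIV \<times> {0} \<times> {0})"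
    by (auto simp: Y4_def image_def roots)
  show "Y5 x q = emb ` ({0} \<times> {0} \<times> {0} \<times> {0} \<times> F \<times> {0})"
    by (auto simp: Y5_def image_def roots)
  show "Y6 x q = emb ` ({0} \<times> {0} \<times> {0} \<times> {0} \<times> {0} \<times> F)"
    by (auto simp: Y6_def image_def roots)
qed

end


context triality_field
begin

section \<open>A nondegenerate pairing, and conjugation in \<open>U\<close>\<close>

definition theta :: "'f \<Rightarrow> complex" where
  "theta = (SOME \<theta>. (\<forall>x y. \<theta> (x + y) = \<theta> x * \<theta> y) \<and> (\<forall>x. cmod (\<theta> x) = 1) \<and> \<theta> 1 \<noteq> 1)"

lemma theta_add: "theta (x + y) = theta x * theta y"
  and theta_norm: "cmod (theta x) = 1"
  and theta_1: "theta 1 \<noteq> 1"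
  using someI_ex[OF ex_additive_char] by (auto simp: theta_def[symmetric])

lemma theta_nz: "theta x \<noteq> 0" using theta_norm[of x] by auto
lemma theta_0 [simp]: "theta 0 = 1" using theta_add[of 0 0] theta_nz[of 0] by simp

lemma theta_eq_iff: "theta x = theta y \<longleftrightarrow> theta (x - y) = 1"
  using theta_add[of "x - y" y] theta_nz[of y] by simp

lemma theta_nondegenerate_F:
  assumes "u \<in> F" "\<And>x. x \<in> F \<Longrightarrow> theta (u * x) = 1" shows "u = 0"
proof (rule ccontr)
  assume "u \<noteq> 0"
  then have "u * (1 / u) = 1" by simp
  then show False using assms(2)[of "1 / u"] assms(1) theta_1 by (metis F_1 F_divide)
qed

lemma theta_nondegenerate_K:
  assumes "\<And>x. theta (tr (y * x)) = 1" shows "y = 0"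
proof (rule ccontr)
  assume y: "y \<noteq> 0"
  obtain x where "tr x = 1" using ex_tr_eq[OF F_1] by auto
  moreover have "y * (x / y) = x" using y by simp
  ultimately show False using assms[of "x / y"] theta_1 by metis
qed

lemma theta_nondegenerate_F_eq:
  assumes "u \<in> F" "v \<in> F" "\<And>x. x \<in> F \<Longrightarrow> theta (u * x) = theta (v * x)" shows "u = v"
  using theta_nondegenerate_F[of "u - v"] assms by (simp add: theta_eq_iff left_diff_distrib)

lemma theta_nondegenerate_K_eq:
  assumes "\<And>x. theta (tr (y * x)) = theta (tr (z * x))" shows "y = z"
  using theta_nondegenerate_K[of "y - z"] assms by (simp add: theta_eq_iff left_diff_distrib tr_diff)

lemma tr_fr_shift: "tr (fr x * a) = tr (fr (fr a) * x)"
proof -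
  have "tr (fr x * a) = tr (fr (fr (fr x * a)))" by (simp only: tr_fr)
  then show ?thesis by (simp add: mult.commute)
qed

text \<open>  Conjugation \<open>h' = t\<^sup>-\<^sup>1 h t\<close>, written without the inverse.\<close>

definition conj_to :: "'f ucoords \<Rightarrow> 'f ucoords \<Rightarrow> 'f ucoords \<Rightarrow> bool" where
  "conj_to t h h' \<longleftrightarrow> h' \<in> ucarrier \<and> umult h t = umult t h'"

lemma conj_to_exists:
  assumes "t \<in> ucarrier" "h \<in> ucarrier"
  obtains h' where "conj_to t h h'"
proof -
  interpret group U by (rule group_U)
  have th: "t \<in> carrier U" "h \<in> carrier U" using assms by (simp_all add: U_simps)
  then have "h \<otimes>\<^bsub>U\<^esub> t = t \<otimes>\<^bsub>U\<^esub> (inv\<^bsub>U\<^esub> t \<otimes>\<^bsub>U\<^esub> (h \<otimes>\<^bsub>U\<^esub> t))"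
    by (simp flip: m_assoc)
  moreover have "inv\<^bsub>U\<^esub> t \<otimes>\<^bsub>U\<^esub> (h \<otimes>\<^bsub>U\<^esub> t) \<in> carrier U" using th by simp
  ultimately show ?thesis using that unfolding conj_to_def U_simps by blast
qed

text \<open>  Conjugation leaves the first two coordinates alone and changes each further one by commutator terms.
  Only the terms that matter for the linear characters below are computed: a coordinate is given
  when enough of the earlier coordinates of \<open>h\<close>, or of the corresponding ones of \<open>t\<close>, vanish.\<close>

lemma conj_toE:
  assumes "conj_to (s, a, b, c, d, e) (S, A, B, C, D, E) h'"
  obtains C' D' E' where "h' = (S, A, B - A * s + a * S, C', D', E')" "S \<in> F" "D' \<in> F" "E' \<in> F"
    "A = 0 \<Longrightarrow> C' = C - (B * fr a + fr B * a) - a * fr a * S"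
    "\<lbrakk>S = 0; A = 0\<rbrakk> \<Longrightarrow> D' = D - tr (fr C * a) + tr (B * fr a * fr (fr a))"
    "\<lbrakk>S = 0; A = 0; B = 0\<rbrakk> \<Longrightarrow> E' = E - tr (fr C * b) - D * s"
    "\<lbrakk>A = 0; a = 0\<rbrakk> \<Longrightarrow> D' = D - tr (fr C * a)"
    "\<lbrakk>S = 0; s = 0; B = 0; b = 0; C = 0; D = 0\<rbrakk> \<Longrightarrow> E' = E"
proof -
  obtain S' A' B' C' D' E' where h': "h' = (S', A', B', C', D', E')" by (rule ucoords_cases)
  have mem: "S' \<in> F" "D' \<in> F" "E' \<in> F" using assms by (simp_all add: conj_to_def h' ucarrier_def)
  have "umult (S, A, B, C, D, E) (s, a, b, c, d, e) = umult (s, a, b, c, d, e) (S', A', B', C', D', E')"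
    using assms by (simp add: conj_to_def h')
  note eq = this[unfolded umult_def prod.case prod.inject]
  have S: "S' = S" using eq by simp
  have A: "A' = A" using eq by simp
  have B: "B' = B - A * s + a * S" using eq unfolding S A by (simp add: algebra_simps)
  have C: "c + C' - (b * fr A + fr b * A) + a * fr a * S + S * (a * fr A + fr a * A) =
     C + c - (B * fr a + fr B * a) + A * fr A * s + s * (A * fr a + fr A * a)"
    using eq unfolding S A by simp
  show ?thesis
  proof (rule that)
    show "h' = (S, A, B - A * s + a * S, C', D', E')" by (simp add: h' S A B)
    show "S \<in> F" "D' \<in> F" "E' \<in> F" using mem S by simp_all
    show "C' = C - (B * fr a + fr B * a) - a * fr a * S" if "A = 0"
      using C that by (simp add: algebra_simps)
    show "D' = D - tr (fr C * a) + tr (B * fr a * fr (fr a))" if "S = 0" "A = 0"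
      using eq that unfolding S A B by (auto simp: nm_def algebra_simps)
    show "E' = E - tr (fr C * b) - D * s" if "S = 0" "A = 0" "B = 0"
      using eq that unfolding S A B by (auto simp: nm_def algebra_simps)
    show "D' = D - tr (fr C * a)" if "A = 0" "a = 0"
      using eq that unfolding S A by (simp add: nm_def)
    show "E' = E" if "S = 0" "s = 0" "B = 0" "b = 0" "C = 0" "D = 0"
      using eq that unfolding S A B by simp
  qed
qed

text \<open>  Mackey's condition in terms of a single test element: some \<open>h\<close> whose conjugate by \<open>t\<close> stays in \<open>H\<close> and has a
  computed value \<open>z\<close> different from that of \<open>h\<close>.\<close>

lemma mackey_irreducibleI:
  assumes "H \<subseteq> ucarrier" "(0, 0, 0, 0, 0, 0) \<in> H"
    and "\<And>u v. \<lbrakk>u \<in> H; v \<in> H\<rbrakk> \<Longrightarrow> umult u v \<in> H" "\<And>u. u \<in> H \<Longrightarrow> uinv u \<in> H"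
    and "\<And>u v. \<lbrakk>u \<in> H; v \<in> H\<rbrakk> \<Longrightarrow> lam (umult u v) = lam u * lam v" "\<And>u. u \<in> H \<Longrightarrow> cmod (lam u) = 1"
    and mackey: "\<And>s a b c d e. \<lbrakk>(s, a, b, c, d, e) \<in> ucarrier; (s, a, b, c, d, e) \<notin> H\<rbrakk> \<Longrightarrow>
      \<exists>h\<in>H. \<exists>z. z \<noteq> lam h \<and> (\<forall>h'. conj_to (s, a, b, c, d, e) h h' \<longrightarrow> h' \<in> H \<and> lam h' = z)"
  shows "mackey_irreducible U H lam"
proof -
  interpret group U by (rule group_U)
  have H: "a \<in> carrier U" if "a \<in> H" for a using that assms(1) by (auto simp: U_simps)
  show ?thesis
  proof (intro mackey_irreducible.intro subgroup_linear_char.intro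
      subgroup_linear_char_axioms.intro mackey_irreducible_axioms.intro)
    show "Group.group U" by (rule group_U)
    show "finite (carrier U)" by (simp add: finite_subset[OF subset_UNIV])
    show "subgroup H U"
      by (rule subgroupI) (use assms(1-4) H in \<open>auto simp: U_simps inv_U\<close>)
    fix t assume t: "t \<in> carrier U" "t \<notin> H"
    obtain s a b c d e where tt: "t = (s, a, b, c, d, e)" by (rule ucoords_cases)
    obtain h z where h: "h \<in> H" "z \<noteq> lam h" "\<And>h'. conj_to t h h' \<Longrightarrow> h' \<in> H \<and> lam h' = z"
      using mackey t unfolding tt U_simps by blast
    obtain h' where h': "conj_to t h h'"
      using conj_to_exists[of t h] t h(1) assms(1) unfolding U_simps by blast
    then show "\<exists>h\<in>H. \<exists>h'\<in>H. h \<otimes>\<^bsub>U\<^esub> t = t \<otimes>\<^bsub>U\<^esub> h' \<and> lam h' \<noteq> lam h"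
      using h(1,2) h(3)[OF h'] unfolding conj_to_def U_simps by blast
  qed (use assms in \<open>auto simp: U_simps\<close>)
qed

text \<open>  The same test elements separate induced characters: if they agree, then for some \<open>t\<close> every computed
  value \<open>z\<close> at a conjugate of \<open>h\<close> must be the value of the other character at \<open>h\<close>.\<close>

lemma equal_characters_conjugate:
  assumes lam: "mackey_irreducible U H lam" and mu: "mackey_irreducible U K mu"
    and eq: "induced_character U H lam = induced_character U K mu"
  obtains s a b c d e where "(s, a, b, c, d, e) \<in> ucarrier"
    "\<And>h z. \<lbrakk>h \<in> K; \<And>h'. conj_to (s, a, b, c, d, e) h h' \<Longrightarrow> h' \<in> H \<and> lam h' = z\<rbrakk> \<Longrightarrow> z = mu h"
proof -
  interpret A: mackey_irreducible U H lam by (rule lam)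
  interpret B: mackey_irreducible U K mu by (rule mu)
  obtain t where t: "t \<in> carrier U"
    "\<And>h h'. \<lbrakk>h \<in> K; h' \<in> H; h \<otimes>\<^bsub>U\<^esub> t = t \<otimes>\<^bsub>U\<^esub> h'\<rbrakk> \<Longrightarrow> lam h' = mu h"
    using induced_character_eqD[OF lam B.subgroup_linear_char_axioms eq] by metis
  obtain s a b c d e where tt: "t = (s, a, b, c, d, e)" by (rule ucoords_cases)
  show ?thesis
  proof (rule that)
    show tc: "(s, a, b, c, d, e) \<in> ucarrier" using t by (simp add: U_simps tt)
    fix h z assume h: "h \<in> K" "\<And>h'. conj_to (s, a, b, c, d, e) h h' \<Longrightarrow> h' \<in> H \<and> lam h' = z"
    have "h \<in> ucarrier" using B.H_carrier[OF h(1)] by (simp add: U_simps)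
    then obtain h' where h': "conj_to (s, a, b, c, d, e) h h'" using conj_to_exists[OF tc] by blast
    then show "z = mu h" using h(2)[OF h'] t(2)[OF h(1), of h'] unfolding tt U_simps conj_to_def by blast
  qed
qed

lemma indchar_value:
  assumes "subgroup_linear_char U H lam" "g \<in> ucarrier"
    and "\<And>s a b c d e h'. conj_to (s, a, b, c, d, e) g h' \<Longrightarrow> h' \<in> H \<and> lam h' = z"
  shows "induced_character U H lam g = z * induced_character U H lam \<one>\<^bsub>U\<^esub>"
proof -
  interpret subgroup_linear_char U H lam by fact
  have "indchar g = z * of_nat (card (carrier U)) / of_nat (card H)"
  proof (rule indchar_constant)
    show "g \<in> carrier U" using assms by (simp add: U_simps)
    fix t assume "t \<in> carrier U"
    then have t: "t \<in> ucarrier" by (simp add: U_simps)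
    obtain h' where h': "conj_to t g h'" using conj_to_exists[OF t assms(2)] .
    obtain s a b c d e where tt: "t = (s, a, b, c, d, e)" by (rule ucoords_cases)
    show "\<exists>h\<in>H. g \<otimes>\<^bsub>U\<^esub> t = t \<otimes>\<^bsub>U\<^esub> h \<and> lam h = z"
      using h' assms(3)[OF h'[unfolded tt]] by (intro bexI[of _ h']) (simp_all add: U_simps conj_to_def)
  qed
  then show ?thesis by (simp add: indchar_one)
qed

lemma mackey_witness:
  "\<lbrakk>h \<in> H; z \<noteq> lam h; \<And>h'. conj_to t h h' \<Longrightarrow> h' \<in> H \<and> lam h' = z\<rbrakk> \<Longrightarrow>
    \<exists>h\<in>H. \<exists>z. z \<noteq> lam h \<and> (\<forall>h'. conj_to t h h' \<longrightarrow> h' \<in> H \<and> lam h' = z)"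
  by blast

section \<open>Linear characters that induce irreducibly\<close>

text \<open>  The parameters are the weights of the coordinates.  The formula gives a linear character of every subgroup
  on which the commutator terms contributed by the weighted coordinates vanish under \<open>theta\<close>.\<close>

definition lchar :: "'f ucoords \<Rightarrow> 'f ucoords \<Rightarrow> complex" where
  "lchar = (\<lambda>(r, v, w, z, u, y) (s, a, b, c, d, e).
     theta (r * s + tr (v * a) + tr (w * b) + tr (z * c) + u * d + y * e))"

lemma lchar_norm: "cmod (lchar m x) = 1"
  by (cases m rule: ucoords_cases; cases x rule: ucoords_cases) (simp add: lchar_def theta_norm)

text \<open>  \<open>H3\<close> is complementary to \<open>Y\<^sub>1\<close>, \<open>H5\<close> is complementary to \<open>Y\<^sub>2\<close>, and \<open>H6 = Y\<^sub>2 Y\<^sub>4 Y\<^sub>5 Y\<^sub>6\<close> contains a Lagrangian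
  subspace \<open>Y\<^sub>4 Y\<^sub>5\<close> of the Heisenberg group formed by the elements with \<open>a = 0\<close>, whose centre is \<open>Y\<^sub>6\<close>.\<close>

definition H3 :: "'f ucoords set" where "H3 = {0} \<times> UNIV \<times> UNIV \<times> UNIV \<times> F \<times> F"
definition H5 :: "'f ucoords set" where "H5 = F \<times> {0} \<times> UNIV \<times> UNIV \<times> F \<times> F"
definition H6 :: "'f ucoords set" where "H6 = {0} \<times> UNIV \<times> {0} \<times> UNIV \<times> F \<times> F"

lemma mackey_lin:
  assumes "r \<in> F"
  shows "mackey_irreducible U ucarrier (lchar (r, v, 0, 0, 0, 0))"
proof (rule mackey_irreducibleI)
  fix x y assume "x \<in> ucarrier" "y \<in> ucarrier"
  then show "lchar (r, v, 0, 0, 0, 0) (umult x y) = lchar (r, v, 0, 0, 0, 0) x * lchar (r, v, 0, 0, 0, 0) y"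
    by (cases x rule: ucoords_cases; cases y rule: ucoords_cases)
      (simp add: ucarrier_def lchar_def umult_def tr_add distrib_left add_ac nm_def flip: theta_add)
next
qed (auto simp: umult_closed uinv_closed lchar_norm, simp add: ucarrier_def)

lemma equal_characters_lin:
  assumes r: "r \<in> F" "r2 \<in> F"
    and eq: "induced_character U ucarrier (lchar (r, v, 0, 0, 0, 0)) = induced_character U ucarrier (lchar (r2, v2, 0, 0, 0, 0))"
  shows "r = r2" "v = v2"
proof -
  obtain s a b c d e where t: "(s, a, b, c, d, e) \<in> ucarrier"
    "\<And>h z. \<lbrakk>h \<in> ucarrier; \<And>h'. conj_to (s, a, b, c, d, e) h h' \<Longrightarrow> h' \<in> ucarrier \<and> lchar (r, v, 0, 0, 0, 0) h' = z\<rbrakk> \<Longrightarrow>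
      z = lchar (r2, v2, 0, 0, 0, 0) h"
    by (rule equal_characters_conjugate[OF mackey_lin[OF r(1)] mackey_lin[OF r(2)] eq]) blast
  have test: "theta (r * S + tr (v * A)) = lchar (r2, v2, 0, 0, 0, 0) (S, A, 0, 0, 0, 0)" if "S \<in> F" for S A
  proof (rule t(2))
    show "(S, A, 0, 0, 0, 0) \<in> ucarrier" using that by (simp add: ucarrier_def)
    show "h' \<in> ucarrier \<and> lchar (r, v, 0, 0, 0, 0) h' = theta (r * S + tr (v * A))"
      if "conj_to (s, a, b, c, d, e) (S, A, 0, 0, 0, 0) h'" for h'
      using that by (rule conj_toE) (simp add: ucarrier_def lchar_def)
  qed
  show "r = r2"
    by (rule theta_nondegenerate_F_eq) (use r test[of _ 0] in \<open>simp_all add: lchar_def\<close>)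
  show "v = v2"
    by (rule theta_nondegenerate_K_eq) (use test[of 0] in \<open>simp add: lchar_def\<close>)
qed

lemma conj_F3:
  assumes "conj_to (s, a, b, c, d, e) (0, A, B, 0, 0, 0) h'"
  shows "h' \<in> H3 \<and> lchar (0, w, v, 0, 0, 0) h' = theta (tr (w * A) + tr (v * (B - A * s)))"
  using assms by (rule conj_toE) (simp add: H3_def lchar_def)

lemma mackey_F3:
  assumes "v \<noteq> 0"
  shows "mackey_irreducible U H3 (lchar (0, w, v, 0, 0, 0))"
proof (rule mackey_irreducibleI)
  fix x y assume "x \<in> H3" "y \<in> H3"
  then show "lchar (0, w, v, 0, 0, 0) (umult x y) = lchar (0, w, v, 0, 0, 0) x * lchar (0, w, v, 0, 0, 0) y"
    by (cases x rule: ucoords_cases; cases y rule: ucoords_cases)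
      (simp add: H3_def lchar_def umult_def tr_add distrib_left add_ac nm_def flip: theta_add)
next
  fix s a b c d e assume t: "(s, a, b, c, d, e) \<in> ucarrier" "(s, a, b, c, d, e) \<notin> H3"
  have s: "s \<noteq> 0" using t by (auto simp: H3_def ucarrier_def)
  then have "- (v * s) \<noteq> 0" using assms by simp
  then obtain x where x: "theta (tr (- (v * s) * x)) \<noteq> 1" using theta_nondegenerate_K by blast
  show "\<exists>h\<in>H3. \<exists>z. z \<noteq> lchar (0, w, v, 0, 0, 0) h \<and>
      (\<forall>h'. conj_to (s, a, b, c, d, e) h h' \<longrightarrow> h' \<in> H3 \<and> lchar (0, w, v, 0, 0, 0) h' = z)"
    by (rule mackey_witness[OF _ _ conj_F3[where A = x and B = 0]])
      (use x in \<open>simp_all add: H3_def lchar_def theta_eq_iff mult_ac\<close>)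
qed (auto simp: H3_def ucarrier_def umult_def uinv_def lchar_norm)

text \<open>  Conjugation by \<open>Y\<^sub>1\<close> shifts the weight \<open>w\<close> of \<open>a\<close> by elements of \<open>v F\<close>, so only its class modulo \<open>v F\<close>
  survives induction.\<close>

lemma equal_characters_F3:
  assumes v: "v \<noteq> 0" "v2 \<noteq> 0"
    and eq: "induced_character U H3 (lchar (0, w, v, 0, 0, 0)) = induced_character U H3 (lchar (0, w2, v2, 0, 0, 0))"
  shows "v = v2" "\<exists>s\<in>F. w - v * s = w2"
proof -
  obtain s a b c d e where t: "(s, a, b, c, d, e) \<in> ucarrier"
    "\<And>h z. \<lbrakk>h \<in> H3; \<And>h'. conj_to (s, a, b, c, d, e) h h' \<Longrightarrow> h' \<in> H3 \<and> lchar (0, w, v, 0, 0, 0) h' = z\<rbrakk> \<Longrightarrow>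
      z = lchar (0, w2, v2, 0, 0, 0) h"
    by (rule equal_characters_conjugate[OF mackey_F3[OF v(1)] mackey_F3[OF v(2)] eq]) blast
  have test: "theta (tr (w * A) + tr (v * (B - A * s))) = lchar (0, w2, v2, 0, 0, 0) (0, A, B, 0, 0, 0)" for A B
    by (rule t(2)[OF _ conj_F3]) (simp_all add: H3_def)
  show "v = v2"
    by (rule theta_nondegenerate_K_eq) (use test[of 0] in \<open>simp add: lchar_def\<close>)
  have "w - v * s = w2"
  proof (rule theta_nondegenerate_K_eq)
    show "theta (tr ((w - v * s) * x)) = theta (tr (w2 * x))" for x
      using test[of x 0] by (simp add: lchar_def algebra_simps tr_diff tr_add tr_minus)
  qed
  then show "\<exists>s\<in>F. w - v * s = w2" using t(1) by (auto simp: ucarrier_def)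
qed

lemma conj_F5:
  assumes "conj_to (s, a, b, c, d, e) (0, 0, 0, C, D, 0) h'"
  shows "h' \<in> H5 \<and> lchar (r, 0, w, 0, u, 0) h' = theta (u * (D - tr (fr C * a)))"
  using assms by (rule conj_toE) (simp add: H5_def lchar_def)

lemma theta_tr_fr:
  assumes "u \<in> F"
  shows "theta (u * (- tr (fr x * a))) = theta (tr (- (u * fr (fr a)) * x))"
  using assms by (simp add: tr_fr_shift tr_minus tr_scale mult.assoc)

text \<open>  The commutator of \<open>Y\<^sub>2\<close> and \<open>Y\<^sub>4\<close> in \<open>Y\<^sub>5\<close> is \<open>tr (c\<^sup>q a)\<close>: an element with \<open>a \<noteq> 0\<close> moves the weight of \<open>c\<close>.\<close>

lemma mackey_F5:
  assumes u: "u \<in> F" "u \<noteq> 0"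
  shows "mackey_irreducible U H5 (lchar (r, 0, w, 0, u, 0))"
proof (rule mackey_irreducibleI)
  fix x y assume "x \<in> H5" "y \<in> H5"
  then show "lchar (r, 0, w, 0, u, 0) (umult x y) = lchar (r, 0, w, 0, u, 0) x * lchar (r, 0, w, 0, u, 0) y"
    by (cases x rule: ucoords_cases; cases y rule: ucoords_cases)
      (simp add: H5_def lchar_def umult_def tr_add distrib_left add_ac nm_def flip: theta_add)
next
  fix s a b c d e assume t: "(s, a, b, c, d, e) \<in> ucarrier" "(s, a, b, c, d, e) \<notin> H5"
  have "a \<noteq> 0" using t by (auto simp: H5_def ucarrier_def)
  then have "- (u * fr (fr a)) \<noteq> 0" using u by simp
  then obtain x where "theta (u * (- tr (fr x * a))) \<noteq> 1"
    unfolding theta_tr_fr[OF u(1)] using theta_nondegenerate_K by blast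
  then show "\<exists>h\<in>H5. \<exists>z. z \<noteq> lchar (r, 0, w, 0, u, 0) h \<and>
      (\<forall>h'. conj_to (s, a, b, c, d, e) h h' \<longrightarrow> h' \<in> H5 \<and> lchar (r, 0, w, 0, u, 0) h' = z)"
    by (intro mackey_witness[OF _ _ conj_F5[where C = x and D = 0]])
      (simp_all add: H5_def lchar_def)
qed (auto simp: H5_def ucarrier_def umult_def uinv_def nm_def lchar_norm)

lemma equal_characters_F5:
  assumes u: "u \<in> F" "u \<noteq> 0" "u2 \<in> F" "u2 \<noteq> 0" and r: "r \<in> F" "r2 \<in> F"
    and eq: "induced_character U H5 (lchar (r, 0, w, 0, u, 0)) = induced_character U H5 (lchar (r2, 0, w2, 0, u2, 0))"
  shows "u = u2" "r = r2" "w = w2"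
proof -
  obtain s a b c d e where t: "(s, a, b, c, d, e) \<in> ucarrier"
    "\<And>h z. \<lbrakk>h \<in> H5; \<And>h'. conj_to (s, a, b, c, d, e) h h' \<Longrightarrow> h' \<in> H5 \<and> lchar (r, 0, w, 0, u, 0) h' = z\<rbrakk> \<Longrightarrow>
      z = lchar (r2, 0, w2, 0, u2, 0) h"
    by (rule equal_characters_conjugate[OF mackey_F5[OF u(1,2)] mackey_F5[OF u(3,4)] eq]) blast
  have test: "theta (u * (D - tr (fr C * a))) = lchar (r2, 0, w2, 0, u2, 0) (0, 0, 0, C, D, 0)" if "D \<in> F" for C D
    by (rule t(2)[OF _ conj_F5]) (use that in \<open>simp_all add: H5_def\<close>)
  show "u = u2"
    by (rule theta_nondegenerate_F_eq) (use u test[of _ 0] in \<open>simp_all add: lchar_def\<close>)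
  have "- (u * fr (fr a)) = 0"
  proof (rule theta_nondegenerate_K)
    show "theta (tr (- (u * fr (fr a)) * x)) = 1" for x
      unfolding theta_tr_fr[OF u(1), symmetric] using test[of 0 x] by (simp add: lchar_def)
  qed
  then have a: "a = 0" using u by simp
  have test2: "theta (r * S + tr (w * B)) = lchar (r2, 0, w2, 0, u2, 0) (S, 0, B, 0, 0, 0)" if "S \<in> F" for S B
  proof (rule t(2))
    show "(S, 0, B, 0, 0, 0) \<in> H5" using that by (simp add: H5_def)
    show "h' \<in> H5 \<and> lchar (r, 0, w, 0, u, 0) h' = theta (r * S + tr (w * B))"
      if "conj_to (s, a, b, c, d, e) (S, 0, B, 0, 0, 0) h'" for h'
      using that by (rule conj_toE) (simp add: H5_def lchar_def a)
  qed
  show "r = r2"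
    by (rule theta_nondegenerate_F_eq) (use r test2[of _ 0] in \<open>simp_all add: lchar_def\<close>)
  show "w = w2"
    by (rule theta_nondegenerate_K_eq) (use test2[of 0] in \<open>simp add: lchar_def\<close>)
qed

lemma conj_F6:
  assumes "conj_to (s, a, b, c, d, e) (0, 0, 0, C, D, E) h'"
  shows "h' \<in> H6 \<and> lchar (0, v, 0, 0, 0, u) h' = theta (u * (E - tr (fr C * b) - D * s))"
  using assms by (rule conj_toE) (simp add: H6_def lchar_def)

text \<open>  An element outside \<open>H6\<close> has \<open>s \<noteq> 0\<close> or \<open>b \<noteq> 0\<close>, and its commutator with \<open>Y\<^sub>5\<close> or with \<open>Y\<^sub>4\<close>, respectively,
  covers \<open>Y\<^sub>6\<close>.\<close>

lemma mackey_F6: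
  assumes u: "u \<in> F" "u \<noteq> 0"
  shows "mackey_irreducible U H6 (lchar (0, v, 0, 0, 0, u))"
proof (rule mackey_irreducibleI)
  fix x y assume "x \<in> H6" "y \<in> H6"
  then show "lchar (0, v, 0, 0, 0, u) (umult x y) = lchar (0, v, 0, 0, 0, u) x * lchar (0, v, 0, 0, 0, u) y"
    by (cases x rule: ucoords_cases; cases y rule: ucoords_cases)
      (simp add: H6_def lchar_def umult_def tr_add distrib_left add_ac nm_def flip: theta_add)
next
  fix s a b c d e assume t: "(s, a, b, c, d, e) \<in> ucarrier" "(s, a, b, c, d, e) \<notin> H6"
  have s: "s \<in> F" and sb: "s \<noteq> 0 \<or> b \<noteq> 0" using t by (auto simp: H6_def ucarrier_def)
  have "\<exists>x y. y \<in> F \<and> theta (u * (0 - tr (fr x * b) - y * s)) \<noteq> 1"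
  proof (cases "s = 0")
    case False
    then have "- (u * s) \<noteq> 0" "- (u * s) \<in> F" using u s by simp_all
    then obtain y where "y \<in> F" "theta (- (u * s) * y) \<noteq> 1" using theta_nondegenerate_F by blast
    then show ?thesis by (intro exI[of _ 0] exI[of _ y]) (simp add: mult_ac)
  next
    case True
    then have "- (u * fr (fr b)) \<noteq> 0" using u sb by simp
    then obtain x where "theta (u * (- tr (fr x * b))) \<noteq> 1"
      unfolding theta_tr_fr[OF u(1)] using theta_nondegenerate_K by blast
    then show ?thesis by (intro exI[of _ x] exI[of _ 0]) simp
  qed
  then obtain x y where "y \<in> F" "theta (u * (0 - tr (fr x * b) - y * s)) \<noteq> 1" by blast
  then show "\<exists>h\<in>H6. \<exists>z. z \<noteq> lchar (0, v, 0, 0, 0, u) h \<and>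
      (\<forall>h'. conj_to (s, a, b, c, d, e) h h' \<longrightarrow> h' \<in> H6 \<and> lchar (0, v, 0, 0, 0, u) h' = z)"
    by (intro mackey_witness[OF _ _ conj_F6[where C = x and D = y and E = 0]])
      (simp_all add: H6_def lchar_def)
qed (auto simp: H6_def ucarrier_def umult_def uinv_def nm_def lchar_norm)

lemma equal_characters_F6:
  assumes u: "u \<in> F" "u \<noteq> 0" "u2 \<in> F" "u2 \<noteq> 0"
    and eq: "induced_character U H6 (lchar (0, v, 0, 0, 0, u)) = induced_character U H6 (lchar (0, v2, 0, 0, 0, u2))"
  shows "u = u2" "v = v2"
proof -
  obtain s a b c d e where t: "(s, a, b, c, d, e) \<in> ucarrier"
    "\<And>h z. \<lbrakk>h \<in> H6; \<And>h'. conj_to (s, a, b, c, d, e) h h' \<Longrightarrow> h' \<in> H6 \<and> lchar (0, v, 0, 0, 0, u) h' = z\<rbrakk> \<Longrightarrow>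
      z = lchar (0, v2, 0, 0, 0, u2) h"
    by (rule equal_characters_conjugate[OF mackey_F6[OF u(1,2)] mackey_F6[OF u(3,4)] eq]) blast
  have s: "s \<in> F" using t(1) by (simp add: ucarrier_def)
  have "theta (u * (E - tr (fr C * b) - D * s)) = lchar (0, v2, 0, 0, 0, u2) (0, 0, 0, C, D, E)"
    if "D \<in> F" "E \<in> F" for C D E
    by (rule t(2)[OF _ conj_F6]) (use that in \<open>simp_all add: H6_def\<close>)
  then have test: "theta (u * (E - tr (fr C * b) - D * s)) = theta (u2 * E)" if "D \<in> F" "E \<in> F" for C D E
    using that by (simp add: lchar_def)
  show "u = u2"
    by (rule theta_nondegenerate_F_eq) (use u test[of 0 _ 0] in simp_all)
  have "- (u * s) = 0"
    by (rule theta_nondegenerate_F) (use u s test[of _ 0 0] in \<open>simp_all add: mult_ac\<close>)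
  then have s0: "s = 0" using u by simp
  have "- (u * fr (fr b)) = 0"
  proof (rule theta_nondegenerate_K)
    show "theta (tr (- (u * fr (fr b)) * x)) = 1" for x
      unfolding theta_tr_fr[OF u(1), symmetric] using test[of 0 0 x] by simp
  qed
  then have b0: "b = 0" using u by simp
  have "theta (tr (v * A)) = lchar (0, v2, 0, 0, 0, u2) (0, A, 0, 0, 0, 0)" for A
  proof (rule t(2))
    show "(0, A, 0, 0, 0, 0) \<in> H6" by (simp add: H6_def)
    show "h' \<in> H6 \<and> lchar (0, v, 0, 0, 0, u) h' = theta (tr (v * A))"
      if "conj_to (s, a, b, c, d, e) (0, A, 0, 0, 0, 0) h'" for h'
      using that by (rule conj_toE) (simp add: H6_def lchar_def s0 b0)
  qed
  then show "v = v2" by (intro theta_nondegenerate_K_eq) (simp add: lchar_def)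
qed

section \<open>Characters nontrivial on \<open>Y\<^sub>4\<close>\<close>

text \<open>  Conjugation by an element of \<open>Y\<^sub>2\<close> with parameter \<open>a\<close> changes the weight of \<open>b\<close> by \<open>- pairing v a\<close>, if
  the weight of \<open>c\<close> is \<open>v\<close>.\<close>

definition pairing :: "'f \<Rightarrow> 'f \<Rightarrow> 'f" where
  "pairing v a = v * fr a + fr (fr v) * fr (fr a)"

lemma tr_pairing: "tr (v * (x * fr a + fr x * a)) = tr (pairing v a * x)"
proof -
  have "tr (v * (x * fr a + fr x * a)) = tr (v * fr a * x) + tr (fr x * (v * a))"
    by (simp add: distrib_left tr_add mult_ac)
  also have "tr (fr x * (v * a)) = tr (fr (fr v) * fr (fr a) * x)"
    by (simp add: tr_fr_shift)
  finally show ?thesis by (simp add: pairing_def distrib_right tr_add)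
qed

text \<open>  The equation and its two Frobenius conjugates form a linear system in the conjugates of \<open>a\<close> of
  determinant \<open>2 nm v\<close>.\<close>

lemma pairing_eq_0_odd:
  assumes "odd q" "v \<noteq> 0" "pairing v a = 0"
  shows "a = 0"
proof -
  have 1: "v * fr a + fr (fr v) * fr (fr a) = 0" using assms(3) by (simp add: pairing_def)
  have 2: "fr v * fr (fr a) + v * a = 0" using arg_cong[OF 1, of fr] by simp
  have 3: "fr (fr v) * a + fr v * fr a = 0" using arg_cong[OF 2, of fr] by simp
  have "2 * (v * fr v * fr (fr v)) * a =
     fr v * fr (fr v) * (fr v * fr (fr a) + v * a) + v * fr v * (fr (fr v) * a + fr v * fr a)
     - fr v * fr v * (v * fr a + fr (fr v) * fr (fr a))"
    by (simp add: algebra_simps)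
  also have "\<dots> = 0" unfolding 1 2 3 by simp
  finally show ?thesis using two_neq_0[OF assms(1)] assms(2) by simp
qed

lemma pairing_eq_0_even:
  assumes "even q" "v \<noteq> 0" "pairing v a = 0"
  obtains f where "f \<in> F" "a = f * fr v"
proof -
  have neg: "- x = x" for x :: 'f using two_eq_0[OF assms(1)] by (metis add.inverse_unique mult_2 mult_zero_left)
  have 1: "v * fr a + fr (fr v) * fr (fr a) = 0" using assms(3) by (simp add: pairing_def)
  have 2: "fr v * fr (fr a) + v * a = 0" using arg_cong[OF 1, of fr] by simp
  have "fr (fr v) * a + fr v * fr a = 0" using arg_cong[OF 2, of fr] by simp
  then have "fr (fr v) * a = fr v * fr a" using neg by (metis eq_neg_iff_add_eq_0)
  then have "fr (a / fr v) = a / fr v" using assms(2) by (simp add: field_simps)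
  then show ?thesis using that[of "a / fr v"] assms(2) by (simp add: F_iff)
qed

lemma conj_F4:
  assumes "conj_to (s, a, b, c, d, e) (S, 0, B, C, 0, 0) h'"
  shows "h' \<in> H5 \<and> lchar (r, 0, w, v, 0, 0) h' =
    theta (r * S + tr (w * (B + a * S)) + tr (v * (C - (B * fr a + fr B * a) - a * fr a * S)))"
  using assms by (rule conj_toE) (simp add: H5_def lchar_def)

lemma mackey_F4_odd:
  assumes "odd q" "v \<noteq> 0"
  shows "mackey_irreducible U H5 (lchar (r, 0, 0, v, 0, 0))"
proof (rule mackey_irreducibleI)
  fix x y assume "x \<in> H5" "y \<in> H5"
  then show "lchar (r, 0, 0, v, 0, 0) (umult x y) = lchar (r, 0, 0, v, 0, 0) x * lchar (r, 0, 0, v, 0, 0) y"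
    by (cases x rule: ucoords_cases; cases y rule: ucoords_cases)
      (simp add: H5_def lchar_def umult_def tr_add distrib_left add_ac nm_def flip: theta_add)
next
  fix s a b c d e assume t: "(s, a, b, c, d, e) \<in> ucarrier" "(s, a, b, c, d, e) \<notin> H5"
  have a: "a \<noteq> 0" using t by (auto simp: H5_def ucarrier_def)
  have "- pairing v a \<noteq> 0" using pairing_eq_0_odd[OF assms, of a] a by auto
  then obtain x where "theta (tr (- pairing v a * x)) \<noteq> 1" using theta_nondegenerate_K by blast
  moreover have "tr (v * (0 - (x * fr a + fr x * a) - a * fr a * 0)) = tr (- pairing v a * x)"
    by (simp only: diff_0 mult_zero_right diff_zero mult_minus_right mult_minus_left tr_minus tr_pairing)
  ultimately have "theta (r * 0 + tr (0 * (x + a * 0)) + tr (v * (0 - (x * fr a + fr x * a) - a * fr a * 0))) \<noteq>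
      lchar (r, 0, 0, v, 0, 0) (0, 0, x, 0, 0, 0)"
    by (simp only: mult_zero_left mult_zero_right tr_0 add_0_left) (simp add: lchar_def)
  then show "\<exists>h\<in>H5. \<exists>z. z \<noteq> lchar (r, 0, 0, v, 0, 0) h \<and>
      (\<forall>h'. conj_to (s, a, b, c, d, e) h h' \<longrightarrow> h' \<in> H5 \<and> lchar (r, 0, 0, v, 0, 0) h' = z)"
    by (intro mackey_witness[where h = "(0, 0, x, 0, 0, 0)", OF _ _ conj_F4[of s a b c d e 0 x 0]])
      (simp add: H5_def, assumption+)
qed (auto simp: H5_def ucarrier_def umult_def uinv_def nm_def lchar_norm)

lemma equal_characters_F4_odd:
  assumes odd: "odd q" and v: "v \<noteq> 0" "v2 \<noteq> 0" and r: "r \<in> F" "r2 \<in> F"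
    and eq: "induced_character U H5 (lchar (r, 0, 0, v, 0, 0)) = induced_character U H5 (lchar (r2, 0, 0, v2, 0, 0))"
  shows "v = v2" "r = r2"
proof -
  obtain s a b c d e where t: "(s, a, b, c, d, e) \<in> ucarrier"
    "\<And>h z. \<lbrakk>h \<in> H5; \<And>h'. conj_to (s, a, b, c, d, e) h h' \<Longrightarrow> h' \<in> H5 \<and> lchar (r, 0, 0, v, 0, 0) h' = z\<rbrakk> \<Longrightarrow>
      z = lchar (r2, 0, 0, v2, 0, 0) h"
    by (rule equal_characters_conjugate[OF mackey_F4_odd[OF odd v(1)] mackey_F4_odd[OF odd v(2)] eq]) blast
  have "theta (r * S + tr (0 * (B + a * S)) + tr (v * (C - (B * fr a + fr B * a) - a * fr a * S))) =
      lchar (r2, 0, 0, v2, 0, 0) (S, 0, B, C, 0, 0)" if "S \<in> F" for S B C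
    by (rule t(2)[OF _ conj_F4]) (use that in \<open>simp_all add: H5_def\<close>)
  then have test: "theta (r * S + tr (v * (C - (B * fr a + fr B * a) - a * fr a * S))) = theta (r2 * S + tr (v2 * C))"
    if "S \<in> F" for S B C
    using that by (simp add: lchar_def)
  show "v = v2"
    by (rule theta_nondegenerate_K_eq) (use test[of 0 _ 0] in simp)
  have "- pairing v a = 0"
  proof (rule theta_nondegenerate_K)
    fix x
    have "theta (tr (v * - (x * fr a + fr x * a))) = 1" using test[of 0 0 x] by simp
    moreover have "tr (v * - (x * fr a + fr x * a)) = tr (- pairing v a * x)"
      unfolding mult_minus_right mult_minus_left tr_minus tr_pairing ..
    ultimately show "theta (tr (- pairing v a * x)) = 1" by simp
  qed
  then have "a = 0" using pairing_eq_0_odd[OF odd v(1), of a] by simp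
  then show "r = r2"
    by (intro theta_nondegenerate_F_eq) (use r test[of _ 0 0] in simp_all)
qed

lemma two_eq_0_simps:
  assumes "even q"
  shows "(x :: 'f) + x = 0" "- (x :: 'f) = x"
proof -
  show 1: "x + x = 0" using two_eq_0[OF assms] mult_2[of x] by simp
  show "- x = x" using minus_unique[OF 1] .
qed

lemma tr_F_even: "\<lbrakk>even q; y \<in> F\<rbrakk> \<Longrightarrow> tr y = y"
  by (simp only: tr_def F_iff two_eq_0_simps(1) add_0_left)

text \<open>  For even \<open>q\<close> the weight \<open>w\<close> of \<open>b\<close> can be normalised to \<open>g v fr (fr v)\<close> with \<open>g \<in> F\<close>, by adding values of the
  pairing.  The radical \<open>F v\<^sup>q\<close> of the pairing then still acts: the parameter \<open>a = f v\<^sup>q\<close> changes the weight of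
  \<open>s\<close> by \<open>f (g - f) nm v\<close>.  The stabiliser is thus given by \<open>f \<in> {0, g}\<close>, which is the definition of \<open>H4\<close>; it
  is larger than \<open>H5\<close> precisely when \<open>g \<noteq> 0\<close>.\<close>

definition H4 :: "'f \<Rightarrow> 'f \<Rightarrow> 'f ucoords set" where
  "H4 v g = F \<times> {0, g * fr v} \<times> UNIV \<times> UNIV \<times> F \<times> F"

text \<open>  The sign \<open>\<epsilon>\<close> distinguishes the two extensions to \<open>H4\<close>.\<close>

definition lchar4 :: "'f \<Rightarrow> 'f \<Rightarrow> 'f \<Rightarrow> complex \<Rightarrow> 'f ucoords \<Rightarrow> complex" where
  "lchar4 v g r \<epsilon> = (\<lambda>(s, a, b, c, d, e).
     (if a = 0 then 1 else \<epsilon>) * theta (r * s + tr (g * v * fr (fr v) * b) + tr (v * c)))"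

lemma conj_F4_even_b:
  assumes "conj_to (s, a, b, c, d, e) (0, 0, x, 0, 0, 0) h'"
  shows "h' \<in> H4 v g \<and> lchar4 v g r \<epsilon> h' = theta (tr ((g * v * fr (fr v) - pairing v a) * x))"
proof -
  obtain C D E where "h' = (0, 0, x - 0 * s + a * 0, C, D, E)" and F: "D \<in> F" "E \<in> F"
    and "(0 :: 'f) = 0 \<Longrightarrow> C = 0 - (x * fr a + fr x * a) - a * fr a * 0"
    using assms by (rule conj_toE) blast
  then have h': "h' = (0, 0, x, - (x * fr a + fr x * a), D, E)" by simp
  have "lchar4 v g r \<epsilon> h' = theta (tr (g * v * fr (fr v) * x) + tr (- (v * (x * fr a + fr x * a))))"
    unfolding h' lchar4_def by (simp only: prod.case mult_minus_right) simp
  also have "tr (- (v * (x * fr a + fr x * a))) = - tr (pairing v a * x)"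
    by (simp only: tr_minus tr_pairing)
  finally show ?thesis using h' F by (simp add: left_diff_distrib tr_diff H4_def)
qed

lemma conj_F4_even_s:
  assumes even: "even q" and F: "f \<in> F" "g \<in> F" and a: "a = f * fr v"
    and "conj_to (s, a, b, c, d, e) (x, 0, 0, 0, 0, 0) h'"
  shows "h' \<in> H4 v g \<and> lchar4 v g r \<epsilon> h' = theta ((r + f * (g - f) * nm v) * x)"
proof -
  obtain C D E where "h' = (x, 0, 0 - 0 * s + a * x, C, D, E)" and F': "x \<in> F" "D \<in> F" "E \<in> F"
    and "(0 :: 'f) = 0 \<Longrightarrow> C = 0 - (0 * fr a + fr 0 * a) - a * fr a * x"
    using assms(5) by (rule conj_toE) blast
  then have h': "h' = (x, 0, a * x, - (a * fr a * x), D, E)" by simp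
  have "g * v * fr (fr v) * (a * x) = (f * g * x) * nm v" "v * - (a * fr a * x) = - (f * f * x) * nm v"
    using F a by (simp_all add: nm_def F_iff)
  then have "lchar4 v g r \<epsilon> h' = theta (r * x + (f * g * x) * tr (nm v) + (- (f * f * x)) * tr (nm v))"
    unfolding h' lchar4_def prod.case using F F'(1) by (simp only: tr_scale F_mult F_minus) simp
  then show ?thesis using h' F' even by (simp add: tr_F_even algebra_simps H4_def)
qed

text \<open>  Outside \<open>H4\<close> the parameter \<open>a\<close> either lies outside the radical and is detected by \<open>Y\<^sub>3\<close>, or it is \<open>f v\<^sup>q\<close>
  with \<open>f (g - f) \<noteq> 0\<close> and is detected by \<open>Y\<^sub>1\<close>.\<close>

lemma mackey_F4_even:
  assumes even: "even q" and v: "v \<noteq> 0" and g: "g \<in> F" and eps: "\<epsilon> = 1 \<or> \<epsilon> = - 1"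
  shows "mackey_irreducible U (H4 v g) (lchar4 v g r \<epsilon>)"
proof (rule mackey_irreducibleI)
  note char2 = two_eq_0_simps[OF even]
  have fg: "fr g = g" using g by (simp add: F_iff)
  show "H4 v g \<subseteq> ucarrier" by (auto simp: H4_def ucarrier_def)
  show "(0, 0, 0, 0, 0, 0) \<in> H4 v g" by (simp add: H4_def)
  show "uinv x \<in> H4 v g" if "x \<in> H4 v g" for x
    using that by (cases x rule: ucoords_cases) (auto simp: H4_def uinv_def char2(2))
  show "cmod (lchar4 v g r \<epsilon> x) = 1" for x
    using eps by (cases x rule: ucoords_cases) (auto simp: lchar4_def theta_norm norm_mult)
  fix x y assume xy: "x \<in> H4 v g" "y \<in> H4 v g"
  then show "umult x y \<in> H4 v g"
    by (cases x rule: ucoords_cases; cases y rule: ucoords_cases) (auto simp: H4_def umult_def char2(1))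
  obtain s a b c d e where x: "x = (s, a, b, c, d, e)" by (rule ucoords_cases)
  obtain S A B C D E where y: "y = (S, A, B, C, D, E)" by (rule ucoords_cases)
  have sF: "S \<in> F" and a: "a = 0 \<or> a = g * fr v" and A: "A = 0 \<or> A = g * fr v"
    using xy by (auto simp: x y H4_def)
  let ?w = "g * v * fr (fr v)"
  have pair0: "pairing v A = 0" 
  proof -
    have "pairing v (g * fr v) = g * v * fr (fr v) + g * v * fr (fr v)"
      using fg by (simp add: pairing_def mult_ac)
    then show ?thesis using A char2(1)[of "g * v * fr (fr v)"] by (auto simp: pairing_def)
  qed
  have "?w * (b + B - a * S) = ?w * b + ?w * B - S * (?w * a)" by (simp add: algebra_simps)
  then have 1: "tr (?w * (b + B - a * S)) = tr (?w * b) + tr (?w * B) - S * tr (?w * a)"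
    by (simp only: tr_add tr_diff tr_scale[OF sF])
  have "v * (c + C - (b * fr A + fr b * A) + a * fr a * S + S * (a * fr A + fr a * A)) =
     v * c + v * C - v * (b * fr A + fr b * A) + S * (v * (a * fr a)) + S * (v * (a * fr A + fr a * A))"
    by (simp add: algebra_simps)
  then have 2: "tr (v * (c + C - (b * fr A + fr b * A) + a * fr a * S + S * (a * fr A + fr a * A))) =
     tr (v * c) + tr (v * C) + S * tr (v * (a * fr a))"
    by (simp only: tr_add tr_diff tr_scale[OF sF] tr_pairing pair0 mult_zero_left mult_zero_right tr_0
        diff_zero add_0_right)
  \<comment> \<open>This is where the normal form of the weight \<open>?w\<close> and the choice of \<open>H4\<close> match.\<close>
  have 3: "?w * a = v * (a * fr a)" using a fg by (auto simp: mult_ac)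
  have sgn: "(if a + A = 0 then 1 else \<epsilon>) = (if a = 0 then 1 else \<epsilon>) * (if A = 0 then 1 else \<epsilon>)"
    using a A eps char2(1)[of "g * fr v"] by auto
  have arg: "r * (s + S) + tr (?w * (b + B - a * S))
      + tr (v * (c + C - (b * fr A + fr b * A) + a * fr a * S + S * (a * fr A + fr a * A)))
    = (r * s + tr (?w * b) + tr (v * c)) + (r * S + tr (?w * B) + tr (v * C))"
    unfolding 1 2 3 by (simp add: algebra_simps)
  show "lchar4 v g r \<epsilon> (umult x y) = lchar4 v g r \<epsilon> x * lchar4 v g r \<epsilon> y"
    unfolding x y umult_def lchar4_def prod.case arg sgn unfolding theta_add by (simp only: mult_ac)
next
  fix s a b c d e assume t: "(s, a, b, c, d, e) \<in> ucarrier" "(s, a, b, c, d, e) \<notin> H4 v g"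
  have a: "a \<noteq> 0" "a \<noteq> g * fr v" using t by (auto simp: H4_def ucarrier_def)
  show "\<exists>h\<in>H4 v g. \<exists>z. z \<noteq> lchar4 v g r \<epsilon> h \<and>
      (\<forall>h'. conj_to (s, a, b, c, d, e) h h' \<longrightarrow> h' \<in> H4 v g \<and> lchar4 v g r \<epsilon> h' = z)"
  proof (cases "pairing v a = 0")
    case False
    then have "- pairing v a \<noteq> 0" by simp
    then obtain x where x: "theta (tr (- pairing v a * x)) \<noteq> 1" using theta_nondegenerate_K by blast
    then have "theta (tr ((g * v * fr (fr v) - pairing v a) * x)) \<noteq> theta (tr (g * v * fr (fr v) * x))"
      by (subst theta_eq_iff) (simp add: left_diff_distrib tr_diff tr_minus)
    then show ?thesis
      by (intro mackey_witness[OF _ _ conj_F4_even_b[where x = x]])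
        (simp_all add: H4_def lchar4_def)
  next
    case True
    obtain f where f: "f \<in> F" "a = f * fr v" using pairing_eq_0_even[OF even v True] .
    have "f * (g - f) * nm v \<in> F" "f * (g - f) * nm v \<noteq> 0" using f g a v by auto
    then obtain x where x: "x \<in> F" "theta (f * (g - f) * nm v * x) \<noteq> 1" using theta_nondegenerate_F by blast
    then have "theta ((r + f * (g - f) * nm v) * x) \<noteq> theta (r * x)"
      by (subst theta_eq_iff) (simp add: distrib_right)
    then show ?thesis
      by (intro mackey_witness[OF _ _ conj_F4_even_s[OF even f(1) g f(2), where x = x]])
        (simp_all add: H4_def lchar4_def x)
  qed
qed

text \<open>  The test elements lie in \<open>Y\<^sub>4\<close>, \<open>Y\<^sub>3\<close>, \<open>Y\<^sub>1\<close> and finally in \<open>Y\<^sub>2\<close>.  The parameter \<open>g\<close> is recovered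
  from the weight of \<open>b\<close> because \<open>tr (v\<^sup>q \<cdot> pairing v a) = 0\<close> in characteristic \<open>2\<close>.  If \<open>f \<in> {0, g}\<close>, the
  conjugating element belongs to \<open>H4\<close>, so it fixes the character and the signs agree.\<close>

lemma equal_characters_F4_even:
  assumes even: "even q" and v: "v \<noteq> 0" "v2 \<noteq> 0" and g: "g \<in> F" "g2 \<in> F" and r: "r \<in> F" "r2 \<in> F"
    and eps: "\<epsilon> = 1 \<or> \<epsilon> = - 1" "\<epsilon>2 = 1 \<or> \<epsilon>2 = - 1"
    and eq: "induced_character U (H4 v g) (lchar4 v g r \<epsilon>) = induced_character U (H4 v2 g2) (lchar4 v2 g2 r2 \<epsilon>2)"
  shows "v = v2" "g = g2" "\<exists>f\<in>F. r + f * (g - f) * nm v = r2 \<and> (g \<noteq> 0 \<and> (f = 0 \<or> f = g) \<longrightarrow> \<epsilon> = \<epsilon>2)"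
proof -
  note mackey1 = mackey_F4_even[OF even v(1) g(1) eps(1), of r] and mackey2 = mackey_F4_even[OF even v(2) g(2) eps(2), of r2]
  interpret A: mackey_irreducible U "H4 v g" "lchar4 v g r \<epsilon>" by (rule mackey1)
  obtain s a b c d e where t: "(s, a, b, c, d, e) \<in> ucarrier"
    "\<And>h z. \<lbrakk>h \<in> H4 v2 g2; \<And>h'. conj_to (s, a, b, c, d, e) h h' \<Longrightarrow> h' \<in> H4 v g \<and> lchar4 v g r \<epsilon> h' = z\<rbrakk> \<Longrightarrow>
      z = lchar4 v2 g2 r2 \<epsilon>2 h"
    by (rule equal_characters_conjugate[OF mackey1 mackey2 eq]) blast
  have "theta (tr (v * x)) = lchar4 v2 g2 r2 \<epsilon>2 (0, 0, 0, x, 0, 0)" for x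
  proof (rule t(2))
    show "(0, 0, 0, x, 0, 0) \<in> H4 v2 g2" by (simp add: H4_def)
    show "h' \<in> H4 v g \<and> lchar4 v g r \<epsilon> h' = theta (tr (v * x))"
      if "conj_to (s, a, b, c, d, e) (0, 0, 0, x, 0, 0) h'" for h'
      using that by (rule conj_toE) (simp add: H4_def lchar4_def)
  qed
  then show vv: "v = v2" by (intro theta_nondegenerate_K_eq) (simp add: lchar4_def)
  have "theta (tr ((g * v * fr (fr v) - pairing v a) * x)) = lchar4 v2 g2 r2 \<epsilon>2 (0, 0, x, 0, 0, 0)" for x
    by (rule t(2)[OF _ conj_F4_even_b]) (simp_all add: H4_def)
  then have pair: "g * v * fr (fr v) - pairing v a = g2 * v * fr (fr v)"
    by (intro theta_nondegenerate_K_eq) (simp add: lchar4_def vv)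
  have "tr (fr v * pairing v a) = tr (v * fr v * fr a) + tr (fr (v * fr v * fr a))"
    by (simp add: pairing_def distrib_left tr_add mult_ac)
  then have "tr (fr v * pairing v a) = 0" using two_eq_0_simps(1)[OF even] by (simp only: tr_fr)
  moreover have "fr v * (g * v * fr (fr v) - pairing v a) = g * nm v - fr v * pairing v a"
    "fr v * (g2 * v * fr (fr v)) = g2 * nm v"
    by (simp_all add: nm_def algebra_simps)
  ultimately have "tr (g * nm v) = tr (g2 * nm v)" using pair by (metis diff_zero tr_diff)
  then have "g * nm v = g2 * nm v" using g by (simp add: tr_F_even even)
  then show gg: "g = g2" using v by simp
  have "pairing v a = 0" using pair gg by simp
  then obtain f where f: "f \<in> F" "a = f * fr v" using pairing_eq_0_even[OF even v(1)] by metis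
  have "r + f * (g - f) * nm v = r2"
  proof (rule theta_nondegenerate_F_eq)
    fix x assume x: "x \<in> F"
    have "theta ((r + f * (g - f) * nm v) * x) = lchar4 v2 g2 r2 \<epsilon>2 (x, 0, 0, 0, 0, 0)"
      by (rule t(2)[OF _ conj_F4_even_s[OF even f(1) g(1) f(2)]]) (use x in \<open>simp_all add: H4_def\<close>)
    then show "theta ((r + f * (g - f) * nm v) * x) = theta (r2 * x)" by (simp add: lchar4_def)
  qed (use r f g in simp_all)
  moreover have "\<epsilon> = \<epsilon>2" if "g \<noteq> 0" "f = 0 \<or> f = g"
  proof -
    let ?h = "(0, g * fr v, 0, 0, 0, 0)"
    have tH: "(s, a, b, c, d, e) \<in> H4 v g" using t(1) that(2) f by (auto simp: H4_def ucarrier_def)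
    have hH: "?h \<in> H4 v2 g2" "?h \<in> H4 v g" by (simp_all add: H4_def vv gg)
    have "lchar4 v g r \<epsilon> ?h = lchar4 v2 g2 r2 \<epsilon>2 ?h"
    proof (rule t(2)[OF hH(1)])
      fix h' assume h': "conj_to (s, a, b, c, d, e) ?h h'"
      have h'H: "h' \<in> H4 v g" using h' by (rule conj_toE) (simp add: H4_def)
      have "lchar4 v g r \<epsilon> ?h * lchar4 v g r \<epsilon> (s, a, b, c, d, e) = lchar4 v g r \<epsilon> (umult ?h (s, a, b, c, d, e))"
        using A.lam_mult[OF hH(2) tH] by (simp add: U_simps)
      also have "\<dots> = lchar4 v g r \<epsilon> (umult (s, a, b, c, d, e) h')" using h' by (simp add: conj_to_def)
      also have "\<dots> = lchar4 v g r \<epsilon> (s, a, b, c, d, e) * lchar4 v g r \<epsilon> h'"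
        using A.lam_mult[OF tH h'H] by (simp add: U_simps)
      finally show "h' \<in> H4 v g \<and> lchar4 v g r \<epsilon> h' = lchar4 v g r \<epsilon> ?h" using A.lam_nz[OF tH] h'H by simp
    qed
    then show ?thesis using that v by (simp add: lchar4_def gg[symmetric])
  qed
  ultimately show "\<exists>f\<in>F. r + f * (g - f) * nm v = r2 \<and> (g \<noteq> 0 \<and> (f = 0 \<or> f = g) \<longrightarrow> \<epsilon> = \<epsilon>2)"
    using f by blast
qed

text \<open>  In characteristic \<open>2\<close> the map \<open>y \<mapsto> y\<^sup>2 + y\<close> sends both \<open>0\<close> and \<open>1\<close> to \<open>0\<close>, so it is not onto the finite set
  \<open>F\<close>.  An element outside its image represents the second class of weights of \<open>s\<close> under the action of the
  radical.\<close>

lemma ex_not_artin_schreier: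
  assumes "even q"
  shows "\<exists>\<eta>\<in>F. \<forall>y\<in>F. y * y + y \<noteq> \<eta>"
proof (rule ccontr)
  assume "\<not> ?thesis"
  then have "F \<subseteq> (\<lambda>y. y * y + y) ` F" by force
  then have "inj_on (\<lambda>y. y * y + y) F" by (intro finite_surj_inj) auto
  moreover have "(\<lambda>y. y * y + y) 0 = (\<lambda>y. y * y + y) (1 :: 'f)" using two_eq_0_simps(1)[OF assms, of 1] by simp
  ultimately show False using inj_onD[of _ F 0 1] by fastforce
qed

definition eta :: 'f where "eta = (SOME \<eta>. \<eta> \<in> F \<and> (\<forall>y\<in>F. y * y + y \<noteq> \<eta>))"

lemma eta:
  assumes "even q" shows "eta \<in> F" "y \<in> F \<Longrightarrow> y * y + y \<noteq> eta"
  using someI_ex[of "\<lambda>\<eta>. \<eta> \<in> F \<and> (\<forall>y\<in>F. y * y + y \<noteq> \<eta>)"] ex_not_artin_schreier[OF assms]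
  unfolding eta_def by blast+

end


context triality_field
begin

section \<open>Degrees and kernels\<close>

definition monomial :: "complex \<Rightarrow> ('f ucoords \<Rightarrow> complex) \<Rightarrow> bool" where
  "monomial d \<chi> \<longleftrightarrow> (\<exists>H lam. mackey_irreducible U H lam \<and> \<chi> = induced_character U H lam \<and>
     of_nat (q ^ 12) = d * of_nat (card H))"

lemma monomialD:
  assumes "monomial d \<chi>"
  shows "\<chi> \<in> Irr U" "\<chi> \<one>\<^bsub>U\<^esub> = d"
    and "g \<in> carrier U \<Longrightarrow> \<chi> (inv\<^bsub>U\<^esub> g) = cnj (\<chi> g)"
    and "(\<Sum>g\<in>carrier U. \<chi> g * \<chi> (inv\<^bsub>U\<^esub> g)) = of_nat (card (carrier U))"
proof -
  obtain H lam where H: "mackey_irreducible U H lam" "\<chi> = induced_character U H lam"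
    "of_nat (q ^ 12) = d * of_nat (card H)" using assms by (auto simp: monomial_def)
  interpret mackey_irreducible U H lam by (rule H(1))
  show "\<chi> \<in> Irr U" unfolding H(2) by (rule indchar_in_Irr)
  have "\<chi> \<one>\<^bsub>U\<^esub> = of_nat (card (carrier U)) / of_nat (card H)" unfolding H(2) by (rule indchar_one)
  also have "\<dots> = d"
  proof -
    have "(of_nat (card H) :: complex) \<noteq> 0" using card_H_pos by (metis less_irrefl of_nat_eq_0_iff)
    then show ?thesis unfolding card_U H(3) by (rule nonzero_mult_div_cancel_right)
  qed
  finally show "\<chi> \<one>\<^bsub>U\<^esub> = d" .
  show "g \<in> carrier U \<Longrightarrow> \<chi> (inv\<^bsub>U\<^esub> g) = cnj (\<chi> g)" unfolding H(2) by (rule indchar_inv)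
  show "(\<Sum>g\<in>carrier U. \<chi> g * \<chi> (inv\<^bsub>U\<^esub> g)) = of_nat (card (carrier U))" unfolding H(2) by (rule indchar_norm)
qed

text \<open>  Conjugates of elements of \<open>Y\<^sub>3 Y\<^sub>4 Y\<^sub>5 Y\<^sub>6\<close> keep their first nonzero coordinate, so a linear character that
  ignores the later ones gives the value of the induced character.\<close>

lemma low_value:
  assumes "mackey_irreducible U H lam" and g: "(0, 0, B, C, D, E) \<in> ucarrier"
    and val: "\<And>C' D' E'. \<lbrakk>D' \<in> F; E' \<in> F; B = 0 \<Longrightarrow> C' = C; \<lbrakk>B = 0; C = 0\<rbrakk> \<Longrightarrow> D' = D;
        \<lbrakk>B = 0; C = 0; D = 0\<rbrakk> \<Longrightarrow> E' = E\<rbrakk> \<Longrightarrow> (0, 0, B, C', D', E') \<in> H \<and> lam (0, 0, B, C', D', E') = z"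
  shows "induced_character U H lam (0, 0, B, C, D, E) = z * induced_character U H lam \<one>\<^bsub>U\<^esub>"
proof (rule indchar_value[OF mackey_irreducible.axioms(1)[OF assms(1)] g])
  fix s a b c d e h' assume "conj_to (s, a, b, c, d, e) (0, 0, B, C, D, E) h'"
  then show "h' \<in> H \<and> lam h' = z"
  proof (rule conj_toE)
    fix C' D' E'
    assume h': "h' = (0, 0, B - 0 * s + a * 0, C', D', E')" and F: "D' \<in> F" "E' \<in> F"
      and c: "(0 :: 'f) = 0 \<Longrightarrow> C' = C - (B * fr a + fr B * a) - a * fr a * 0"
        "\<lbrakk>(0 :: 'f) = 0; (0 :: 'f) = 0\<rbrakk> \<Longrightarrow> D' = D - tr (fr C * a) + tr (B * fr a * fr (fr a))"
        "\<lbrakk>(0 :: 'f) = 0; (0 :: 'f) = 0; B = 0\<rbrakk> \<Longrightarrow> E' = E - tr (fr C * b) - D * s"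
    have "(0, 0, B, C', D', E') \<in> H \<and> lam (0, 0, B, C', D', E') = z"
      by (rule val) (use F c in auto)
    then show ?thesis by (simp add: h')
  qed
qed

lemma not_in_kernel:
  assumes "mackey_irreducible U H lam" "induced_character U H lam g = z * induced_character U H lam \<one>\<^bsub>U\<^esub>" "z \<noteq> 1"
  shows "g \<notin> char_ker U (induced_character U H lam)"
proof -
  interpret mackey_irreducible U H lam by fact
  have "indchar \<one>\<^bsub>U\<^esub> \<noteq> 0" using card_H_pos finite_group by (auto simp: indchar_one)
  then show ?thesis using assms(2,3) by (simp add: char_ker_def)
qed

text \<open>  The products of root subgroups that occur in the definitions of the families, in coordinates.\<close>

definition Z6 :: "'f ucoords set" where "Z6 = {0} \<times> {0} \<times> {0} \<times> {0} \<times> {0} \<times> F"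
definition Z5 :: "'f ucoords set" where "Z5 = {0} \<times> {0} \<times> {0} \<times> {0} \<times> F \<times> {0}"
definition Z4 :: "'f ucoords set" where "Z4 = {0} \<times> {0} \<times> {0} \<times> UNIV \<times> {0} \<times> {0}"
definition Z3 :: "'f ucoords set" where "Z3 = {0} \<times> {0} \<times> UNIV \<times> {0} \<times> {0} \<times> {0}"
definition Z56 :: "'f ucoords set" where "Z56 = {0} \<times> {0} \<times> {0} \<times> {0} \<times> F \<times> F"
definition Z456 :: "'f ucoords set" where "Z456 = {0} \<times> {0} \<times> {0} \<times> UNIV \<times> F \<times> F"
definition Z3456 :: "'f ucoords set" where "Z3456 = {0} \<times> {0} \<times> UNIV \<times> UNIV \<times> F \<times> F"

lemmas Z_defs = Z6_def Z5_def Z4_def Z3_def Z56_def Z456_def Z3456_def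

definition famU6 where "famU6 = {\<chi> \<in> Irr U. \<not> Z6 \<subseteq> char_ker U \<chi>}"
definition famU5 where "famU5 = {\<chi> \<in> Irr U. \<not> Z5 \<subseteq> char_ker U \<chi> \<and> Z6 \<subseteq> char_ker U \<chi>}"
definition famU4 where "famU4 = {\<chi> \<in> Irr U. \<not> Z4 \<subseteq> char_ker U \<chi> \<and> Z56 \<subseteq> char_ker U \<chi>}"
definition famU3 where "famU3 = {\<chi> \<in> Irr U. \<not> Z3 \<subseteq> char_ker U \<chi> \<and> Z456 \<subseteq> char_ker U \<chi>}"
definition famU_lin where "famU_lin = {\<chi> \<in> Irr U. Z3456 \<subseteq> char_ker U \<chi>}"

lemmas famU_defs = famU6_def famU5_def famU4_def famU3_def famU_lin_def

lemma famU_disjoint: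
  "famU6 \<inter> famU5 = {}" "famU6 \<inter> famU4 = {}" "famU6 \<inter> famU3 = {}" "famU6 \<inter> famU_lin = {}"
  "famU5 \<inter> famU4 = {}" "famU5 \<inter> famU3 = {}" "famU5 \<inter> famU_lin = {}"
  "famU4 \<inter> famU3 = {}" "famU4 \<inter> famU_lin = {}" "famU3 \<inter> famU_lin = {}"
proof -
  have inc: "Z6 \<subseteq> Z56" "Z5 \<subseteq> Z56" "Z56 \<subseteq> Z456" "Z4 \<subseteq> Z456" "Z456 \<subseteq> Z3456" "Z3 \<subseteq> Z3456"
    unfolding Z_defs by auto
  show "famU6 \<inter> famU5 = {}" "famU6 \<inter> famU4 = {}" "famU6 \<inter> famU3 = {}" "famU6 \<inter> famU_lin = {}"
    "famU5 \<inter> famU4 = {}" "famU5 \<inter> famU3 = {}" "famU5 \<inter> famU_lin = {}"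
    "famU4 \<inter> famU3 = {}" "famU4 \<inter> famU_lin = {}" "famU3 \<inter> famU_lin = {}"
    unfolding famU_defs using inc by blast+
qed

lemma Z_members:
  "(0, 0, x, 0, 0, 0) \<in> Z3" "(0, 0, 0, x, 0, 0) \<in> Z4"
  "y \<in> F \<Longrightarrow> (0, 0, 0, 0, y, 0) \<in> Z5" "y \<in> F \<Longrightarrow> (0, 0, 0, 0, 0, y) \<in> Z6"
  unfolding Z_defs by auto

lemma in_kernel: "\<lbrakk>\<chi> g = 1 * \<chi> \<one>\<^bsub>U\<^esub>; g \<in> ucarrier\<rbrakk> \<Longrightarrow> g \<in> char_ker U \<chi>"
  by (simp add: char_ker_def U_simps(1))

lemma famU_lin_member:
  assumes "r \<in> F"
  shows "monomial 1 (induced_character U ucarrier (lchar (r, v, 0, 0, 0, 0)))" (is "monomial 1 ?\<chi>")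
    and "induced_character U ucarrier (lchar (r, v, 0, 0, 0, 0)) \<in> famU_lin"
proof -
  note m = mackey_lin[OF assms, of v]
  show mon: "monomial 1 ?\<chi>"
    unfolding monomial_def using m card_U by (intro exI[of _ ucarrier] exI) (auto simp: U_simps)
  have "?\<chi> (0, 0, B, C, D, E) = 1 * ?\<chi> \<one>\<^bsub>U\<^esub>" if "D \<in> F" "E \<in> F" for B C D E
    by (rule low_value[OF m]) (use that in \<open>simp_all add: ucarrier_def lchar_def\<close>)
  then have "Z3456 \<subseteq> char_ker U ?\<chi>"
    by (auto simp: Z_defs ucarrier_def intro!: in_kernel)
  then show "?\<chi> \<in> famU_lin"
    using monomialD(1)[OF mon] by (simp add: famU_lin_def)
qed

lemma famU3_member:
  assumes "v \<noteq> 0"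
  shows "monomial (of_nat q) (induced_character U H3 (lchar (0, w, v, 0, 0, 0)))" (is "monomial _ ?\<chi>")
    and "induced_character U H3 (lchar (0, w, v, 0, 0, 0)) \<in> famU3"
proof -
  note m = mackey_F3[OF assms, of w]
  have card: "q ^ 12 = q * card H3"
    by (simp add: H3_def card_cartesian_product card_F card_K) (simp add: eval_nat_numeral)
  show mon: "monomial (of_nat q) ?\<chi>"
    unfolding monomial_def card using m by (intro exI[of _ H3] exI) auto
  have val: "?\<chi> (0, 0, B, C, D, E) = theta (tr (v * B)) * ?\<chi> \<one>\<^bsub>U\<^esub>" if "D \<in> F" "E \<in> F" for B C D E
    by (rule low_value[OF m]) (use that in \<open>simp_all add: ucarrier_def lchar_def H3_def\<close>)
  obtain x where x: "theta (tr (v * x)) \<noteq> 1" using theta_nondegenerate_K assms by blast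
  have "(0, 0, x, 0, 0, 0) \<notin> char_ker U ?\<chi>"
    by (rule not_in_kernel[OF m val x]) auto
  moreover have "Z456 \<subseteq> char_ker U ?\<chi>"
    unfolding Z_defs using val[of _ _ 0] by (auto simp: ucarrier_def intro!: in_kernel)
  ultimately show "?\<chi> \<in> famU3"
    using monomialD(1)[OF mon] Z_members unfolding famU3_def by blast
qed

lemma famU4_memberI:
  assumes m: "mackey_irreducible U H lam" and irr: "induced_character U H lam \<in> Irr U"
    and v: "v \<noteq> 0" and val: "\<And>C D E. \<lbrakk>D \<in> F; E \<in> F\<rbrakk> \<Longrightarrow> (0, 0, 0, C, D, E) \<in> H \<and> lam (0, 0, 0, C, D, E) = theta (tr (v * C))"
  shows "induced_character U H lam \<in> famU4"
proof -
  let ?\<chi> = "induced_character U H lam"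
  have val: "?\<chi> (0, 0, 0, C, D, E) = theta (tr (v * C)) * ?\<chi> \<one>\<^bsub>U\<^esub>" if "D \<in> F" "E \<in> F" for C D E
    by (rule low_value[OF m]) (use that val in \<open>simp_all add: ucarrier_def\<close>)
  obtain x where x: "theta (tr (v * x)) \<noteq> 1" using theta_nondegenerate_K v by blast
  have "(0, 0, 0, x, 0, 0) \<notin> char_ker U ?\<chi>"
    by (rule not_in_kernel[OF m val x]) auto
  moreover have "Z56 \<subseteq> char_ker U ?\<chi>"
    unfolding Z_defs using val[of _ _ 0] by (auto simp: ucarrier_def intro!: in_kernel)
  ultimately show "?\<chi> \<in> famU4"
    using irr Z_members unfolding famU4_def by blast
qed

lemma famU4_member_odd:
  assumes "odd q" "v \<noteq> 0"
  shows "monomial (of_nat (q ^ 3)) (induced_character U H5 (lchar (r, 0, 0, v, 0, 0)))" (is "monomial _ ?\<chi>")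
    and "induced_character U H5 (lchar (r, 0, 0, v, 0, 0)) \<in> famU4"
proof -
  note m = mackey_F4_odd[OF assms, of r]
  have "q ^ 12 = q ^ 3 * card H5"
    by (simp add: H5_def card_cartesian_product card_F card_K) (simp add: eval_nat_numeral)
  then have card: "of_nat (q ^ 12) = (of_nat (q ^ 3) * of_nat (card H5) :: complex)" by (simp only: of_nat_mult)
  show mon: "monomial (of_nat (q ^ 3)) ?\<chi>"
    unfolding monomial_def using m card by (intro exI[of _ H5] exI) auto
  show "?\<chi> \<in> famU4"
    by (rule famU4_memberI[OF m monomialD(1)[OF mon] assms(2)]) (simp add: H5_def lchar_def)
qed

lemma famU4_member_even:
  assumes "even q" "v \<noteq> 0" "g \<in> F" "\<epsilon> = 1 \<or> \<epsilon> = - 1"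
  shows "monomial (if g = 0 then of_nat (q ^ 3) else of_nat (q ^ 3) / 2) (induced_character U (H4 v g) (lchar4 v g r \<epsilon>))"
      (is "monomial ?d ?\<chi>")
    and "induced_character U (H4 v g) (lchar4 v g r \<epsilon>) \<in> famU4"
proof -
  note m = mackey_F4_even[OF assms, of r]
  have "card (H4 v g) = q ^ 9 * card {0, g * fr v}"
    by (simp add: H4_def card_cartesian_product card_F card_K) (simp add: eval_nat_numeral)
  moreover have "card {0, g * fr v} = (if g = 0 then 1 else 2)" using assms(2) by simp
  ultimately have "of_nat (q ^ 12) = ?d * of_nat (card (H4 v g))" by (simp flip: power_add)
  then show mon: "monomial ?d ?\<chi>"
    unfolding monomial_def using m by (intro exI[of _ "H4 v g"] exI) auto
  show "?\<chi> \<in> famU4"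
    by (rule famU4_memberI[OF m monomialD(1)[OF mon] assms(2)]) (simp add: H4_def lchar4_def)
qed

lemma famU5_member:
  assumes "u \<in> F" "u \<noteq> 0"
  shows "monomial (of_nat (q ^ 3)) (induced_character U H5 (lchar (r, 0, w, 0, u, 0)))" (is "monomial _ ?\<chi>")
    and "induced_character U H5 (lchar (r, 0, w, 0, u, 0)) \<in> famU5"
proof -
  note m = mackey_F5[OF assms, of r w]
  have "q ^ 12 = q ^ 3 * card H5"
    by (simp add: H5_def card_cartesian_product card_F card_K) (simp add: eval_nat_numeral)
  then have card: "of_nat (q ^ 12) = (of_nat (q ^ 3) * of_nat (card H5) :: complex)" by (simp only: of_nat_mult)
  show mon: "monomial (of_nat (q ^ 3)) ?\<chi>"
    unfolding monomial_def using m card by (intro exI[of _ H5] exI) auto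
  have val: "?\<chi> (0, 0, 0, 0, D, E) = theta (u * D) * ?\<chi> \<one>\<^bsub>U\<^esub>" if "D \<in> F" "E \<in> F" for D E
    by (rule low_value[OF m]) (use that in \<open>simp_all add: ucarrier_def lchar_def H5_def\<close>)
  obtain x where x: "x \<in> F" "theta (u * x) \<noteq> 1" using theta_nondegenerate_F assms by blast
  have "(0, 0, 0, 0, x, 0) \<notin> char_ker U ?\<chi>"
    by (rule not_in_kernel[OF m val x(2)]) (use x in auto)
  moreover have "Z6 \<subseteq> char_ker U ?\<chi>"
    unfolding Z_defs using val[of 0] by (auto simp: ucarrier_def intro!: in_kernel)
  ultimately show "?\<chi> \<in> famU5"
    using monomialD(1)[OF mon] x(1) Z_members unfolding famU5_def by blast
qed

lemma famU6_member:
  assumes "u \<in> F" "u \<noteq> 0"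
  shows "monomial (of_nat (q ^ 4)) (induced_character U H6 (lchar (0, v, 0, 0, 0, u)))" (is "monomial _ ?\<chi>")
    and "induced_character U H6 (lchar (0, v, 0, 0, 0, u)) \<in> famU6"
proof -
  note m = mackey_F6[OF assms, of v]
  have "q ^ 12 = q ^ 4 * card H6"
    by (simp add: H6_def card_cartesian_product card_F card_K) (simp add: eval_nat_numeral)
  then have card: "of_nat (q ^ 12) = (of_nat (q ^ 4) * of_nat (card H6) :: complex)" by (simp only: of_nat_mult)
  show mon: "monomial (of_nat (q ^ 4)) ?\<chi>"
    unfolding monomial_def using m card by (intro exI[of _ H6] exI) auto
  have val: "?\<chi> (0, 0, 0, 0, 0, E) = theta (u * E) * ?\<chi> \<one>\<^bsub>U\<^esub>" if "E \<in> F" for E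
    by (rule low_value[OF m]) (use that in \<open>simp_all add: ucarrier_def lchar_def H6_def\<close>)
  obtain x where x: "x \<in> F" "theta (u * x) \<noteq> 1" using theta_nondegenerate_F assms by blast
  have "(0, 0, 0, 0, 0, x) \<notin> char_ker U ?\<chi>"
    by (rule not_in_kernel[OF m val x(2)]) (use x in auto)
  then show "?\<chi> \<in> famU6"
    using monomialD(1)[OF mon] x(1) Z_members unfolding famU6_def by blast
qed

text \<open>The second statement: a representative determines its coset.\<close>

lemma card_F_mod_Fq: "card (F_mod_Fq q :: 'f set set) = q ^ 2"
  and F_mod_Fq_rep: "\<lbrakk>C \<in> (F_mod_Fq q :: 'f set set); C' \<in> F_mod_Fq q; (SOME r. r \<in> C) - (SOME r. r \<in> C') \<in> F\<rbrakk> \<Longrightarrow> C = C'"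
proof -
  let ?R = "{(s :: 'f, t). s - t \<in> F}"
  have equiv: "equiv UNIV ?R"
  proof (rule equivI)
    show "sym ?R" by (rule symI) (metis (no_types, lifting) F_minus case_prodD case_prodI mem_Collect_eq minus_diff_eq)
    show "trans ?R" by (rule transI) (clarsimp, metis F_add diff_add_cancel add_diff_eq)
  qed (auto simp: refl_on_def)
  have Q: "F_mod_Fq q = UNIV // ?R" by (simp add: F_mod_Fq_def)
  have card_class: "card X = q" if "X \<in> UNIV // ?R" for X
  proof -
    obtain s where "X = ?R `` {s}" using \<open>X \<in> UNIV // ?R\<close> by (auto elim: quotientE)
    then have "X = (\<lambda>t. s - t) ` F"
      by (auto simp: image_iff intro!: bexI[of _ "s - _"])
    then show ?thesis by (simp add: card_image inj_on_def card_F)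
  qed
  have "card (\<Union> (UNIV // ?R)) = (\<Sum>X\<in>UNIV // ?R. card X)"
    using quotient_disj[OF equiv] by (intro card_Union_disjoint) (auto simp: pairwise_def disjnt_def)
  then have "q ^ 3 = card (UNIV // ?R) * q"
    using Union_quotient[OF equiv] card_class by (simp add: card_K)
  then show "card (F_mod_Fq q :: 'f set set) = q ^ 2"
    using q_ge_2 by (simp add: Q power3_eq_cube power2_eq_square)
  assume C: "C \<in> F_mod_Fq q" "C' \<in> F_mod_Fq q" and rep: "(SOME r. r \<in> C) - (SOME r. r \<in> C') \<in> F"
  have "(SOME r. r \<in> X) \<in> X" if "X \<in> F_mod_Fq q" for X :: "'f set"
    using in_quotient_imp_non_empty[OF equiv, of X] that unfolding Q by (simp add: some_in_eq)
  then have "(SOME r. r \<in> C) \<in> C" "(SOME r. r \<in> C') \<in> C'" using C by auto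
  then show "C = C'"
    using quotient_eqI[OF equiv _ _ _ _, of C C' "SOME r. r \<in> C" "SOME r. r \<in> C'"] C rep unfolding Q by auto
qed

end


context triality_field
begin

section \<open>The five families of monomial characters\<close>

definition chi6 :: "'f \<times> 'f \<Rightarrow> 'f ucoords \<Rightarrow> complex" where
  "chi6 = (\<lambda>(u, v). induced_character U H6 (lchar (0, v, 0, 0, 0, u)))"
definition chi5 :: "'f \<times> 'f \<times> 'f \<Rightarrow> 'f ucoords \<Rightarrow> complex" where
  "chi5 = (\<lambda>(u, r, w). induced_character U H5 (lchar (r, 0, w, 0, u, 0)))"
definition chi4_odd :: "'f \<times> 'f \<Rightarrow> 'f ucoords \<Rightarrow> complex" where
  "chi4_odd = (\<lambda>(v, r). induced_character U H5 (lchar (r, 0, 0, v, 0, 0)))"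
definition chi4_even :: "'f \<Rightarrow> 'f ucoords \<Rightarrow> complex" where
  "chi4_even = (\<lambda>v. induced_character U (H4 v 0) (lchar4 v 0 0 1))"
text \<open>  The first bit selects one of the two classes of weights of \<open>s\<close> modulo the values \<open>f (g - f) nm v\<close>, the second
  one the sign of the extension.\<close>

definition chi4_half :: "'f \<times> 'f \<times> bit \<times> bit \<Rightarrow> 'f ucoords \<Rightarrow> complex" where
  "chi4_half = (\<lambda>(v, g, i, j). induced_character U (H4 v g)
     (lchar4 v g (if i = 1 then nm v * g\<^sup>2 * eta else 0) (if j = 1 then - 1 else 1)))"
definition chi3 :: "'f \<times> 'f set \<Rightarrow> 'f ucoords \<Rightarrow> complex" where
  "chi3 = (\<lambda>(v, C). induced_character U H3 (lchar (0, v * (SOME r. r \<in> C), v, 0, 0, 0)))"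
definition chi_lin :: "'f \<times> 'f \<Rightarrow> 'f ucoords \<Rightarrow> complex" where
  "chi_lin = (\<lambda>(v, r). induced_character U ucarrier (lchar (r, v, 0, 0, 0, 0)))"

lemma inj_chi6:
  "inj_on chi6 ((F - {0}) \<times> UNIV)"
proof (rule inj_onI)
  fix p p' assume dom: "p \<in> (F - {0}) \<times> UNIV" "p' \<in> (F - {0}) \<times> UNIV" and eq: "chi6 p = chi6 p'"
  obtain u v where p1: "p = (u, v)" by (cases p)
  obtain u' v' where p2: "p' = (u', v')" by (cases p')
  note p = p1 p2
  have mem: "u \<in> F" "u \<noteq> 0" "u' \<in> F" "u' \<noteq> 0" using dom by (simp_all add: p)
  show "p = p'" using equal_characters_F6[OF mem eq[unfolded p chi6_def prod.case]] by (simp add: p)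
qed

lemma inj_chi5:
  "inj_on chi5 ((F - {0}) \<times> F \<times> UNIV)"
proof (rule inj_onI)
  fix p p' assume dom: "p \<in> (F - {0}) \<times> F \<times> UNIV" "p' \<in> (F - {0}) \<times> F \<times> UNIV" and eq: "chi5 p = chi5 p'"
  obtain u r w where p1: "p = (u, r, w)" by (cases p)
  obtain u' r' w' where p2: "p' = (u', r', w')" by (cases p')
  note p = p1 p2
  have mem: "u \<in> F" "u \<noteq> 0" "u' \<in> F" "u' \<noteq> 0" "r \<in> F" "r' \<in> F" using dom by (simp_all add: p)
  show "p = p'" using equal_characters_F5[OF mem eq[unfolded p chi5_def prod.case]] by (simp add: p)
qed

lemma inj_chi4_odd: assumes "odd q"
  shows "inj_on chi4_odd ((UNIV - {0}) \<times> F)"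
proof (rule inj_onI)
  fix p p' assume dom: "p \<in> (UNIV - {0}) \<times> F" "p' \<in> (UNIV - {0}) \<times> F" and eq: "chi4_odd p = chi4_odd p'"
  obtain v r where p1: "p = (v, r)" by (cases p)
  obtain v' r' where p2: "p' = (v', r')" by (cases p')
  note p = p1 p2
  have mem: "v \<noteq> 0" "v' \<noteq> 0" "r \<in> F" "r' \<in> F" using dom by (simp_all add: p)
  show "p = p'" using equal_characters_F4_odd[OF assms mem eq[unfolded p chi4_odd_def prod.case]] by (simp add: p)
qed

lemma inj_chi4_even: assumes "even q"
  shows "inj_on chi4_even (UNIV - {0})"
proof (rule inj_onI)
  fix v v' assume "v \<in> UNIV - {0}" "v' \<in> UNIV - {0}" and eq: "chi4_even v = chi4_even v'"
  then have v: "v \<noteq> 0" "v' \<noteq> 0" by auto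
  have e: "(1 :: complex) = 1 \<or> (1 :: complex) = - 1" by simp
  show "v = v'" by (rule equal_characters_F4_even(1)[OF assms v F_0 F_0 F_0 F_0 e e eq[unfolded chi4_even_def]])
qed

text \<open>  Two different weights of \<open>s\<close> that are conjugate would make \<open>eta\<close> a value of \<open>y\<^sup>2 + y\<close>, at \<open>y = f / g\<close>.\<close>

lemma inj_chi4_half:
  assumes "even q"
  shows "inj_on chi4_half ((UNIV - {0}) \<times> (F - {0}) \<times> UNIV \<times> UNIV)"
proof (rule inj_onI)
  fix p p' assume dom: "p \<in> (UNIV - {0}) \<times> (F - {0}) \<times> (UNIV :: bit set) \<times> (UNIV :: bit set)"
      "p' \<in> (UNIV - {0}) \<times> (F - {0}) \<times> (UNIV :: bit set) \<times> (UNIV :: bit set)"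
    and eq: "chi4_half p = chi4_half p'"
  obtain v g i j where p1: "p = (v, g, i, j)" by (cases p)
  obtain v' g' i' j' where p2: "p' = (v', g', i', j')" by (cases p')
  have mem: "v \<noteq> 0" "v' \<noteq> 0" "g \<in> F" "g' \<in> F" "g \<noteq> 0" "g' \<noteq> 0" using dom by (simp_all add: p1 p2)
  note p = p1 p2 mem
  let ?r = "\<lambda>v g (i :: bit). if i = 1 then nm v * g\<^sup>2 * eta else 0"
  let ?e = "\<lambda>j :: bit. if j = 1 then - 1 else (1 :: complex)"
  have rF: "?r v g i \<in> F" "?r v' g' i' \<in> F" using p eta(1)[OF assms] by (auto simp: power2_eq_square)
  have e1: "?e j = 1 \<or> ?e j = - 1" "?e j' = 1 \<or> ?e j' = - 1" by auto
  note E = equal_characters_F4_even[OF assms p(3-6) rF e1 eq[unfolded p chi4_half_def prod.case]]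
  have vg: "v' = v" "g' = g" using E(1,2) by simp_all
  obtain f where f: "f \<in> F" "?r v g i + f * (g - f) * nm v = ?r v g i'" "f = 0 \<or> f = g \<Longrightarrow> ?e j = ?e j'"
    using E(3) p unfolding vg by blast
  note char2 = two_eq_0_simps[OF assms]
  have ii: "i = i'"
  proof (rule ccontr)
    assume "i \<noteq> i'"
    then have "?r v g i' - ?r v g i = nm v * g\<^sup>2 * eta"
      using char2(2) by (cases i; cases i') auto
    moreover have "?r v g i' - ?r v g i = f * (g - f) * nm v"
      unfolding f(2)[symmetric] by simp
    ultimately have "f * (g - f) = g\<^sup>2 * eta" using p by simp
    moreover have "f * (g - f) = g\<^sup>2 * ((f / g) * (f / g) + f / g)"
    proof -
      have "g\<^sup>2 * ((f / g) * (f / g) + f / g) = f * (g + f)"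
        using p by (simp add: field_simps power2_eq_square)
      then show ?thesis using char2(2)[of f] by (metis diff_conv_add_uminus)
    qed
    ultimately have "(f / g) * (f / g) + f / g = eta" using p by simp
    then show False using eta(2)[OF assms, of "f / g"] f(1) p by simp
  qed
  then have "f * (g - f) * nm v = 0" using f(2) by simp
  then have "f = 0 \<or> f = g" using p by auto
  then have "?e j = ?e j'" by (rule f(3))
  then have "j = j'" by (cases j; cases j') auto
  then show "p = p'" using p vg ii by simp
qed

lemma inj_chi3: "inj_on chi3 ((UNIV - {0}) \<times> F_mod_Fq q)"
proof (rule inj_onI)
  fix p p' :: "'f \<times> 'f set"
  assume dom: "p \<in> (UNIV - {0}) \<times> F_mod_Fq q" "p' \<in> (UNIV - {0}) \<times> F_mod_Fq q" and eq: "chi3 p = chi3 p'"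
  obtain v C where p1: "p = (v, C)" by (cases p)
  obtain v' C' where p2: "p' = (v', C')" by (cases p')
  have mem: "v \<noteq> 0" "v' \<noteq> 0" "C \<in> F_mod_Fq q" "C' \<in> F_mod_Fq q" using dom by (simp_all add: p1 p2)
  note p = p1 p2 mem
  note E = equal_characters_F3[OF p(3,4) eq[unfolded p chi3_def prod.case]]
  obtain s where s: "s \<in> F" "v * (SOME r. r \<in> C) - v * s = v * (SOME r. r \<in> C')" using E by auto
  then have "v * ((SOME r. r \<in> C) - (SOME r. r \<in> C')) = v * s" by (simp add: right_diff_distrib flip: s(2))
  then have "(SOME r. r \<in> C) - (SOME r. r \<in> C') \<in> F" using p s by simp
  then show "p = p'" using F_mod_Fq_rep[OF p(5,6)] E(1) p by simp
qed

lemma inj_chi_lin: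
  "inj_on chi_lin (UNIV \<times> F)"
proof (rule inj_onI)
  fix p p' assume dom: "p \<in> UNIV \<times> F" "p' \<in> UNIV \<times> F" and eq: "chi_lin p = chi_lin p'"
  obtain v r where p1: "p = (v, r)" by (cases p)
  obtain v' r' where p2: "p' = (v', r')" by (cases p')
  note p = p1 p2
  have mem: "r \<in> F" "r' \<in> F" using dom by (simp_all add: p)
  show "p = p'" using equal_characters_lin[OF mem eq[unfolded p chi_lin_def prod.case]] by (simp add: p)
qed

lemma chi_families:
  "\<chi> \<in> chi6 ` ((F - {0}) \<times> UNIV) \<Longrightarrow> monomial (of_nat (q ^ 4)) \<chi> \<and> \<chi> \<in> famU6"
  "\<chi> \<in> chi5 ` ((F - {0}) \<times> F \<times> UNIV) \<Longrightarrow> monomial (of_nat (q ^ 3)) \<chi> \<and> \<chi> \<in> famU5"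
  "\<lbrakk>odd q; \<chi> \<in> chi4_odd ` ((UNIV - {0}) \<times> F)\<rbrakk> \<Longrightarrow> monomial (of_nat (q ^ 3)) \<chi> \<and> \<chi> \<in> famU4"
  "\<lbrakk>even q; \<chi> \<in> chi4_even ` (UNIV - {0})\<rbrakk> \<Longrightarrow> monomial (of_nat (q ^ 3)) \<chi> \<and> \<chi> \<in> famU4"
  "\<lbrakk>even q; \<chi> \<in> chi4_half ` ((UNIV - {0}) \<times> (F - {0}) \<times> UNIV \<times> UNIV)\<rbrakk> \<Longrightarrow>
     monomial (of_nat (q ^ 3) / 2) \<chi> \<and> \<chi> \<in> famU4"
  "\<chi> \<in> chi3 ` ((UNIV - {0}) \<times> F_mod_Fq q) \<Longrightarrow> monomial (of_nat q) \<chi> \<and> \<chi> \<in> famU3"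
  "\<chi> \<in> chi_lin ` (UNIV \<times> F) \<Longrightarrow> monomial 1 \<chi> \<and> \<chi> \<in> famU_lin"
proof -
  show "\<chi> \<in> chi6 ` ((F - {0}) \<times> UNIV) \<Longrightarrow> monomial (of_nat (q ^ 4)) \<chi> \<and> \<chi> \<in> famU6"
    unfolding chi6_def using famU6_member by auto
  show "\<chi> \<in> chi5 ` ((F - {0}) \<times> F \<times> UNIV) \<Longrightarrow> monomial (of_nat (q ^ 3)) \<chi> \<and> \<chi> \<in> famU5"
    unfolding chi5_def using famU5_member by auto
  show "\<lbrakk>odd q; \<chi> \<in> chi4_odd ` ((UNIV - {0}) \<times> F)\<rbrakk> \<Longrightarrow> monomial (of_nat (q ^ 3)) \<chi> \<and> \<chi> \<in> famU4"
    unfolding chi4_odd_def using famU4_member_odd by auto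
  show "\<lbrakk>even q; \<chi> \<in> chi4_even ` (UNIV - {0})\<rbrakk> \<Longrightarrow> monomial (of_nat (q ^ 3)) \<chi> \<and> \<chi> \<in> famU4"
    unfolding chi4_even_def using famU4_member_even[of _ 0 1 0] by auto
  show "\<chi> \<in> chi3 ` ((UNIV - {0}) \<times> F_mod_Fq q) \<Longrightarrow> monomial (of_nat q) \<chi> \<and> \<chi> \<in> famU3"
    unfolding chi3_def using famU3_member by auto
  show "\<chi> \<in> chi_lin ` (UNIV \<times> F) \<Longrightarrow> monomial 1 \<chi> \<and> \<chi> \<in> famU_lin"
    unfolding chi_lin_def using famU_lin_member by auto
  assume even: "even q" and "\<chi> \<in> chi4_half ` ((UNIV - {0}) \<times> (F - {0}) \<times> UNIV \<times> UNIV)"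
  then obtain v g i j where p: "v \<noteq> 0" "g \<in> F" "g \<noteq> 0" "\<chi> = chi4_half (v, g, i, j)" by auto
  have "(if j = 1 then - 1 else 1) = 1 \<or> (if j = 1 then - 1 else 1) = (- 1 :: complex)" by auto
  from famU4_member_even[OF even p(1,2) this]
  show "monomial (of_nat (q ^ 3) / 2) \<chi> \<and> \<chi> \<in> famU4"
    unfolding p chi4_half_def prod.case using p(3) by auto
qed

lemma card_nonzero: "card (F - {0}) = q - 1" "card (UNIV - {0 :: 'f}) = q ^ 3 - 1"
  by (simp_all add: card_F card_K)

lemma card_chi:
  "card (chi6 ` ((F - {0}) \<times> UNIV)) = (q - 1) * q ^ 3"
  "card (chi5 ` ((F - {0}) \<times> F \<times> UNIV)) = (q - 1) * q ^ 4"
  "odd q \<Longrightarrow> card (chi4_odd ` ((UNIV - {0}) \<times> F)) = (q ^ 3 - 1) * q"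
  "even q \<Longrightarrow> card (chi4_even ` (UNIV - {0})) = q ^ 3 - 1"
  "even q \<Longrightarrow> card (chi4_half ` ((UNIV - {0}) \<times> (F - {0}) \<times> UNIV \<times> UNIV)) = 4 * (q ^ 3 - 1) * (q - 1)"
  "card (chi3 ` ((UNIV - {0}) \<times> F_mod_Fq q)) = (q ^ 3 - 1) * q ^ 2"
  "card (chi_lin ` (UNIV \<times> F)) = q ^ 4"
proof -
  have "(UNIV :: bit set) = {0, 1}" using bit_not_zero_iff by blast
  then have bit: "card (UNIV :: bit set) = 2" by (metis card_2_iff zero_neq_one)
  have bit2: "card (UNIV :: (bit \<times> bit) set) = 4"
    unfolding UNIV_Times_UNIV[symmetric] card_cartesian_product bit by simp
  note simps = card_image card_cartesian_product card_nonzero card_F card_K card_F_mod_Fq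
  show "card (chi6 ` ((F - {0}) \<times> UNIV)) = (q - 1) * q ^ 3"
    using inj_chi6 by (simp add: simps del: card_Diff_insert)
  show "card (chi5 ` ((F - {0}) \<times> F \<times> UNIV)) = (q - 1) * q ^ 4"
    using inj_chi5 by (simp add: simps flip: power_Suc)
  show "odd q \<Longrightarrow> card (chi4_odd ` ((UNIV - {0}) \<times> F)) = (q ^ 3 - 1) * q"
    using inj_chi4_odd by (simp add: simps)
  show "even q \<Longrightarrow> card (chi4_even ` (UNIV - {0})) = q ^ 3 - 1"
    using inj_chi4_even by (simp add: simps)
  show "even q \<Longrightarrow> card (chi4_half ` ((UNIV - {0}) \<times> (F - {0}) \<times> UNIV \<times> UNIV)) = 4 * (q ^ 3 - 1) * (q - 1)"
    using inj_chi4_half by (simp add: simps bit2)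
  show "card (chi3 ` ((UNIV - {0}) \<times> F_mod_Fq q)) = (q ^ 3 - 1) * q ^ 2"
    using inj_chi3 by (simp add: simps)
  show "card (chi_lin ` (UNIV \<times> F)) = q ^ 4"
    using inj_chi_lin by (simp add: simps flip: power_Suc2)
qed

lemma sum_squares_monomial:
  assumes "\<And>\<chi>. \<chi> \<in> X \<Longrightarrow> monomial d \<chi>"
  shows "(\<Sum>\<chi>\<in>X. (\<chi> \<one>\<^bsub>U\<^esub>)\<^sup>2) = of_nat (card X) * d\<^sup>2"
proof -
  have "(\<Sum>\<chi>\<in>X. (\<chi> \<one>\<^bsub>U\<^esub>)\<^sup>2) = (\<Sum>\<chi>\<in>X. d\<^sup>2)"
    by (intro sum.cong refl) (simp only: monomialD(2)[OF assms])
  then show ?thesis by simp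
qed

text \<open>  The two shapes of the family that is nontrivial on \<open>Y\<^sub>4\<close> enter only through a set \<open>X4\<close> whose squared
  degrees add up to \<open>(q\<^sup>3 - 1) q\<^sup>7\<close>.  The identity behind the count is
  \<open>(q - 1) q\<^sup>1\<^sup>1 + (q - 1) q\<^sup>1\<^sup>0 + (q\<^sup>3 - 1) q\<^sup>7 + (q\<^sup>3 - 1) q\<^sup>4 + q\<^sup>4 = q\<^sup>1\<^sup>2\<close>.  As the families are disjoint and every
  list lies in its family, equality with the whole of \<^term>\<open>Irr U\<close> forces equality in each family.\<close>

lemma families_complete:
  assumes X4: "finite X4" "\<And>\<chi>. \<chi> \<in> X4 \<Longrightarrow> (\<exists>d. monomial d \<chi>) \<and> \<chi> \<in> famU4"
    and sum4: "(\<Sum>\<chi>\<in>X4. (\<chi> \<one>\<^bsub>U\<^esub>)\<^sup>2) = (of_nat q ^ 3 - 1) * of_nat q ^ 7"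
  shows "Irr U = famU6 \<union> famU5 \<union> famU4 \<union> famU3 \<union> famU_lin"
    and "famU6 = chi6 ` ((F - {0}) \<times> UNIV)" "famU5 = chi5 ` ((F - {0}) \<times> F \<times> UNIV)" "famU4 = X4"
    and "famU3 = chi3 ` ((UNIV - {0}) \<times> F_mod_Fq q)" "famU_lin = chi_lin ` (UNIV \<times> F)"
proof -
  define X6 where "X6 = chi6 ` ((F - {0}) \<times> UNIV)"
  define X5 where "X5 = chi5 ` ((F - {0}) \<times> F \<times> UNIV)"
  define X3 where "X3 = chi3 ` ((UNIV - {0}) \<times> F_mod_Fq q)"
  define X1 where "X1 = chi_lin ` (UNIV \<times> F)"
  have m6: "\<chi> \<in> X6 \<Longrightarrow> monomial (of_nat (q ^ 4)) \<chi> \<and> \<chi> \<in> famU6" for \<chi> unfolding X6_def by (rule chi_families)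
  have m5: "\<chi> \<in> X5 \<Longrightarrow> monomial (of_nat (q ^ 3)) \<chi> \<and> \<chi> \<in> famU5" for \<chi> unfolding X5_def by (rule chi_families)
  have m3: "\<chi> \<in> X3 \<Longrightarrow> monomial (of_nat q) \<chi> \<and> \<chi> \<in> famU3" for \<chi> unfolding X3_def by (rule chi_families)
  have m1: "\<chi> \<in> X1 \<Longrightarrow> monomial 1 \<chi> \<and> \<chi> \<in> famU_lin" for \<chi> unfolding X1_def by (rule chi_families)
  have fin: "finite X6" "finite X5" "finite X3" "finite X1"
    unfolding X6_def X5_def X3_def X1_def by (auto intro!: finite_imageI)
  have sub: "X6 \<subseteq> famU6" "X5 \<subseteq> famU5" "X4 \<subseteq> famU4" "X3 \<subseteq> famU3" "X1 \<subseteq> famU_lin"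
    using m6 m5 X4 m3 m1 by auto
  let ?L = "X6 \<union> X5 \<union> X4 \<union> X3 \<union> X1"
  let ?S = "\<lambda>X. \<Sum>\<chi>\<in>X. (\<chi> \<one>\<^bsub>U\<^esub>)\<^sup>2"
  have mono: "\<exists>d. monomial d \<chi>" if "\<chi> \<in> ?L" for \<chi> using that m6 m5 X4(2) m3 m1 by blast
  have q1: "of_nat (q - 1) = (of_nat q - 1 :: complex)" "of_nat (q ^ 3 - 1) = (of_nat q ^ 3 - 1 :: complex)"
    using q_ge_2 by (simp_all add: of_nat_diff)
  have "?S ?L = ?S X6 + ?S X5 + ?S X4 + ?S X3 + ?S X1"
  proof -
    have "(X6 \<union> X5 \<union> X4 \<union> X3) \<inter> X1 = {}" using sub famU_disjoint(4,7,9,10) by blast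
    moreover have "(X6 \<union> X5 \<union> X4) \<inter> X3 = {}" using sub(1-4) famU_disjoint(3,6,8) by blast
    moreover have "(X6 \<union> X5) \<inter> X4 = {}" "X6 \<inter> X5 = {}"
      using sub(1-3) famU_disjoint(1,2,5) by blast+
    ultimately show ?thesis using fin X4(1) by (simp add: sum.union_disjoint)
  qed
  also have "\<dots> = of_nat q ^ 12"
  proof -
    have "?S X6 = (of_nat q - 1) * of_nat q ^ 3 * (of_nat q ^ 4)\<^sup>2"
      using sum_squares_monomial[of X6 "of_nat (q ^ 4)"] m6 card_chi(1) q1 by (simp add: X6_def)
    moreover have "?S X5 = (of_nat q - 1) * of_nat q ^ 4 * (of_nat q ^ 3)\<^sup>2"
      using sum_squares_monomial[of X5 "of_nat (q ^ 3)"] m5 card_chi(2) q1 by (simp add: X5_def)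
    moreover have "?S X3 = (of_nat q ^ 3 - 1) * of_nat q ^ 2 * (of_nat q)\<^sup>2"
      using sum_squares_monomial[of X3 "of_nat q"] m3 card_chi(6) q1 by (simp add: X3_def)
    moreover have "?S X1 = of_nat q ^ 4"
      using sum_squares_monomial[of X1 1] m1 card_chi(7) by (simp add: X1_def)
    ultimately have "?S X6 + ?S X5 + ?S X4 + ?S X3 + ?S X1 =
      (of_nat q - 1) * of_nat q ^ 3 * (of_nat q ^ 4)\<^sup>2 + (of_nat q - 1) * of_nat q ^ 4 * (of_nat q ^ 3)\<^sup>2
      + (of_nat q ^ 3 - 1) * of_nat q ^ 7 + (of_nat q ^ 3 - 1) * of_nat q ^ 2 * (of_nat q)\<^sup>2 + of_nat q ^ 4"
      using sum4 by simp
    also have "\<dots> = of_nat q ^ 12" by (simp add: algebra_simps eval_nat_numeral)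
    finally show ?thesis .
  qed
  finally have squares: "?S ?L = of_nat (card (carrier U))" by (simp add: card_U)
  have irr: "Irr U = ?L"
  proof (rule group.Irr_eqI_sum_of_squares[OF group_U _ _ _ _ _ squares])
    show "finite (carrier U)" by (simp add: finite_subset[OF subset_UNIV])
    show "?L \<subseteq> Irr U" using mono monomialD(1) by blast
    show "finite ?L" using fin X4 by simp
    show "\<chi> (inv\<^bsub>U\<^esub> g) = cnj (\<chi> g)" if "\<chi> \<in> ?L" "g \<in> carrier U" for \<chi> g
      using mono[OF that(1)] monomialD(3) that(2) by blast
    show "(\<Sum>g\<in>carrier U. \<chi> g * \<chi> (inv\<^bsub>U\<^esub> g)) = of_nat (card (carrier U))" if "\<chi> \<in> ?L" for \<chi>
      using mono[OF that(1)] monomialD(4) by blast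
  qed
  have famI: "famU6 \<subseteq> Irr U" "famU5 \<subseteq> Irr U" "famU4 \<subseteq> Irr U" "famU3 \<subseteq> Irr U" "famU_lin \<subseteq> Irr U"
    unfolding famU_defs by auto
  show "Irr U = famU6 \<union> famU5 \<union> famU4 \<union> famU3 \<union> famU_lin" using irr sub famI by blast
  have "famU6 = X6" using irr sub famI(1) famU_disjoint(1-4) by blast
  moreover have "famU5 = X5" using irr sub famI(2) famU_disjoint(1,5-7) by blast
  moreover have "famU4 = X4" using irr sub famI(3) famU_disjoint(2,5,8,9) by blast
  moreover have "famU3 = X3" using irr sub famI(4) famU_disjoint(3,6,8,10) by blast
  moreover have "famU_lin = X1" using irr sub famI(5) famU_disjoint(4,7,9,10) by blast
  ultimately show "famU6 = chi6 ` ((F - {0}) \<times> UNIV)" "famU5 = chi5 ` ((F - {0}) \<times> F \<times> UNIV)" "famU4 = X4"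
    "famU3 = chi3 ` ((UNIV - {0}) \<times> F_mod_Fq q)" "famU_lin = chi_lin ` (UNIV \<times> F)"
    by (simp_all add: X6_def X5_def X3_def X1_def)
qed

end


section \<open>Transport to the group of fixed points\<close>

definition pullback_character :: "('b, 'm) monoid_scheme \<Rightarrow> ('b \<Rightarrow> 'a) \<Rightarrow> ('a \<Rightarrow> complex) \<Rightarrow> 'b \<Rightarrow> complex" where
  "pullback_character B k \<chi> = (\<lambda>g\<in>carrier B. \<chi> (k g))"

lemma pullback_Irr:
  assumes "group A" "group B" "k \<in> iso B A" "\<chi> \<in> Irr A"
  shows "pullback_character B k \<chi> \<in> Irr B"
proof -
  interpret A: group A by fact
  interpret B: group B by fact
  have hom: "k \<in> hom B A" and bij: "bij_betw k (carrier B) (carrier A)" using assms(3) by (auto simp: iso_def)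
  have kc: "k g \<in> carrier A" if "g \<in> carrier B" for g using hom that by (rule hom_in_carrier)
  obtain n \<rho> where irr: "irreducible_rep A n \<rho>" and \<chi>: "\<chi> = (\<lambda>g\<in>carrier A. mat_trace (\<rho> g))"
    using assms(4) by (auto simp: Irr_def)
  note \<rho> = A.irreducible_repD[OF irr]
  have "irreducible_rep B n (\<lambda>g. \<rho> (k g))"
  proof (rule B.irreducible_repI)
    show "\<rho> (k \<one>\<^bsub>B\<^esub>) = 1\<^sub>m n" using \<rho>(4) hom_one[OF hom B.is_group A.is_group] by simp
    show "\<rho> (k (g \<otimes>\<^bsub>B\<^esub> h)) = \<rho> (k g) * \<rho> (k h)" if "g \<in> carrier B" "h \<in> carrier B" for g h
      using \<rho>(3) kc that hom_mult[OF hom that] by simp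
    fix W assume W: "VectorSpace.subspace class_ring W (module_vec TYPE(complex) n)"
      "\<And>g w. \<lbrakk>g \<in> carrier B; w \<in> W\<rbrakk> \<Longrightarrow> \<rho> (k g) *\<^sub>v w \<in> W"
    show "W = {0\<^sub>v n} \<or> W = carrier_vec n"
    proof (rule \<rho>(5)[OF W(1)])
      fix a w assume "a \<in> carrier A" "w \<in> W"
      then show "\<rho> a *\<^sub>v w \<in> W" using W(2) bij by (metis bij_betw_imp_surj_on imageE)
    qed
  qed (use \<rho>(1,2) kc in auto)
  moreover have "pullback_character B k \<chi> = (\<lambda>g\<in>carrier B. mat_trace (\<rho> (k g)))"
    using kc by (auto simp: pullback_character_def \<chi> intro!: restrict_ext)
  ultimately show ?thesis unfolding Irr_def by blast
qed

text \<open>  Irreducible characters are \<^const>\<open>undefined\<close> outside the carrier, so restricting the composition makes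
  pulling back along an isomorphism and along its inverse mutually inverse.\<close>

lemma bij_betw_pullback:
  assumes "group A" "group B" "k \<in> iso B A"
  shows "bij_betw (pullback_character B k) (Irr A) (Irr B)"
proof -
  let ?h = "inv_into (carrier B) k"
  have h: "?h \<in> iso A B" using group.iso_set_sym[OF assms(2,3)] .
  have bij: "bij_betw k (carrier B) (carrier A)" using assms(3) by (simp add: iso_def)
  have ext: "\<chi> = (\<lambda>g\<in>carrier C. \<chi> g)" if "\<chi> \<in> Irr C" for \<chi> :: "'z \<Rightarrow> complex" and C :: "('z, 'w) monoid_scheme"
    using that by (auto simp: Irr_def)
  show ?thesis
  proof (rule bij_betw_byWitness[of _ "pullback_character A ?h"])
    show "\<forall>\<chi>\<in>Irr A. pullback_character A ?h (pullback_character B k \<chi>) = \<chi>"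
    proof
      fix \<chi> assume \<chi>: "\<chi> \<in> Irr A"
      have "pullback_character A ?h (pullback_character B k \<chi>) = (\<lambda>g\<in>carrier A. \<chi> g)"
        using bij bij_betw_inv_into_right[OF bij] bij_betw_apply[OF bij_betw_inv_into[OF bij]]
        by (auto simp: pullback_character_def intro!: restrict_ext)
      then show "pullback_character A ?h (pullback_character B k \<chi>) = \<chi>" using ext[OF \<chi>] by simp
    qed
    show "\<forall>\<chi>\<in>Irr B. pullback_character B k (pullback_character A ?h \<chi>) = \<chi>"
    proof
      fix \<chi> assume \<chi>: "\<chi> \<in> Irr B"
      have "pullback_character B k (pullback_character A ?h \<chi>) = (\<lambda>g\<in>carrier B. \<chi> g)"
        using bij bij_betw_inv_into_left[OF bij] bij_betw_apply[OF bij]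
        by (auto simp: pullback_character_def intro!: restrict_ext)
      then show "pullback_character B k (pullback_character A ?h \<chi>) = \<chi>" using ext[OF \<chi>] by simp
    qed
    show "pullback_character B k ` Irr A \<subseteq> Irr B" using pullback_Irr[OF assms] by blast
    show "pullback_character A ?h ` Irr B \<subseteq> Irr A" using pullback_Irr[OF assms(2,1) h] by blast
  qed
qed

lemma bij_betw_restrict_filter:
  assumes "bij_betw f A B" "\<And>x. x \<in> A \<Longrightarrow> Q (f x) \<longleftrightarrow> P x"
  shows "bij_betw f {x \<in> A. P x} {y \<in> B. Q y}"
  by (rule bij_betw_subset[OF assms(1)]) (use assms in \<open>auto simp: bij_betw_def\<close>)

context triality_group
begin

lemma group_fixed: "group (U3D4 G \<sigma>)"
proof -
  have iso: "\<sigma> \<in> iso G G" using triality by (simp add: is_triality_def)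
  interpret h: group_hom G G \<sigma> using iso by unfold_locales (auto simp: iso_def)
  have "subgroup {g \<in> carrier G. \<sigma> g = g} G"
    by (rule subgroupI) (use h.hom_inv in \<open>auto intro!: exI[of _ "\<one>\<^bsub>G\<^esub>"]\<close>)
  then show ?thesis unfolding U3D4_def by (rule subgroup.subgroup_is_group[OF _ is_group])
qed

definition coords :: "'g \<Rightarrow> 'f ucoords" where "coords = inv_into ucarrier emb"

lemma coords_iso: "coords \<in> iso (U3D4 G \<sigma>) U"
  using group.iso_set_sym[OF group_U emb_iso] by (simp add: coords_def U_simps)

lemma coords_emb: "u \<in> ucarrier \<Longrightarrow> coords (emb u) = u"
  unfolding coords_def using emb_bij by (intro inv_into_f_f) (auto simp: bij_betw_def)

abbreviation pull :: "('f ucoords \<Rightarrow> complex) \<Rightarrow> 'g \<Rightarrow> complex" where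
  "pull \<equiv> pullback_character (U3D4 G \<sigma>) coords"

lemma bij_pull: "bij_betw pull (Irr U) (Irr (U3D4 G \<sigma>))"
  by (rule bij_betw_pullback[OF group_U group_fixed coords_iso])

lemma coords_one: "coords \<one>\<^bsub>U3D4 G \<sigma>\<^esub> = \<one>\<^bsub>U\<^esub>"
  using hom_one[OF _ group_fixed group_U] coords_iso by (auto simp: iso_def)

lemma degree_pull: "char_degree (U3D4 G \<sigma>) (pull \<chi>) = \<chi> \<one>\<^bsub>U\<^esub>"
  using group.is_monoid[OF group_fixed] coords_one
  by (simp add: char_degree_def pullback_character_def monoid.one_closed)

lemma kernel_pull:
  assumes "Z \<subseteq> ucarrier"
  shows "emb ` Z \<subseteq> char_ker (U3D4 G \<sigma>) (pull \<chi>) \<longleftrightarrow> Z \<subseteq> char_ker U \<chi>"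
proof -
  have "emb z \<in> char_ker (U3D4 G \<sigma>) (pull \<chi>) \<longleftrightarrow> z \<in> char_ker U \<chi>" if z: "z \<in> Z" for z
  proof -
    have "z \<in> ucarrier" using z assms by blast
    moreover from this have "emb z \<in> carrier (U3D4 G \<sigma>)" using emb_bij by (auto simp: bij_betw_def)
    moreover have "pull \<chi> \<one>\<^bsub>U3D4 G \<sigma>\<^esub> = \<chi> \<one>\<^bsub>U\<^esub>" using degree_pull by (simp add: char_degree_def)
    ultimately show ?thesis
      by (simp add: char_ker_def pullback_character_def coords_emb U_simps(1))
  qed
  then show ?thesis by blast
qed

lemma emb_set_mult:
  assumes "A \<subseteq> ucarrier" "B \<subseteq> ucarrier" "C = (\<lambda>(u, v). umult u v) ` (A \<times> B)"
  shows "emb ` A <#>\<^bsub>G\<^esub> emb ` B = emb ` C"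
proof -
  have "emb u \<otimes>\<^bsub>G\<^esub> emb v = emb (umult u v)" if "u \<in> A" "v \<in> B" for u v
    using emb_mult that assms by (metis subsetD)
  then show ?thesis unfolding set_mult_def assms(3) by force
qed

lemma Z_carrier: "Z3 \<subseteq> ucarrier" "Z4 \<subseteq> ucarrier" "Z5 \<subseteq> ucarrier" "Z6 \<subseteq> ucarrier"
  "Z56 \<subseteq> ucarrier" "Z456 \<subseteq> ucarrier" "Z3456 \<subseteq> ucarrier"
  unfolding Z_defs ucarrier_def by auto

lemma umult_low: "umult (0, 0, b, c, d, e) (0, 0, 0, C, D, E) = (0, 0, b, c + C, d + D, e + E)"
  by (simp add: umult_def)

lemma Y_products:
  "Y3 G x q = emb ` Z3" "Y4 G x q = emb ` Z4" "Y5 x q = emb ` Z5" "Y6 x q = emb ` Z6"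
  "Y5 x q <#>\<^bsub>G\<^esub> Y6 x q = emb ` Z56"
  "Y4 G x q <#>\<^bsub>G\<^esub> Y5 x q <#>\<^bsub>G\<^esub> Y6 x q = emb ` Z456"
  "Y3 G x q <#>\<^bsub>G\<^esub> Y4 G x q <#>\<^bsub>G\<^esub> Y5 x q <#>\<^bsub>G\<^esub> Y6 x q = emb ` Z3456"
proof -
  show Y: "Y3 G x q = emb ` Z3" "Y4 G x q = emb ` Z4" "Y5 x q = emb ` Z5" "Y6 x q = emb ` Z6"
    unfolding Z_defs by (rule emb_Y)+
  define Z45 :: "'f ucoords set" where "Z45 = {0} \<times> {0} \<times> {0} \<times> UNIV \<times> F \<times> {0}"
  define Z34 :: "'f ucoords set" where "Z34 = {0} \<times> {0} \<times> UNIV \<times> UNIV \<times> {0} \<times> {0}"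
  define Z345 :: "'f ucoords set" where "Z345 = {0} \<times> {0} \<times> UNIV \<times> UNIV \<times> F \<times> {0}"
  have carr: "Z45 \<subseteq> ucarrier" "Z34 \<subseteq> ucarrier" "Z345 \<subseteq> ucarrier"
    unfolding Z45_def Z34_def Z345_def ucarrier_def by auto
  have split:
    "\<lbrakk>(0, 0, b, c, d, 0) \<in> A; (0, 0, 0, 0, 0, e) \<in> B\<rbrakk> \<Longrightarrow> (0, 0, b, c, d, e) \<in> (\<lambda>(u, v). umult u v) ` (A \<times> B)"
    "\<lbrakk>(0, 0, b, c, 0, 0) \<in> A; (0, 0, 0, 0, d, 0) \<in> B\<rbrakk> \<Longrightarrow> (0, 0, b, c, d, 0) \<in> (\<lambda>(u, v). umult u v) ` (A \<times> B)"
    "\<lbrakk>(0, 0, b, 0, 0, 0) \<in> A; (0, 0, 0, c, 0, 0) \<in> B\<rbrakk> \<Longrightarrow> (0, 0, b, c, 0, 0) \<in> (\<lambda>(u, v). umult u v) ` (A \<times> B)"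
    for b c d e A B
    using umult_low[of b c d 0 0 0 e] umult_low[of b c 0 0 0 d 0] umult_low[of b 0 0 0 c 0 0]
    by (force simp: image_iff)+
  have P56: "Z56 = (\<lambda>(u, v). umult u v) ` (Z5 \<times> Z6)"
    by (auto simp: Z_defs umult_low intro!: split(1))
  have P45: "Z45 = (\<lambda>(u, v). umult u v) ` (Z4 \<times> Z5)"
    by (auto simp: Z_defs Z45_def umult_low intro!: split(2))
  have P456: "Z456 = (\<lambda>(u, v). umult u v) ` (Z45 \<times> Z6)"
    by (auto simp: Z_defs Z45_def umult_low intro!: split(1))
  have P34: "Z34 = (\<lambda>(u, v). umult u v) ` (Z3 \<times> Z4)"
    by (auto simp: Z_defs Z34_def umult_low intro!: split(3))
  have P345: "Z345 = (\<lambda>(u, v). umult u v) ` (Z34 \<times> Z5)"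
    by (auto simp: Z_defs Z34_def Z345_def umult_low intro!: split(2))
  have P3456: "Z3456 = (\<lambda>(u, v). umult u v) ` (Z345 \<times> Z6)"
    by (auto simp: Z_defs Z345_def umult_low intro!: split(1))
  note c = Z_carrier carr
  show "Y5 x q <#>\<^bsub>G\<^esub> Y6 x q = emb ` Z56"
    unfolding Y by (rule emb_set_mult[OF c(3,4) P56])
  show "Y4 G x q <#>\<^bsub>G\<^esub> Y5 x q <#>\<^bsub>G\<^esub> Y6 x q = emb ` Z456"
    unfolding Y emb_set_mult[OF c(2,3) P45] by (rule emb_set_mult[OF c(8,4) P456])
  show "Y3 G x q <#>\<^bsub>G\<^esub> Y4 G x q <#>\<^bsub>G\<^esub> Y5 x q <#>\<^bsub>G\<^esub> Y6 x q = emb ` Z3456"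
    unfolding Y emb_set_mult[OF c(1,2) P34] emb_set_mult[OF c(9,3) P345]
    by (rule emb_set_mult[OF c(10,4) P3456])
qed

lemma bij_pull_families:
  "bij_betw pull famU6 (fam6 G x q \<sigma>)" "bij_betw pull famU5 (fam5 G x q \<sigma>)"
  "bij_betw pull famU4 (fam4 G x q \<sigma>)" "bij_betw pull famU3 (fam3 G x q \<sigma>)"
  "bij_betw pull famU_lin (fam_lin G x q \<sigma>)"
  unfolding famU_defs fam6_def fam5_def fam4_def fam3_def fam_lin_def Y_products(5-7) unfolding Y_products(1-4)
  by (rule bij_betw_restrict_filter[OF bij_pull]; simp add: kernel_pull Z_carrier)+

end


section \<open>The classification\<close>

context triality_field
begin

lemma odd_family_4:
  assumes "odd q"
  defines "X \<equiv> chi4_odd ` ((UNIV - {0}) \<times> F)"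
  shows "finite X" "\<And>\<chi>. \<chi> \<in> X \<Longrightarrow> (\<exists>d. monomial d \<chi>) \<and> \<chi> \<in> famU4"
    and "(\<Sum>\<chi>\<in>X. (\<chi> \<one>\<^bsub>U\<^esub>)\<^sup>2) = (of_nat q ^ 3 - 1) * of_nat q ^ 7"
proof -
  show "finite X" unfolding X_def by (intro finite_imageI) simp
  have mon: "monomial (of_nat (q ^ 3)) \<chi> \<and> \<chi> \<in> famU4" if "\<chi> \<in> X" for \<chi>
    using chi_families(3)[OF assms(1)] that unfolding X_def by blast
  then show "\<And>\<chi>. \<chi> \<in> X \<Longrightarrow> (\<exists>d. monomial d \<chi>) \<and> \<chi> \<in> famU4" by blast
  have "(\<Sum>\<chi>\<in>X. (\<chi> \<one>\<^bsub>U\<^esub>)\<^sup>2) = of_nat ((q ^ 3 - 1) * q) * (of_nat (q ^ 3))\<^sup>2"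
    using sum_squares_monomial[of X "of_nat (q ^ 3)"] mon card_chi(3)[OF assms(1)] by (simp add: X_def)
  then show "(\<Sum>\<chi>\<in>X. (\<chi> \<one>\<^bsub>U\<^esub>)\<^sup>2) = (of_nat q ^ 3 - 1) * of_nat q ^ 7"
    using q_ge_2 by (simp add: of_nat_diff eval_nat_numeral)
qed

lemma even_family_4:
  assumes "even q"
  defines "X \<equiv> chi4_even ` (UNIV - {0})"
    and "Y \<equiv> chi4_half ` ((UNIV - {0}) \<times> (F - {0}) \<times> UNIV \<times> UNIV)"
  shows "finite (X \<union> Y)" "\<And>\<chi>. \<chi> \<in> X \<union> Y \<Longrightarrow> (\<exists>d. monomial d \<chi>) \<and> \<chi> \<in> famU4"
    and "(\<Sum>\<chi>\<in>X \<union> Y. (\<chi> \<one>\<^bsub>U\<^esub>)\<^sup>2) = (of_nat q ^ 3 - 1) * of_nat q ^ 7"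
    and "{\<chi> \<in> X \<union> Y. \<chi> \<one>\<^bsub>U\<^esub> = of_nat (q ^ 3)} = X" "{\<chi> \<in> X \<union> Y. \<chi> \<one>\<^bsub>U\<^esub> = of_nat (q ^ 3) / 2} = Y"
proof -
  have "finite (UNIV :: bit set)" by (rule finite_subset[of _ "{0, 1}"]) (use bit_not_zero_iff in blast, simp)
  then have "finite (UNIV :: (bit \<times> bit) set)" by (metis UNIV_Times_UNIV finite_cartesian_product)
  then have fin: "finite X" "finite Y" unfolding X_def Y_def
    by (auto intro!: finite_imageI finite_cartesian_product)
  then show "finite (X \<union> Y)" by simp
  have X: "monomial (of_nat (q ^ 3)) \<chi> \<and> \<chi> \<in> famU4" if "\<chi> \<in> X" for \<chi>
    using chi_families(4)[OF assms(1)] that unfolding X_def by blast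
  have Y: "monomial (of_nat (q ^ 3) / 2) \<chi> \<and> \<chi> \<in> famU4" if "\<chi> \<in> Y" for \<chi>
    using chi_families(5)[OF assms(1)] that unfolding Y_def by blast
  show "\<And>\<chi>. \<chi> \<in> X \<union> Y \<Longrightarrow> (\<exists>d. monomial d \<chi>) \<and> \<chi> \<in> famU4" using X Y by blast
  have ne: "(of_nat (q ^ 3) :: complex) \<noteq> of_nat (q ^ 3) / 2" using q_ge_2 by simp
  have degX: "\<chi> \<one>\<^bsub>U\<^esub> = of_nat (q ^ 3)" if "\<chi> \<in> X" for \<chi> using X[OF that] monomialD(2) by blast
  have degY: "\<chi> \<one>\<^bsub>U\<^esub> = of_nat (q ^ 3) / 2" if "\<chi> \<in> Y" for \<chi> using Y[OF that] monomialD(2) by blast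
  show "{\<chi> \<in> X \<union> Y. \<chi> \<one>\<^bsub>U\<^esub> = of_nat (q ^ 3)} = X"
    by (rule Set.set_eqI) (metis (mono_tags, lifting) UnE UnI1 mem_Collect_eq degX degY ne)
  show "{\<chi> \<in> X \<union> Y. \<chi> \<one>\<^bsub>U\<^esub> = of_nat (q ^ 3) / 2} = Y"
    by (rule Set.set_eqI) (metis (mono_tags, lifting) UnE UnI2 mem_Collect_eq degX degY ne)
  have "X \<inter> Y = {}"
  proof (rule equals0I)
    fix \<chi> assume "\<chi> \<in> X \<inter> Y"
    then show False using degX[of \<chi>] degY[of \<chi>] ne by simp
  qed
  then have "(\<Sum>\<chi>\<in>X \<union> Y. (\<chi> \<one>\<^bsub>U\<^esub>)\<^sup>2) = (\<Sum>\<chi>\<in>X. (\<chi> \<one>\<^bsub>U\<^esub>)\<^sup>2) + (\<Sum>\<chi>\<in>Y. (\<chi> \<one>\<^bsub>U\<^esub>)\<^sup>2)"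
    by (rule sum.union_disjoint[OF fin])
  also have "(\<Sum>\<chi>\<in>X. (\<chi> \<one>\<^bsub>U\<^esub>)\<^sup>2) = of_nat (q ^ 3 - 1) * (of_nat (q ^ 3))\<^sup>2"
    using sum_squares_monomial[of X "of_nat (q ^ 3)"] X card_chi(4)[OF assms(1)] unfolding X_def by (simp only:)
  also have "(\<Sum>\<chi>\<in>Y. (\<chi> \<one>\<^bsub>U\<^esub>)\<^sup>2) = of_nat (4 * (q ^ 3 - 1) * (q - 1)) * (of_nat (q ^ 3) / 2)\<^sup>2"
    using sum_squares_monomial[of Y "of_nat (q ^ 3) / 2"] Y card_chi(5)[OF assms(1)] unfolding Y_def by (simp only:)
  also have "of_nat (q ^ 3 - 1) * (of_nat (q ^ 3))\<^sup>2 + of_nat (4 * (q ^ 3 - 1) * (q - 1)) * (of_nat (q ^ 3) / 2)\<^sup>2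
     = ((of_nat q ^ 3 - 1) * of_nat q ^ 7 :: complex)"
  proof -
    have "of_nat (q - 1) = (of_nat q - 1 :: complex)" "of_nat (q ^ 3 - 1) = (of_nat q ^ 3 - 1 :: complex)"
      using q_ge_2 by (simp_all add: of_nat_diff)
    then have "of_nat (q ^ 3 - 1) * (of_nat (q ^ 3))\<^sup>2 + of_nat (4 * (q ^ 3 - 1) * (q - 1)) * (of_nat (q ^ 3) / 2)\<^sup>2
     = (of_nat q ^ 3 - 1) * (of_nat q ^ 3)\<^sup>2 + 4 * (of_nat q ^ 3 - 1) * (of_nat q - 1) * (of_nat q ^ 3 / 2 :: complex)\<^sup>2"
      by (simp only: of_nat_mult of_nat_power of_nat_numeral)
    also have "\<dots> = (of_nat q ^ 3 - 1) * of_nat q ^ 7" by (simp add: field_simps eval_nat_numeral)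
    finally show ?thesis .
  qed
  finally show "(\<Sum>\<chi>\<in>X \<union> Y. (\<chi> \<one>\<^bsub>U\<^esub>)\<^sup>2) = (of_nat q ^ 3 - 1) * of_nat q ^ 7" .
qed

lemma Irr_U_classification:
  "Irr U = famU6 \<union> famU5 \<union> famU4 \<union> famU3 \<union> famU_lin"
  "bij_betw chi6 ((F - {0}) \<times> UNIV) famU6"
  "bij_betw chi5 ((F - {0}) \<times> F \<times> UNIV) famU5"
  "odd q \<Longrightarrow> bij_betw chi4_odd ((UNIV - {0}) \<times> F) famU4"
  "even q \<Longrightarrow> bij_betw chi4_even (UNIV - {0}) {\<chi> \<in> famU4. \<chi> \<one>\<^bsub>U\<^esub> = of_nat (q ^ 3)}"
  "even q \<Longrightarrow> bij_betw chi4_half ((UNIV - {0}) \<times> (F - {0}) \<times> UNIV \<times> UNIV) {\<chi> \<in> famU4. \<chi> \<one>\<^bsub>U\<^esub> = of_nat (q ^ 3) / 2}"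
  "bij_betw chi3 ((UNIV - {0}) \<times> F_mod_Fq q) famU3"
  "bij_betw chi_lin (UNIV \<times> F) famU_lin"
proof -
  have C: "Irr U = famU6 \<union> famU5 \<union> famU4 \<union> famU3 \<union> famU_lin \<and>
    famU6 = chi6 ` ((F - {0}) \<times> UNIV) \<and> famU5 = chi5 ` ((F - {0}) \<times> F \<times> UNIV) \<and>
    famU3 = chi3 ` ((UNIV - {0}) \<times> F_mod_Fq q) \<and> famU_lin = chi_lin ` (UNIV \<times> F)"
  proof (cases "odd q")
    case True
    note FC = families_complete[OF odd_family_4[OF True]]
    show ?thesis by (intro conjI FC(1,2,3,5,6))
  next
    case False
    then have even: "even q" by simp
    note FC = families_complete[OF even_family_4(1-3)[OF even]]
    show ?thesis by (intro conjI FC(1,2,3,5,6))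
  qed
  show "Irr U = famU6 \<union> famU5 \<union> famU4 \<union> famU3 \<union> famU_lin" using C by (elim conjE)
  show "bij_betw chi6 ((F - {0}) \<times> UNIV) famU6" using inj_chi6 C by (simp add: bij_betw_def)
  show "bij_betw chi5 ((F - {0}) \<times> F \<times> UNIV) famU5" using inj_chi5 C by (simp add: bij_betw_def)
  show "bij_betw chi3 ((UNIV - {0}) \<times> F_mod_Fq q) famU3" using inj_chi3 C by (simp add: bij_betw_def)
  show "bij_betw chi_lin (UNIV \<times> F) famU_lin" using inj_chi_lin C by (simp add: bij_betw_def)
  show "bij_betw chi4_odd ((UNIV - {0}) \<times> F) famU4" if odd: "odd q"
    using inj_chi4_odd[OF odd] families_complete(4)[OF odd_family_4[OF odd]] by (simp add: bij_betw_def)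
  assume even: "even q"
  note E = even_family_4[OF even]
  have fam4: "famU4 = chi4_even ` (UNIV - {0}) \<union> chi4_half ` ((UNIV - {0}) \<times> (F - {0}) \<times> UNIV \<times> UNIV)"
    by (rule families_complete(4)[OF E(1-3)])
  show "bij_betw chi4_even (UNIV - {0}) {\<chi> \<in> famU4. \<chi> \<one>\<^bsub>U\<^esub> = of_nat (q ^ 3)}"
    unfolding fam4 E(4) by (rule inj_on_imp_bij_betw[OF inj_chi4_even[OF even]])
  show "bij_betw chi4_half ((UNIV - {0}) \<times> (F - {0}) \<times> UNIV \<times> UNIV) {\<chi> \<in> famU4. \<chi> \<one>\<^bsub>U\<^esub> = of_nat (q ^ 3) / 2}"
    unfolding fam4 E(5) by (rule inj_on_imp_bij_betw[OF inj_chi4_half[OF even]])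
qed

lemma famU_degrees:
  "\<chi> \<in> famU6 \<Longrightarrow> \<chi> \<one>\<^bsub>U\<^esub> = of_nat (q ^ 4)"
  "\<chi> \<in> famU5 \<Longrightarrow> \<chi> \<one>\<^bsub>U\<^esub> = of_nat (q ^ 3)"
  "\<lbrakk>odd q; \<chi> \<in> famU4\<rbrakk> \<Longrightarrow> \<chi> \<one>\<^bsub>U\<^esub> = of_nat (q ^ 3)"
  "\<lbrakk>even q; \<chi> \<in> famU4\<rbrakk> \<Longrightarrow> \<chi> \<one>\<^bsub>U\<^esub> \<in> {of_nat (q ^ 3), of_nat (q ^ 3) / 2}"
  "\<chi> \<in> famU3 \<Longrightarrow> \<chi> \<one>\<^bsub>U\<^esub> = of_nat q"
  "\<chi> \<in> famU_lin \<Longrightarrow> \<chi> \<one>\<^bsub>U\<^esub> = 1"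
proof -
  note I = Irr_U_classification(2-8)[THEN bij_betw_imp_surj_on]
  show "\<chi> \<in> famU6 \<Longrightarrow> \<chi> \<one>\<^bsub>U\<^esub> = of_nat (q ^ 4)"
    using chi_families(1) monomialD(2) unfolding I(1)[symmetric] by blast
  show "\<chi> \<in> famU5 \<Longrightarrow> \<chi> \<one>\<^bsub>U\<^esub> = of_nat (q ^ 3)"
    using chi_families(2) monomialD(2) unfolding I(2)[symmetric] by blast
  show "\<lbrakk>odd q; \<chi> \<in> famU4\<rbrakk> \<Longrightarrow> \<chi> \<one>\<^bsub>U\<^esub> = of_nat (q ^ 3)"
    using chi_families(3) monomialD(2) I(3) by blast
  show "\<chi> \<in> famU3 \<Longrightarrow> \<chi> \<one>\<^bsub>U\<^esub> = of_nat q"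
    using chi_families(6) monomialD(2) unfolding I(6)[symmetric] by blast
  show "\<chi> \<in> famU_lin \<Longrightarrow> \<chi> \<one>\<^bsub>U\<^esub> = 1"
    using chi_families(7) monomialD(2) unfolding I(7)[symmetric] by blast
  assume even: "even q" and \<chi>: "\<chi> \<in> famU4"
  note E = even_family_4[OF even]
  have "famU4 = chi4_even ` (UNIV - {0}) \<union> chi4_half ` ((UNIV - {0}) \<times> (F - {0}) \<times> UNIV \<times> UNIV)"
    by (rule families_complete(4)[OF E(1-3)])
  with \<chi> have "\<chi> \<in> chi4_even ` (UNIV - {0}) \<union> chi4_half ` ((UNIV - {0}) \<times> (F - {0}) \<times> UNIV \<times> UNIV)"
    by (rule back_subst[of "\<lambda>X. \<chi> \<in> X"])
  then show "\<chi> \<one>\<^bsub>U\<^esub> \<in> {of_nat (q ^ 3), of_nat (q ^ 3) / 2}"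
  proof (rule UnE)
    assume "\<chi> \<in> chi4_even ` (UNIV - {0})"
    then show ?thesis using monomialD(2) chi_families(4)[OF even] by blast
  next
    assume "\<chi> \<in> chi4_half ` ((UNIV - {0}) \<times> (F - {0}) \<times> UNIV \<times> UNIV)"
    then show ?thesis using monomialD(2) chi_families(5)[OF even] by blast
  qed
qed

end

theorem theorem1p1:
  fixes p k q :: nat
    and G :: "('g, 'b) monoid_scheme"
    and x :: "nat \<Rightarrow> 'f::{field,finite} \<Rightarrow> 'g"
    and \<sigma> :: "'g \<Rightarrow> 'g"
  assumes "prime p" and "k \<ge> 1" and "q = p ^ k"
    and "card (UNIV :: 'f set) = q ^ 3"
    and "UD4 G x"
    and "is_triality G x q \<sigma>"
  shows
    "Irr (U3D4 G \<sigma>) =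
       fam6 G x q \<sigma> \<union> fam5 G x q \<sigma> \<union> fam4 G x q \<sigma> \<union> fam3 G x q \<sigma> \<union> fam_lin G x q \<sigma> \<and>
     sorted_wrt disjnt
       [fam6 G x q \<sigma>, fam5 G x q \<sigma>, fam4 G x q \<sigma>, fam3 G x q \<sigma>, fam_lin G x q \<sigma>] \<and>

     (\<exists>\<chi>6 :: 'f \<times> 'f \<Rightarrow> 'g \<Rightarrow> complex.
        bij_betw \<chi>6 ((Fq q - {0}) \<times> UNIV) (fam6 G x q \<sigma>)) \<and>
     card (fam6 G x q \<sigma>) = (q - 1) * q ^ 3 \<and>
     (\<forall>\<chi>\<in>fam6 G x q \<sigma>. char_degree (U3D4 G \<sigma>) \<chi> = of_nat (q ^ 4)) \<and>

     (\<exists>\<chi>5 :: 'f \<times> 'f \<times> 'f \<Rightarrow> 'g \<Rightarrow> complex.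
        bij_betw \<chi>5 ((Fq q - {0}) \<times> Fq q \<times> UNIV) (fam5 G x q \<sigma>)) \<and>
     card (fam5 G x q \<sigma>) = (q - 1) * q ^ 4 \<and>
     (\<forall>\<chi>\<in>fam5 G x q \<sigma>. char_degree (U3D4 G \<sigma>) \<chi> = of_nat (q ^ 3)) \<and>

     (odd q \<longrightarrow>
        (\<exists>\<chi>4 :: 'f \<times> 'f \<Rightarrow> 'g \<Rightarrow> complex.
           bij_betw \<chi>4 ((UNIV - {0}) \<times> Fq q) (fam4 G x q \<sigma>)) \<and>
        card (fam4 G x q \<sigma>) = (q ^ 3 - 1) * q \<and>
        (\<forall>\<chi>\<in>fam4 G x q \<sigma>. char_degree (U3D4 G \<sigma>) \<chi> = of_nat (q ^ 3))) \<and>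
     (even q \<longrightarrow>
        (\<exists>(\<chi>4 :: 'f \<Rightarrow> 'g \<Rightarrow> complex) (\<chi>4' :: 'f \<times> 'f \<times> bit \<times> bit \<Rightarrow> 'g \<Rightarrow> complex).
           bij_betw \<chi>4 (UNIV - {0})
             {\<chi> \<in> fam4 G x q \<sigma>. char_degree (U3D4 G \<sigma>) \<chi> = of_nat (q ^ 3)} \<and>
           bij_betw \<chi>4' ((UNIV - {0}) \<times> (Fq q - {0}) \<times> UNIV \<times> UNIV)
             {\<chi> \<in> fam4 G x q \<sigma>. char_degree (U3D4 G \<sigma>) \<chi> = of_nat (q ^ 3) / 2}) \<and>
        card {\<chi> \<in> fam4 G x q \<sigma>. char_degree (U3D4 G \<sigma>) \<chi> = of_nat (q ^ 3)} = q ^ 3 - 1 \<and>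
        card {\<chi> \<in> fam4 G x q \<sigma>. char_degree (U3D4 G \<sigma>) \<chi> = of_nat (q ^ 3) / 2} =
          4 * (q ^ 3 - 1) * (q - 1) \<and>
        (\<forall>\<chi>\<in>fam4 G x q \<sigma>. char_degree (U3D4 G \<sigma>) \<chi> \<in> {of_nat (q ^ 3), of_nat (q ^ 3) / 2})) \<and>

     (\<exists>\<chi>3 :: 'f \<times> 'f set \<Rightarrow> 'g \<Rightarrow> complex.
        bij_betw \<chi>3 ((UNIV - {0}) \<times> F_mod_Fq q) (fam3 G x q \<sigma>)) \<and>
     card (fam3 G x q \<sigma>) = (q ^ 3 - 1) * q ^ 2 \<and>
     (\<forall>\<chi>\<in>fam3 G x q \<sigma>. char_degree (U3D4 G \<sigma>) \<chi> = of_nat q) \<and>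

     (\<exists>\<chi>lin :: 'f \<times> 'f \<Rightarrow> 'g \<Rightarrow> complex.
        bij_betw \<chi>lin (UNIV \<times> Fq q) (fam_lin G x q \<sigma>)) \<and>
     card (fam_lin G x q \<sigma>) = q ^ 4 \<and>
     (\<forall>\<chi>\<in>fam_lin G x q \<sigma>. char_degree (U3D4 G \<sigma>) \<chi> = 1)"
proof -
  interpret triality_group p k q "TYPE('f)" G x \<sigma>
    using assms by (intro triality_group.intro triality_field.intro triality_group_axioms.intro)
  note C = Irr_U_classification and P = bij_pull_families
  let ?V = "U3D4 G \<sigma>"
  let ?deg = "char_degree ?V"
  have deg: "(\<forall>\<psi>\<in>B. Q (?deg \<psi>)) \<longleftrightarrow> (\<forall>\<chi>\<in>A. Q (\<chi> \<one>\<^bsub>U\<^esub>))" if "bij_betw pull A B" for A B Q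
    using bij_betw_imp_surj_on[OF that] degree_pull by auto
  have filter: "bij_betw pull {\<chi> \<in> famU4. \<chi> \<one>\<^bsub>U\<^esub> = d} {\<chi> \<in> fam4 G x q \<sigma>. ?deg \<chi> = d}" for d
    by (rule bij_betw_restrict_filter[OF P(3)]) (simp add: degree_pull)
  have pull_union: "pull ` (famU6 \<union> famU5 \<union> famU4 \<union> famU3 \<union> famU_lin) =
      fam6 G x q \<sigma> \<union> fam5 G x q \<sigma> \<union> fam4 G x q \<sigma> \<union> fam3 G x q \<sigma> \<union> fam_lin G x q \<sigma>"
    unfolding image_Un P[THEN bij_betw_imp_surj_on] ..
  then have irr: "Irr ?V = fam6 G x q \<sigma> \<union> fam5 G x q \<sigma> \<union> fam4 G x q \<sigma> \<union> fam3 G x q \<sigma> \<union> fam_lin G x q \<sigma>"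
    using bij_betw_imp_surj_on[OF bij_pull] unfolding C(1) by simp
  have inj: "inj_on pull (Irr U)" using bij_pull by (rule bij_betw_imp_inj_on)
  have disj: "disjnt (pull ` A) (pull ` B)" if "A \<inter> B = {}" "A \<subseteq> Irr U" "B \<subseteq> Irr U" for A B
    using inj_on_image_Int[OF inj that(2,3)] that(1) by (simp add: disjnt_def)
  have sub: "famU6 \<subseteq> Irr U" "famU5 \<subseteq> Irr U" "famU4 \<subseteq> Irr U" "famU3 \<subseteq> Irr U" "famU_lin \<subseteq> Irr U"
    unfolding C(1) by auto
  have disjoint: "sorted_wrt disjnt [fam6 G x q \<sigma>, fam5 G x q \<sigma>, fam4 G x q \<sigma>, fam3 G x q \<sigma>, fam_lin G x q \<sigma>]"
    unfolding P[THEN bij_betw_imp_surj_on, symmetric]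
    by (simp add: disj[OF famU_disjoint(1) sub(1,2)] disj[OF famU_disjoint(2) sub(1,3)]
        disj[OF famU_disjoint(3) sub(1,4)] disj[OF famU_disjoint(4) sub(1,5)] disj[OF famU_disjoint(5) sub(2,3)]
        disj[OF famU_disjoint(6) sub(2,4)] disj[OF famU_disjoint(7) sub(2,5)] disj[OF famU_disjoint(8) sub(3,4)]
        disj[OF famU_disjoint(9) sub(3,5)] disj[OF famU_disjoint(10) sub(4,5)])
  have card: "card B = card (f ` I)" if "bij_betw f I A" "bij_betw pull A B" for f :: "'i \<Rightarrow> _" and I A B
    using bij_betw_same_card[OF that(2)] bij_betw_imp_surj_on[OF that(1)] by simp
  note B6 = bij_betw_trans[OF C(2) P(1)] card[OF C(2) P(1), unfolded card_chi]
  note B5 = bij_betw_trans[OF C(3) P(2)] card[OF C(3) P(2), unfolded card_chi]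
  note B3 = bij_betw_trans[OF C(7) P(4)] card[OF C(7) P(4), unfolded card_chi]
  note B1 = bij_betw_trans[OF C(8) P(5)] card[OF C(8) P(5), unfolded card_chi]
  have odd: "(\<exists>\<chi>4 :: 'f \<times> 'f \<Rightarrow> 'g \<Rightarrow> complex. bij_betw \<chi>4 ((UNIV - {0}) \<times> Fq q) (fam4 G x q \<sigma>)) \<and>
        card (fam4 G x q \<sigma>) = (q ^ 3 - 1) * q \<and> (\<forall>\<chi>\<in>fam4 G x q \<sigma>. ?deg \<chi> = of_nat (q ^ 3))" if "odd q"
    using bij_betw_trans[OF C(4)[OF that] P(3)] card[OF C(4)[OF that] P(3), unfolded card_chi(3)[OF that]]
      deg[OF P(3), of "\<lambda>d. d = of_nat (q ^ 3)"] famU_degrees(3)[OF that] by blast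
  have even: "(\<exists>(\<chi>4 :: 'f \<Rightarrow> 'g \<Rightarrow> complex) (\<chi>4' :: 'f \<times> 'f \<times> bit \<times> bit \<Rightarrow> 'g \<Rightarrow> complex).
           bij_betw \<chi>4 (UNIV - {0}) {\<chi> \<in> fam4 G x q \<sigma>. ?deg \<chi> = of_nat (q ^ 3)} \<and>
           bij_betw \<chi>4' ((UNIV - {0}) \<times> (Fq q - {0}) \<times> UNIV \<times> UNIV)
             {\<chi> \<in> fam4 G x q \<sigma>. ?deg \<chi> = of_nat (q ^ 3) / 2}) \<and>
        card {\<chi> \<in> fam4 G x q \<sigma>. ?deg \<chi> = of_nat (q ^ 3)} = q ^ 3 - 1 \<and>
        card {\<chi> \<in> fam4 G x q \<sigma>. ?deg \<chi> = of_nat (q ^ 3) / 2} = 4 * (q ^ 3 - 1) * (q - 1) \<and>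
        (\<forall>\<chi>\<in>fam4 G x q \<sigma>. ?deg \<chi> \<in> {of_nat (q ^ 3), of_nat (q ^ 3) / 2})" if "even q"
  proof (intro conjI)
    show "\<exists>(\<chi>4 :: 'f \<Rightarrow> 'g \<Rightarrow> complex) (\<chi>4' :: 'f \<times> 'f \<times> bit \<times> bit \<Rightarrow> 'g \<Rightarrow> complex).
           bij_betw \<chi>4 (UNIV - {0}) {\<chi> \<in> fam4 G x q \<sigma>. ?deg \<chi> = of_nat (q ^ 3)} \<and>
           bij_betw \<chi>4' ((UNIV - {0}) \<times> (Fq q - {0}) \<times> UNIV \<times> UNIV)
             {\<chi> \<in> fam4 G x q \<sigma>. ?deg \<chi> = of_nat (q ^ 3) / 2}"
      using bij_betw_trans[OF C(5)[OF that] filter] bij_betw_trans[OF C(6)[OF that] filter] by blast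
    show "card {\<chi> \<in> fam4 G x q \<sigma>. ?deg \<chi> = of_nat (q ^ 3)} = q ^ 3 - 1"
      using card[OF C(5)[OF that] filter] card_chi(4)[OF that] by simp
    show "card {\<chi> \<in> fam4 G x q \<sigma>. ?deg \<chi> = of_nat (q ^ 3) / 2} = 4 * (q ^ 3 - 1) * (q - 1)"
      using card[OF C(6)[OF that] filter] card_chi(5)[OF that] by simp
    show "\<forall>\<chi>\<in>fam4 G x q \<sigma>. ?deg \<chi> \<in> {of_nat (q ^ 3), of_nat (q ^ 3) / 2}"
      using deg[OF P(3), of "\<lambda>d. d \<in> {of_nat (q ^ 3), of_nat (q ^ 3) / 2}"] famU_degrees(4)[OF that] by blast
  qed
  have degs: "\<forall>\<chi>\<in>fam6 G x q \<sigma>. ?deg \<chi> = of_nat (q ^ 4)" "\<forall>\<chi>\<in>fam5 G x q \<sigma>. ?deg \<chi> = of_nat (q ^ 3)"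
    "\<forall>\<chi>\<in>fam3 G x q \<sigma>. ?deg \<chi> = of_nat q" "\<forall>\<chi>\<in>fam_lin G x q \<sigma>. ?deg \<chi> = 1"
    using deg[OF P(1), of "\<lambda>d. d = of_nat (q ^ 4)"] deg[OF P(2), of "\<lambda>d. d = of_nat (q ^ 3)"]
      deg[OF P(4), of "\<lambda>d. d = of_nat q"] deg[OF P(5), of "\<lambda>d. d = 1"] famU_degrees(1,2,5,6) by blast+
  have ex:
    "\<exists>\<chi>6 :: 'f \<times> 'f \<Rightarrow> 'g \<Rightarrow> complex. bij_betw \<chi>6 ((Fq q - {0}) \<times> UNIV) (fam6 G x q \<sigma>)"
    "\<exists>\<chi>5 :: 'f \<times> 'f \<times> 'f \<Rightarrow> 'g \<Rightarrow> complex. bij_betw \<chi>5 ((Fq q - {0}) \<times> Fq q \<times> UNIV) (fam5 G x q \<sigma>)"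
    "\<exists>\<chi>3 :: 'f \<times> 'f set \<Rightarrow> 'g \<Rightarrow> complex. bij_betw \<chi>3 ((UNIV - {0}) \<times> F_mod_Fq q) (fam3 G x q \<sigma>)"
    "\<exists>\<chi>lin :: 'f \<times> 'f \<Rightarrow> 'g \<Rightarrow> complex. bij_betw \<chi>lin (UNIV \<times> Fq q) (fam_lin G x q \<sigma>)"
    using B6(1) B5(1) B3(1) B1(1) by blast+
  show ?thesis
    by (intro conjI irr disjoint ex B6(2) B5(2) B3(2) B1(2) degs impI[OF odd] impI[OF even])
qed

end
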